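(* Let $\alpha\in(0,1)$. Let $H\in C^2(\mathbb{R}^2;\mathbb{R})$ be radial, $H(p)=h(|p|)$, with $h(s)=1+\frac{A}{s^\gamma}+\frac{\tilde h(s)}{s^{\gamma+\beta}}$ for all large $s$, where $A>0$, $\gamma>1$, $\beta\ge0$, $\tilde h\in C^2((0,+\infty);\mathbb{R})$, and: if $\beta>1$, $\tilde h$ is bounded; if $\beta\in(0,1]$, $\tilde h(s)=B+o(s^{\beta-1})$ for some $B\in\mathbb{R}$; if $\beta=0$, $\tilde h(s)=B+o(s^{-1})$ with $B>-A$; and $|h''(s)|\le C s^{-(\gamma+1+\min\{1,\beta\})}$ for some $C>0$ and all large $s$. Then there exist $\bar n\ge2$, $\bar M>0$, a sequence $(R_n)\subset\mathbb{R}$ and a sequence $(\phi_n)$ with $\phi_n\in C^{2,\alpha}$ and $\phi_n$ periodic of period $2\pi\frac{n}{n-1}$, such that for every $n\ge\bar n$: $R_n=(r_nn)^{1/(\gamma+2)}$ with $r_n\in(r_0,r_1)$ for some $0<r_0<r_1$ (independent of $n$); $\|\phi_n\|_{C^{2,\alpha}}\le\bar M n^{-\gamma/(\gamma+2)}$; and $\mathcal{K}(U_{n,R_n}+\phi_n\mathbf{N}_{n,R_n})=H(U_{n,R_n}+\phi_n\mathbf{N}_{n,R_n})$ on $\mathbb{R}$.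
   Context: Identify $\mathbb{R}^2$ with $\mathbb{C}$ ($ip$ is rotation by $\pi/2$, $e^{i\theta}=(\cos\theta,\sin\theta)$). For $n\in\mathbb{N}$, $R>0$: $U_{n,R}(t)=Re^{it/n}+e^{it}$ and $\mathbf{N}_{n,R}=\frac{i\dot U_{n,R}}{|\dot U_{n,R}|}$. For a regular $C^2$ curve $U$, $\mathcal{K}(U)=\frac{i\dot U\cdot\ddot U}{|\dot U|^3}$. The norm $\|\phi\|_{C^{2,\alpha}}$ of a periodic function is the $C^{2,\alpha}$ norm computed over one period (sup norms of $\phi,\phi',\phi''$ plus the $\alpha$-Hölder seminorm of $\phi''$). *)

theory Defs
  imports "HOL-Analysis.Analysis" "HOL-Library.Landau_Symbols"
begin

definition U_curve :: "nat \<Rightarrow> real \<Rightarrow> real \<Rightarrow> complex" where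
  "U_curve n R t = of_real R * cis (t / real n) + cis t"

definition N_normal :: "nat \<Rightarrow> real \<Rightarrow> real \<Rightarrow> complex" where
  "N_normal n R t = \<i> * vector_derivative (U_curve n R) (at t)
                     / of_real (cmod (vector_derivative (U_curve n R) (at t)))"

definition curvature :: "(real \<Rightarrow> complex) \<Rightarrow> real \<Rightarrow> real" where
  "curvature V t =
     ((\<i> * vector_derivative V (at t)) \<bullet>
        vector_derivative (\<lambda>s. vector_derivative V (at s)) (at t))
     / (cmod (vector_derivative V (at t))) ^ 3"

definition regular_C2_curve :: "(real \<Rightarrow> complex) \<Rightarrow> bool" where
  "regular_C2_curve V \<longleftrightarrow>
     (\<exists>V1. (\<forall>t. (V has_vector_derivative V1 t) (at t)) \<and> V1 C1_differentiable_on UNIV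
           \<and> (\<forall>t. V1 t \<noteq> 0))"

definition C2_plane :: "(complex \<Rightarrow> real) \<Rightarrow> bool" where
  "C2_plane H \<longleftrightarrow>
     (\<exists>(DH :: complex \<Rightarrow> complex \<Rightarrow>\<^sub>L real) (D2H :: complex \<Rightarrow> complex \<Rightarrow>\<^sub>L (complex \<Rightarrow>\<^sub>L real)).
        (\<forall>p. (H has_derivative blinfun_apply (DH p)) (at p)) \<and>
        (\<forall>p. (DH has_derivative blinfun_apply (D2H p)) (at p)) \<and>
        continuous_on UNIV D2H)"

definition C2_on :: "(real \<Rightarrow> real) \<Rightarrow> real set \<Rightarrow> bool" where
  "C2_on f S \<longleftrightarrow>
     (\<exists>f1. (\<forall>x\<in>S. (f has_real_derivative f1 x) (at x)) \<and> f1 C1_differentiable_on S)"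

definition C2alpha_periodic :: "real \<Rightarrow> real \<Rightarrow> (real \<Rightarrow> real) \<Rightarrow> bool" where
  "C2alpha_periodic \<alpha> T \<phi> \<longleftrightarrow>
     (\<forall>t. \<phi> (t + T) = \<phi> t) \<and>
     (\<exists>\<phi>1 \<phi>2. (\<forall>t. (\<phi> has_real_derivative \<phi>1 t) (at t)) \<and>
              (\<forall>t. (\<phi>1 has_real_derivative \<phi>2 t) (at t)) \<and>
              (\<exists>L. \<forall>s t. \<bar>\<phi>2 s - \<phi>2 t\<bar> \<le> L * \<bar>s - t\<bar> powr \<alpha>))"

definition C2alpha_norm :: "real \<Rightarrow> real \<Rightarrow> (real \<Rightarrow> real) \<Rightarrow> real" where
  "C2alpha_norm \<alpha> T \<phi> =
     (SUP t\<in>{0..T}. \<bar>\<phi> t\<bar>) + (SUP t\<in>{0..T}. \<bar>deriv \<phi> t\<bar>)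
     + (SUP t\<in>{0..T}. \<bar>deriv (deriv \<phi>) t\<bar>)
     + (SUP st\<in>{(s, t). s \<in> {0..T} \<and> t \<in> {0..T} \<and> s \<noteq> t}.
          \<bar>deriv (deriv \<phi>) (fst st) - deriv (deriv \<phi>) (snd st)\<bar> / \<bar>fst st - snd st\<bar> powr \<alpha>)"

end

theory Submission
  imports Defs
begin

text \<open>In the frame rotating with \<open>cis (t/n)\<close> and in the time \<open>\<tau> = (1 - 1/n) t\<close>, the curve
  \<open>U + \<phi> N\<close> has prescribed curvature iff \<open>\<phi>'' + \<phi> = Q\<close> with
  \<open>Q = (h - 1) + 2 \<delta> cos \<tau> + (quadratically small terms)\<close>, \<open>\<delta> = R/n\<close>, where \<open>h\<close> is evaluated at the
  distance of the curve from the origin. All data are \<open>2\<pi>\<close>-periodic and even in \<open>\<tau>\<close>, so the kernel of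
  \<open>\<phi>'' + \<phi>\<close> is spanned by \<open>cos\<close>. Modulo \<open>cos\<close> the equation is solved by the contraction principle,
  with \<open>\<phi> = O(R powr -\<gamma>)\<close>. The remaining scalar equation is
  \<open>2 R/n - \<gamma> A' R powr (-\<gamma>-1) + o(R powr (-\<gamma>-1)) = 0\<close> (the square of \<open>\<phi>\<close> is negligible because
  \<open>\<gamma> > 1\<close>), and it is solved by the intermediate value theorem for some \<open>R\<close> with
  \<open>R powr (\<gamma>+2) / n\<close> between \<open>\<gamma> A' / 4\<close> and \<open>\<gamma> A'\<close>. Here \<open>A' = A\<close> unless \<open>\<beta> = 0\<close>, when \<open>A' = A + B\<close>.\<close>

section \<open>Functions of second order at the origin\<close>

text \<open>The difficulty is one of orders. The source of the oscillator is dominated by the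
  constant \<open>h R - 1\<close> of order R^(-\<gamma>), while the solvability condition lives at
  order R^(-\<gamma>-1), so every error in it must be o(R^(-\<gamma>-1)). The constant is orthogonal
  to cos and drops out. The term with \<gamma> A' comes from the distance R + cos \<tau> + O(1/R) of
  the unperturbed curve from the origin: expanding h about R turns the cos of the distance into a
  cos of the source. The response of h to \<phi> costs only the product of its Lipschitz constant
  O(R^(-\<gamma>-1)) with the size of \<phi>. The curvature equation is solved algebraically for
  \<phi>'', so its right-hand side involves only \<phi> and \<phi>'. The unknown of the contraction
  can therefore be the source instead of \<phi>: a single sup norm suffices, and the derivatives are
  recovered from an explicit solution operator. The Hoelder bound comes last, because the equation
  makes its own source Lipschitz in time.\<close>

definition lip :: "('a::real_normed_vector \<Rightarrow> real) \<Rightarrow> bool" where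
  "lip f \<longleftrightarrow> (\<lambda>u. f (fst u) - f (snd u)) \<in> O[nhds 0](\<lambda>u. norm (fst u - snd u))"

text \<open>Two-point form of a second-order remainder: the local Lipschitz constant shrinks
  linearly towards the origin, while the value there is left free. A bound by the square of the norm
  would control size but not differences, which the contraction needs. Both \<open>lip\<close> and
  \<open>quad\<close> are Landau classes over pairs tending to the origin, so radii and constants
  are left to the calculus of O.\<close>

definition quad :: "('a::real_normed_vector \<Rightarrow> real) \<Rightarrow> bool" where
  "quad f \<longleftrightarrow> (\<lambda>u. f (fst u) - f (snd u))
     \<in> O[nhds 0](\<lambda>u. (norm (fst u) + norm (snd u)) * norm (fst u - snd u))"

lemma filterlim_fst_nhds_0: "filterlim fst (nhds (0::'a::real_normed_vector)) (nhds (0::'a \<times> 'a))"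
  and filterlim_snd_nhds_0: "filterlim snd (nhds (0::'a::real_normed_vector)) (nhds (0::'a \<times> 'a))"
proof -
  have "filterlim (\<lambda>u::'a\<times>'a. fst u) (nhds (fst (0::'a\<times>'a))) (nhds 0)"
    by (intro tendsto_fst filterlim_ident)
  thus "filterlim fst (nhds (0::'a)) (nhds (0::'a \<times> 'a))" by simp
  have "filterlim (\<lambda>u::'a\<times>'a. snd u) (nhds (snd (0::'a\<times>'a))) (nhds 0)"
    by (intro tendsto_snd filterlim_ident)
  thus "filterlim snd (nhds (0::'a)) (nhds (0::'a \<times> 'a))" by simp
qed

lemma lip_const: "lip (\<lambda>_. c)"
  by (simp add: lip_def)

lemma lip_bounded_linear:
  assumes "bounded_linear f" shows "lip f"
proof -
  obtain K where K: "\<And>x. norm (f x) \<le> norm x * K"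
    using bounded_linear.bounded[OF assms] by blast
  show ?thesis unfolding lip_def
  proof (rule bigoI[of _ K], rule always_eventually, rule allI)
    fix u :: "'a \<times> 'a"
    show "norm (f (fst u) - f (snd u)) \<le> K * norm (norm (fst u - snd u))"
      using K[of "fst u - snd u"] by (simp add: bounded_linear.linear[OF assms] linear_diff mult.commute)
  qed
qed

lemma lip_add: "lip f \<Longrightarrow> lip g \<Longrightarrow> lip (\<lambda>x. f x + g x)"
  unfolding lip_def by (drule (1) sum_in_bigo(1)) (simp add: algebra_simps)

lemma lip_minus: "lip f \<Longrightarrow> lip (\<lambda>x. - f x)"
  unfolding lip_def
  by (subst (asm) landau_o.big.uminus_in_iff[symmetric]) (simp add: algebra_simps)

lemma lip_diff: "lip f \<Longrightarrow> lip g \<Longrightarrow> lip (\<lambda>x. f x - g x)"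
  using lip_add[OF _ lip_minus[of g], of f] by simp

lemma quad_add: "quad f \<Longrightarrow> quad g \<Longrightarrow> quad (\<lambda>x. f x + g x)"
  unfolding quad_def by (drule (1) sum_in_bigo(1)) (simp add: algebra_simps)

lemma quad_minus: "quad f \<Longrightarrow> quad (\<lambda>x. - f x)"
  unfolding quad_def
  by (subst (asm) landau_o.big.uminus_in_iff[symmetric]) (simp add: algebra_simps)

lemma quad_diff: "quad f \<Longrightarrow> quad g \<Longrightarrow> quad (\<lambda>x. f x - g x)"
  using quad_add[OF _ quad_minus[of g], of f] by simp

lemma lip_bigo_0:
  assumes "lip f" shows "(\<lambda>x. f x - f 0) \<in> O[nhds 0](norm)"
proof -
  have "filterlim (\<lambda>x::'a. (x, 0::'a)) (nhds (0, 0)) (nhds 0)"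
    by (intro tendsto_Pair filterlim_ident tendsto_const)
  hence "filterlim (\<lambda>x::'a. (x, 0::'a)) (nhds 0) (nhds 0)" by (simp add: zero_prod_def)
  from landau_o.big.compose[OF assms[unfolded lip_def] this] show ?thesis by simp
qed

lemma lip_tendsto:
  assumes "lip f" shows "(f \<longlongrightarrow> f 0) (nhds 0)"
proof -
  obtain c where "\<forall>\<^sub>F x in nhds 0. norm (f x - f 0) \<le> c * norm (norm x)"
    using lip_bigo_0[OF assms] by (rule landau_o.bigE)
  moreover have "((\<lambda>x::'a. c * norm (norm x)) \<longlongrightarrow> 0) (nhds 0)"
    by (intro tendsto_mult_right_zero) (use tendsto_norm[OF filterlim_ident, of "0::'a"] in simp)
  ultimately have "((\<lambda>x. f x - f 0) \<longlongrightarrow> 0) (nhds 0)"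
    by (rule Lim_null_comparison)
  thus ?thesis using LIM_zero_cancel by blast
qed

lemma tendsto_imp_bigo_1:
  fixes f :: "'b \<Rightarrow> real"
  assumes "(f \<longlongrightarrow> c) F" shows "f \<in> O[F](\<lambda>_. 1)"
  using assms by (intro bigoI_tendsto[where c = c]) (simp_all only: div_by_1, simp)

lemma lip_bigo_1:
  fixes f :: "'a::real_normed_vector \<Rightarrow> real"
  assumes "lip f"
  shows "(\<lambda>u. f (fst u)) \<in> O[nhds (0::'a\<times>'a)](\<lambda>_. 1)" "(\<lambda>u. f (snd u)) \<in> O[nhds (0::'a\<times>'a)](\<lambda>_. 1)"
  by (rule tendsto_imp_bigo_1 filterlim_compose[OF lip_tendsto[OF assms] filterlim_fst_nhds_0]
        filterlim_compose[OF lip_tendsto[OF assms] filterlim_snd_nhds_0])+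

lemma lip0_bigo:
  fixes f :: "'a::real_normed_vector \<Rightarrow> real"
  assumes "lip f" "f 0 = 0"
  shows "(\<lambda>u. f (fst u)) \<in> O[nhds 0](\<lambda>u::'a\<times>'a. norm (fst u) + norm (snd u))"
    and "(\<lambda>u. f (snd u)) \<in> O[nhds 0](\<lambda>u::'a\<times>'a. norm (fst u) + norm (snd u))"
proof -
  have f: "f \<in> O[nhds 0](norm)" using lip_bigo_0[OF assms(1)] assms(2) by simp
  have "(\<lambda>u. f (fst u)) \<in> O[nhds 0](\<lambda>u::'a\<times>'a. norm (fst u))"
    by (rule landau_o.big.compose[OF f filterlim_fst_nhds_0])
  also have "(\<lambda>u::'a\<times>'a. norm (fst u)) \<in> O[nhds 0](\<lambda>u. norm (fst u) + norm (snd u))"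
    by (rule bigoI[of _ 1]) (auto intro!: always_eventually)
  finally show "(\<lambda>u. f (fst u)) \<in> O[nhds 0](\<lambda>u::'a\<times>'a. norm (fst u) + norm (snd u))" .
  have "(\<lambda>u. f (snd u)) \<in> O[nhds 0](\<lambda>u::'a\<times>'a. norm (snd u))"
    by (rule landau_o.big.compose[OF f filterlim_snd_nhds_0])
  also have "(\<lambda>u::'a\<times>'a. norm (snd u)) \<in> O[nhds 0](\<lambda>u. norm (fst u) + norm (snd u))"
    by (rule bigoI[of _ 1]) (auto intro!: always_eventually)
  finally show "(\<lambda>u. f (snd u)) \<in> O[nhds 0](\<lambda>u::'a\<times>'a. norm (fst u) + norm (snd u))" .
qed

text \<open>Discrete product rule: f(u)g(u) - f(v)g(v) = f(u)(g(u) - g(v)) + (f(u) - f(v))g(v),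
  where the undifferenced factors are bounded near the origin. The next two lemmas reuse this
  splitting.\<close>

lemma lip_mult:
  fixes f g :: "'a::real_normed_vector \<Rightarrow> real"
  assumes "lip f" "lip g" shows "lip (\<lambda>x. f x * g x)"
proof -
  have "(\<lambda>u. f (fst u) * (g (fst u) - g (snd u)) + (f (fst u) - f (snd u)) * g (snd u))
          \<in> O[nhds 0](\<lambda>u::'a\<times>'a. norm (fst u - snd u))"
    using landau_o.big.mult[OF lip_bigo_1(1)[OF assms(1)] assms(2)[unfolded lip_def]]
      landau_o.big.mult[OF assms(1)[unfolded lip_def] lip_bigo_1(2)[OF assms(2)]]
    by (intro sum_in_bigo(1)) simp_all
  thus ?thesis unfolding lip_def by (simp add: algebra_simps)
qed

lemma quad_mult:
  fixes f g :: "'a::real_normed_vector \<Rightarrow> real"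
  assumes "lip f" "lip g" "f 0 = 0" "g 0 = 0" shows "quad (\<lambda>x. f x * g x)"
proof -
  have "(\<lambda>u. f (fst u) * (g (fst u) - g (snd u)) + (f (fst u) - f (snd u)) * g (snd u))
          \<in> O[nhds 0](\<lambda>u::'a\<times>'a. (norm (fst u) + norm (snd u)) * norm (fst u - snd u))"
    using landau_o.big.mult[OF lip0_bigo(1)[OF assms(1,3)] assms(2)[unfolded lip_def]]
      landau_o.big.mult[OF lip0_bigo(2)[OF assms(2,4)] assms(1)[unfolded lip_def]]
    by (intro sum_in_bigo(1)) (simp_all add: mult_ac)
  thus ?thesis unfolding quad_def by (simp add: algebra_simps)
qed

text \<open>In the summand where f is differenced, the factor g(v) is O(norm v) because g vanishes
  at the origin; this supplies the second small factor.\<close>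

lemma lip_quad_mult:
  fixes f g :: "'a::real_normed_vector \<Rightarrow> real"
  assumes "lip f" "quad g" "lip g" "g 0 = 0" shows "quad (\<lambda>x. f x * g x)"
proof -
  have "(\<lambda>u. f (fst u) * (g (fst u) - g (snd u)) + (f (fst u) - f (snd u)) * g (snd u))
          \<in> O[nhds 0](\<lambda>u::'a\<times>'a. (norm (fst u) + norm (snd u)) * norm (fst u - snd u))"
    using landau_o.big.mult[OF lip_bigo_1(1)[OF assms(1)] assms(2)[unfolded quad_def]]
      landau_o.big.mult[OF lip0_bigo(2)[OF assms(3,4)] assms(1)[unfolded lip_def]]
    by (intro sum_in_bigo(1)) (simp_all add: mult_ac)
  thus ?thesis unfolding quad_def by (simp add: algebra_simps)
qed

lemma eventually_nhds_0_pair: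
  fixes P :: "'a::real_normed_vector \<Rightarrow> bool"
  assumes "\<forall>\<^sub>F x in nhds 0. P x"
  shows "\<forall>\<^sub>F u in nhds (0::'a\<times>'a). P (fst u) \<and> P (snd u)"
  using eventually_compose_filterlim[OF assms filterlim_fst_nhds_0]
    eventually_compose_filterlim[OF assms filterlim_snd_nhds_0] by eventually_elim simp

lemma lip_inverse:
  fixes f :: "'a::real_normed_vector \<Rightarrow> real"
  assumes "lip f" "f 0 \<noteq> 0" shows "lip (\<lambda>x. inverse (f x))"
proof -
  have lim: "((\<lambda>x. inverse (f x)) \<longlongrightarrow> inverse (f 0)) (nhds 0)"
    by (intro tendsto_inverse lip_tendsto assms)
  have "((\<lambda>u. inverse (f (fst u))) \<longlongrightarrow> inverse (f 0)) (nhds (0::'a\<times>'a))"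
       "((\<lambda>u. inverse (f (snd u))) \<longlongrightarrow> inverse (f 0)) (nhds (0::'a\<times>'a))"
    by (rule filterlim_compose[OF lim filterlim_fst_nhds_0]
        filterlim_compose[OF lim filterlim_snd_nhds_0])+
  hence "((\<lambda>u. - (inverse (f (fst u)) * inverse (f (snd u)))) \<longlongrightarrow> - (inverse (f 0) * inverse (f 0)))
      (nhds (0::'a\<times>'a))" by (intro tendsto_minus tendsto_mult)
  hence "(\<lambda>u. - (inverse (f (fst u)) * inverse (f (snd u)))) \<in> O[nhds (0::'a\<times>'a)](\<lambda>_. 1)"
    by (rule tendsto_imp_bigo_1)
  from landau_o.big.mult[OF this assms(1)[unfolded lip_def]]
  have *: "(\<lambda>u. - (inverse (f (fst u)) * inverse (f (snd u))) * (f (fst u) - f (snd u)))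
      \<in> O[nhds (0::'a\<times>'a)](\<lambda>u. norm (fst u - snd u))" by simp
  have "\<forall>\<^sub>F x in nhds 0. f x \<noteq> 0"
    using lip_tendsto[OF assms(1)] assms(2) by (rule tendsto_imp_eventually_ne)
  from eventually_nhds_0_pair[OF this]
  have "\<forall>\<^sub>F u in nhds (0::'a\<times>'a). inverse (f (fst u)) - inverse (f (snd u))
     = - (inverse (f (fst u)) * inverse (f (snd u))) * (f (fst u) - f (snd u))"
    by eventually_elim (auto simp: field_simps)
  from landau_o.big.in_cong[OF this] * show ?thesis unfolding lip_def by simp
qed

lemma lip_divide: "lip f \<Longrightarrow> lip g \<Longrightarrow> g 0 \<noteq> 0 \<Longrightarrow> lip (\<lambda>x. f x / g x)"
  unfolding divide_inverse by (intro lip_mult lip_inverse)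

lemma lip_sqrt:
  fixes f :: "'a::real_normed_vector \<Rightarrow> real"
  assumes "lip f" "f 0 > 0" shows "lip (\<lambda>x. sqrt (f x))"
proof -
  have lim: "((\<lambda>x. sqrt (f x)) \<longlongrightarrow> sqrt (f 0)) (nhds 0)"
    by (intro tendsto_real_sqrt lip_tendsto assms)
  have "((\<lambda>u. sqrt (f (fst u))) \<longlongrightarrow> sqrt (f 0)) (nhds (0::'a\<times>'a))"
       "((\<lambda>u. sqrt (f (snd u))) \<longlongrightarrow> sqrt (f 0)) (nhds (0::'a\<times>'a))"
    by (rule filterlim_compose[OF lim filterlim_fst_nhds_0]
        filterlim_compose[OF lim filterlim_snd_nhds_0])+
  hence "((\<lambda>u. inverse (sqrt (f (fst u)) + sqrt (f (snd u)))) \<longlongrightarrow> inverse (sqrt (f 0) + sqrt (f 0)))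
      (nhds (0::'a\<times>'a))" using assms(2) by (intro tendsto_inverse tendsto_add) auto
  hence "(\<lambda>u. inverse (sqrt (f (fst u)) + sqrt (f (snd u)))) \<in> O[nhds (0::'a\<times>'a)](\<lambda>_. 1)"
    by (rule tendsto_imp_bigo_1)
  from landau_o.big.mult[OF this assms(1)[unfolded lip_def]]
  have *: "(\<lambda>u. inverse (sqrt (f (fst u)) + sqrt (f (snd u))) * (f (fst u) - f (snd u)))
      \<in> O[nhds (0::'a\<times>'a)](\<lambda>u. norm (fst u - snd u))" by simp
  have "\<forall>\<^sub>F x in nhds 0. f x > 0"
    using lip_tendsto[OF assms(1)] assms(2) by (rule order_tendstoD)
  from eventually_nhds_0_pair[OF this]
  have "\<forall>\<^sub>F u in nhds (0::'a\<times>'a). sqrt (f (fst u)) - sqrt (f (snd u))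
     = inverse (sqrt (f (fst u)) + sqrt (f (snd u))) * (f (fst u) - f (snd u))"
  proof eventually_elim
    case (elim u)
    have "sqrt (f (fst u)) + sqrt (f (snd u)) > 0" using elim by (simp add: add_pos_pos)
    moreover have "(sqrt (f (fst u)) + sqrt (f (snd u))) * (sqrt (f (fst u)) - sqrt (f (snd u)))
        = f (fst u) - f (snd u)" using elim by (simp add: algebra_simps)
    ultimately show ?case by (simp add: field_simps)
  qed
  from landau_o.big.in_cong[OF this] * show ?thesis unfolding lip_def by simp
qed

lemma quad_cong:
  fixes f :: "'a::real_normed_vector \<Rightarrow> real"
  assumes "\<forall>\<^sub>F x in nhds 0. f x = g x" "quad g" shows "quad f"
proof -
  from eventually_nhds_0_pair[OF assms(1)]
  have "\<forall>\<^sub>F u in nhds (0::'a\<times>'a). f (fst u) - f (snd u) = g (fst u) - g (snd u)"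
    by eventually_elim simp
  from landau_o.big.in_cong[OF this] assms(2) show ?thesis unfolding quad_def by simp
qed

lemma quadE:
  fixes f :: "'a::real_normed_vector \<Rightarrow> real"
  assumes "quad f"
  obtains K r where "K > 0" "r > 0"
    "\<And>v w. norm v \<le> r \<Longrightarrow> norm w \<le> r \<Longrightarrow> \<bar>f v - f w\<bar> \<le> K * (norm v + norm w) * norm (v - w)"
proof -
  obtain K where "K > 0" and K: "\<forall>\<^sub>F u in nhds (0::'a\<times>'a). norm (f (fst u) - f (snd u))
      \<le> K * norm ((norm (fst u) + norm (snd u)) * norm (fst u - snd u))"
    using assms[unfolded quad_def] by (rule landau_o.bigE)
  then obtain e where "e > 0" and e: "\<And>u::'a\<times>'a. dist u 0 < e \<Longrightarrow> norm (f (fst u) - f (snd u))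
      \<le> K * norm ((norm (fst u) + norm (snd u)) * norm (fst u - snd u))"
    unfolding eventually_nhds_metric by blast
  show thesis
  \<comment> \<open>A third, not a half: the norm of the pair is at most the sum of the two norms,
    hence at most 2e/3, strictly inside the ball of radius e.\<close>
  proof (rule that[of K "e/3"])
    fix v w :: 'a assume vw: "norm v \<le> e/3" "norm w \<le> e/3"
    have "norm (v, w) \<le> norm v + norm w" by (rule norm_Pair_le)
    hence "dist (v, w) 0 < e" using vw \<open>e > 0\<close> unfolding dist_norm by simp
    from e[OF this] show "\<bar>f v - f w\<bar> \<le> K * (norm v + norm w) * norm (v - w)"
      by (simp add: abs_mult mult.assoc)
  qed (use \<open>K > 0\<close> \<open>e > 0\<close> in auto)
qed

section \<open>Expansion of the graph equation\<close>

lemma quad_imp_lip: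
  fixes f :: "'a::real_normed_vector \<Rightarrow> real"
  assumes "quad f" shows "lip f"
proof -
  have "((\<lambda>u::'a\<times>'a. norm (fst u) + norm (snd u)) \<longlongrightarrow> norm (0::'a) + norm (0::'a)) (nhds 0)"
    by (intro tendsto_add tendsto_norm filterlim_fst_nhds_0 filterlim_snd_nhds_0)
  from landau_o.big.mult[OF tendsto_imp_bigo_1[OF this] landau_o.big_refl]
  have "(\<lambda>u::'a\<times>'a. (norm (fst u) + norm (snd u)) * norm (fst u - snd u)) \<in> O[nhds 0](\<lambda>u. norm (fst u - snd u))"
    by simp
  from landau_o.big_trans[OF assms[unfolded quad_def] this] show ?thesis unfolding lip_def .
qed

section \<open>The curvature equation as a function of seven small variables\<close>

type_synonym vars = "real \<times> real \<times> real \<times> real \<times> real \<times> real \<times> real"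

text \<open>The variables stand for
  \<open>(\<delta> cos \<tau>, \<delta>, \<delta> sin \<tau>, 1/n, \<phi>, d\<phi>/d\<tau>, h - 1)\<close>
  with \<open>\<delta> = R/n\<close>, \<open>\<tau> = (1 - 1/n) t\<close>. Including \<open>\<delta> cos \<tau>\<close> and \<open>\<delta> sin \<tau>\<close> themselves removes all other
  dependence on \<open>\<tau>\<close>, so one expansion at the origin covers all times.\<close>

definition var_g :: "vars \<Rightarrow> real" where "var_g w = fst w"
definition var_d :: "vars \<Rightarrow> real" where "var_d w = fst (snd w)"
definition var_k :: "vars \<Rightarrow> real" where "var_k w = fst (snd (snd w))"
definition omega :: "vars \<Rightarrow> real" where "omega w = 1 - fst (snd (snd (snd w)))"
definition var_x :: "vars \<Rightarrow> real" where "var_x w = fst (snd (snd (snd (snd w))))"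
definition var_y :: "vars \<Rightarrow> real" where "var_y w = fst (snd (snd (snd (snd (snd w)))))"
definition var_e :: "vars \<Rightarrow> real" where "var_e w = snd (snd (snd (snd (snd (snd w)))))"

text \<open>Squared speed of the unperturbed curve in the time t, the squared modulus of \<delta> +
  cis \<tau>. The quantities below also refer to t; only \<open>var_y\<close> is a derivative in
  \<tau>, whence the factors \<open>omega\<close>.\<close>

definition speed2 :: "vars \<Rightarrow> real" where "speed2 w = 1 + 2 * var_g w + var_d w * var_d w"
definition speed :: "vars \<Rightarrow> real" where "speed w = sqrt (speed2 w)"
text \<open>Angular velocity of the unit tangent of the unperturbed curve: the t-derivative of the
  tangent is \<i> \<open>turn\<close> times the tangent.\<close>

definition turn :: "vars \<Rightarrow> real" where
  "turn w = 1 - omega w * (var_g w + var_d w * var_d w) / speed2 w"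
text \<open>Closed forms, here and in \<open>dturn\<close>, of the t-derivatives of
  \<open>speed\<close> and \<open>turn\<close>. They are functions of the same variables, so the
  equation closes up.\<close>

definition dspeed :: "vars \<Rightarrow> real" where "dspeed w = - (omega w * var_k w / speed w)"
definition dturn :: "vars \<Rightarrow> real" where
  "dturn w = omega w * omega w * (1 - var_d w * var_d w) * var_k w / (speed2 w * speed2 w)"
text \<open>With \<open>norml\<close>, the components of the velocity of the graph curve along the
  unit tangent T and along \<i> T.\<close>

definition tang :: "vars \<Rightarrow> real" where "tang w = speed w - turn w * var_x w"
definition norml :: "vars \<Rightarrow> real" where "norml w = omega w * var_y w"
definition vel2 :: "vars \<Rightarrow> real" where "vel2 w = tang w * tang w + norml w * norml w"
text \<open>The second t-derivative of \<phi>, found by solving the curvature formula for it when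
  the curvature is set to \<open>1 + var_e\<close>. Near the origin the divisor \<open>tang\<close>
  is close to 1.\<close>

definition accel :: "vars \<Rightarrow> real" where
  "accel w = (vel2 w * (sqrt (vel2 w) * (1 + var_e w) - turn w) + norml w * (dspeed w - dturn w * var_x w)
              - turn w * norml w * norml w) / tang w"
definition linpart :: "vars \<Rightarrow> real" where "linpart w = var_e w + 2 * var_g w - var_x w"
text \<open>Division by the square of \<open>omega\<close> passes from t to \<tau>. The subtracted
  linear part contains \<open>- var_x\<close>, the restoring force that makes the oscillator
  resonant with cos.\<close>

definition resid :: "vars \<Rightarrow> real" where "resid w = accel w / (omega w * omega w) - linpart w"

lemma vars_at_0 [simp]:
  "var_g 0 = 0" "var_d 0 = 0" "var_k 0 = 0" "omega 0 = 1" "var_x 0 = 0" "var_y 0 = 0" "var_e 0 = 0"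
  "speed2 0 = 1" "speed 0 = 1" "turn 0 = 1" "dspeed 0 = 0" "dturn 0 = 0" "tang 0 = 1" "norml 0 = 0"
  "vel2 0 = 1" "accel 0 = 0" "linpart 0 = 0" "resid 0 = 0"
  by (simp_all add: var_g_def var_d_def var_k_def omega_def var_x_def var_y_def var_e_def speed2_def
    speed_def turn_def dspeed_def dturn_def tang_def norml_def vel2_def accel_def linpart_def resid_def)

lemma lip_vars:
  "lip var_g" "lip var_d" "lip var_k" "lip omega" "lip var_x" "lip var_y" "lip var_e"
  unfolding var_g_def[abs_def] var_d_def[abs_def] var_k_def[abs_def] omega_def[abs_def] var_x_def[abs_def]
    var_y_def[abs_def] var_e_def[abs_def]
  by (intro lip_diff lip_const lip_bounded_linear bounded_linear_fst_comp bounded_linear_snd_comp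
      bounded_linear_fst bounded_linear_snd bounded_linear_ident)+

lemmas lip_arith = lip_const lip_add lip_minus lip_diff lip_mult lip_divide lip_sqrt lip_vars

lemma lip_speed2: "lip speed2" unfolding speed2_def[abs_def] by (intro lip_arith)
lemma lip_speed: "lip speed" unfolding speed_def[abs_def] by (intro lip_arith lip_speed2) simp
lemma lip_turn: "lip turn" unfolding turn_def[abs_def] by (intro lip_arith lip_speed2) simp
lemma lip_dspeed: "lip dspeed" unfolding dspeed_def[abs_def] by (intro lip_arith lip_speed) simp
lemma lip_dturn: "lip dturn" unfolding dturn_def[abs_def] by (intro lip_arith lip_speed2) simp
lemma lip_tang: "lip tang" unfolding tang_def[abs_def] by (intro lip_arith lip_speed lip_turn)
lemma lip_norml: "lip norml" unfolding norml_def[abs_def] by (intro lip_arith)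
lemma lip_vel2: "lip vel2" unfolding vel2_def[abs_def] by (intro lip_arith lip_tang lip_norml)
lemma lip_accel: "lip accel"
  unfolding accel_def[abs_def]
  by (intro lip_arith lip_vel2 lip_turn lip_norml lip_dspeed lip_dturn lip_tang) simp_all
lemma lip_linpart: "lip linpart" unfolding linpart_def[abs_def] by (intro lip_arith)

lemmas lip_all = lip_arith lip_speed2 lip_speed lip_turn lip_dspeed lip_dturn lip_tang lip_norml lip_vel2
  lip_accel lip_linpart

lemma lip_ev_pos:
  assumes "lip f" "f 0 > 0" shows "\<forall>\<^sub>F x in nhds 0. f x > 0"
  using lip_tendsto[OF assms(1)] assms(2) by (rule order_tendstoD)

lemma speed2_ev_pos: "\<forall>\<^sub>F w in nhds 0. speed2 w > 0"
  and tang_ev_pos: "\<forall>\<^sub>F w in nhds 0. tang w > 0"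
  by (intro lip_ev_pos lip_all; simp)+

lemma quad_divide:
  fixes f g :: "'a::real_normed_vector \<Rightarrow> real"
  assumes "quad f" "f 0 = 0" "lip g" "g 0 \<noteq> 0" shows "quad (\<lambda>x. f x / g x)"
  using lip_quad_mult[OF lip_inverse[OF assms(3,4)] assms(1) quad_imp_lip[OF assms(1)] assms(2)]
  by (simp add: divide_inverse mult.commute)

text \<open>From speed^2 - 1 = 2g + d^2 follows (speed - 1 - g)(speed + 1) = g(1 - speed) + d^2, a
  sum of products of factors that vanish at the origin.\<close>

lemma quad_speed: "quad (\<lambda>w. speed w - 1 - var_g w)"
proof (rule quad_cong)
  show "\<forall>\<^sub>F w in nhds 0. speed w - 1 - var_g w
      = (var_g w * (1 - speed w) + var_d w * var_d w) / (speed w + 1)"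
  proof (rule eventually_mono[OF speed2_ev_pos])
    fix w assume w: "speed2 w > 0"
    hence "speed w * speed w = 1 + 2 * var_g w + var_d w * var_d w" "speed w + 1 \<noteq> 0"
      using real_sqrt_gt_zero[OF w] by (simp_all add: speed_def add_pos_pos less_imp_neq[symmetric] speed2_def)
    thus "speed w - 1 - var_g w = (var_g w * (1 - speed w) + var_d w * var_d w) / (speed w + 1)"
      by (simp add: field_simps)
  qed
  show "quad (\<lambda>w. (var_g w * (1 - speed w) + var_d w * var_d w) / (speed w + 1))"
    by (intro quad_divide quad_add quad_mult lip_all) simp_all
qed

lemma quad_turn: "quad (\<lambda>w. turn w - 1 + var_g w)"
proof (rule quad_cong)
  show "\<forall>\<^sub>F w in nhds 0. turn w - 1 + var_g w
      = (var_g w * (speed2 w - omega w) - omega w * (var_d w * var_d w)) / speed2 w"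
    by (rule eventually_mono[OF speed2_ev_pos]) (simp add: turn_def field_simps)
  show "quad (\<lambda>w. (var_g w * (speed2 w - omega w) - omega w * (var_d w * var_d w)) / speed2 w)"
    by (intro quad_divide quad_diff quad_mult lip_quad_mult lip_all) simp_all
qed

text \<open>The normal velocity changes the length only through its square, as (sqrt vel2 -
  tang)(sqrt vel2 + tang) = norml^2.\<close>

lemma quad_vel: "quad (\<lambda>w. sqrt (vel2 w) - tang w)"
proof (rule quad_cong)
  have l: "lip (\<lambda>w. sqrt (vel2 w) + tang w)" by (intro lip_all) simp
  have "\<forall>\<^sub>F w in nhds 0. sqrt (vel2 w) + tang w > 0" by (rule lip_ev_pos[OF l]) simp
  thus "\<forall>\<^sub>F w in nhds 0. sqrt (vel2 w) - tang w = norml w * norml w / (sqrt (vel2 w) + tang w)"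
  proof (rule eventually_mono)
    fix w assume "sqrt (vel2 w) + tang w > 0"
    moreover have "sqrt (vel2 w) * sqrt (vel2 w) = tang w * tang w + norml w * norml w"
      by (simp add: vel2_def)
    ultimately show "sqrt (vel2 w) - tang w = norml w * norml w / (sqrt (vel2 w) + tang w)"
      by (simp add: field_simps)
  qed
  show "quad (\<lambda>w. norml w * norml w / (sqrt (vel2 w) + tang w))"
    by (intro quad_divide quad_mult lip_all l) simp_all
qed

lemma quad_accel: "quad (\<lambda>w. accel w - linpart w)"
proof (rule quad_cong)
  \<comment> \<open>\<open>?N\<close> regroups \<open>(accel w - linpart w) * tang w\<close> so that
    every summand is either a product of two factors vanishing at the origin or a Lipschitz factor
    times a quadratic one. The linear terms of \<open>speed - turn\<close> add up to 2g, which is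
    how \<open>2 * var_g\<close> enters \<open>linpart\<close>.\<close>
  let ?N = "\<lambda>w. vel2 w * ((sqrt (vel2 w) - tang w) * (1 + var_e w) + (tang w - 1) * var_e w
       + ((speed w - 1 - var_g w) - (turn w - 1 + var_g w)) + (1 - turn w) * var_x w)
       + (vel2 w - tang w) * linpart w + norml w * (dspeed w - dturn w * var_x w) - (turn w * norml w) * norml w"
  show "\<forall>\<^sub>F w in nhds 0. accel w - linpart w = ?N w / tang w"
  proof (rule eventually_mono[OF tang_ev_pos])
    fix w assume "tang w > 0"
    hence "accel w - linpart w = (accel w * tang w - tang w * linpart w) / tang w"
      by (simp add: field_simps)
    also have "accel w * tang w = vel2 w * (sqrt (vel2 w) * (1 + var_e w) - turn w)
        + norml w * (dspeed w - dturn w * var_x w) - turn w * norml w * norml w"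
      using \<open>tang w > 0\<close> by (simp add: accel_def)
    also have "\<dots> - tang w * linpart w = ?N w"
    proof -
      have "speed w = tang w + turn w * var_x w" by (simp add: tang_def)
      thus ?thesis unfolding linpart_def by (simp add: algebra_simps)
    qed
    finally show "accel w - linpart w = ?N w / tang w" .
  qed
  have "quad (\<lambda>w. (1 + var_e w) * (sqrt (vel2 w) - tang w))"
    by (intro lip_quad_mult quad_vel quad_imp_lip[OF quad_vel] lip_all) simp
  hence q1: "quad (\<lambda>w. (sqrt (vel2 w) - tang w) * (1 + var_e w))" by (simp only: mult.commute)
  have q2: "quad (\<lambda>w. (tang w - 1) * var_e w)" "quad (\<lambda>w. (1 - turn w) * var_x w)"
    by (intro quad_mult lip_all; simp)+
  have q: "quad (\<lambda>w. (sqrt (vel2 w) - tang w) * (1 + var_e w) + (tang w - 1) * var_e w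
       + ((speed w - 1 - var_g w) - (turn w - 1 + var_g w)) + (1 - turn w) * var_x w)"
    by (rule quad_add[OF quad_add[OF quad_add[OF q1 q2(1)] quad_diff[OF quad_speed quad_turn]] q2(2)])
  show "quad (\<lambda>w. ?N w / tang w)"
    by (intro quad_divide quad_add quad_diff quad_mult lip_quad_mult[OF _ q quad_imp_lip[OF q]] lip_all) simp_all
qed

text \<open>Passing to the time \<tau> changes \<open>accel\<close> by its product with 1/omega^2 -
  1, and both factors vanish at the origin.\<close>

lemma quad_resid: "quad resid"
proof -
  have "quad (\<lambda>w. (accel w - linpart w) + accel w * (1 / (omega w * omega w) - 1))"
    by (intro quad_add quad_accel quad_mult lip_all) simp_all
  thus ?thesis by (rule quad_cong[rotated]) (simp add: resid_def algebra_simps)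
qed

lemma resid_estimate:
  obtains K r where "K > 0" "r > 0"
    "\<And>v w. norm v \<le> r \<Longrightarrow> norm w \<le> r \<Longrightarrow> \<bar>resid v - resid w\<bar> \<le> K * (norm v + norm w) * norm (v - w)"
    "\<And>w. norm w \<le> r \<Longrightarrow> speed2 w > 0 \<and> tang w > 0 \<and> omega w > 0"
proof -
  obtain K r where K: "K > 0" "r > 0"
    "\<And>v w. norm v \<le> r \<Longrightarrow> norm w \<le> r \<Longrightarrow> \<bar>resid v - resid w\<bar> \<le> K * (norm v + norm w) * norm (v - w)"
    using quadE[OF quad_resid] by metis
  have "\<forall>\<^sub>F w in nhds 0. speed2 w > 0 \<and> tang w > 0 \<and> omega w > 0"
    by (intro eventually_conj lip_ev_pos lip_all) simp_all
  then obtain e where e: "e > 0" "\<And>w. dist w 0 < e \<Longrightarrow> speed2 w > 0 \<and> tang w > 0 \<and> omega w > 0"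
    unfolding eventually_nhds_metric by blast
  show thesis
    by (rule that[of K "min r (e/2)"]) (use K e in \<open>auto simp: dist_norm\<close>)
qed

section \<open>Periodic solutions of a resonant oscillator\<close>

text \<open>An antiderivative normalised at 0 on the whole line, so that negative arguments and
  parity need no convention on integrals with reversed limits. For continuous f it is
  unique.\<close>

definition primitive :: "(real \<Rightarrow> real) \<Rightarrow> real \<Rightarrow> real" where
  "primitive f = (SOME F. F 0 = 0 \<and> (\<forall>t. (F has_real_derivative f t) (at t)))"

lemma primitive:
  assumes "continuous_on UNIV f"
  shows primitive_0: "primitive f 0 = 0"
    and has_derivative_primitive: "(primitive f has_real_derivative f t) (at t)"
proof -
  have "isCont f x" for x using assms by (simp add: continuous_on_eq_continuous_at)
  then obtain F where F: "\<forall>x. (F has_vector_derivative f x) (at x)"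
    using einterval_antiderivative[of "-\<infinity>" "\<infinity>" f] by auto
  hence "(\<lambda>x. F x - F 0) 0 = 0 \<and> (\<forall>t. ((\<lambda>x. F x - F 0) has_real_derivative f t) (at t))"
    by (auto simp: has_real_derivative_iff_has_vector_derivative intro!: derivative_eq_intros)
  from someI[of "\<lambda>F. F 0 = 0 \<and> (\<forall>t. (F has_real_derivative f t) (at t))", OF this]
  show "primitive f 0 = 0" "(primitive f has_real_derivative f t) (at t)"
    unfolding primitive_def by blast+
qed

lemma primitive_unique:
  assumes "continuous_on UNIV f" "\<And>t. (F has_real_derivative f t) (at t)" "F 0 = 0"
  shows "primitive f t = F t"
proof -
  have "\<forall>x. DERIV (\<lambda>x. primitive f x - F x) x :> 0"
    by (auto intro!: derivative_eq_intros has_derivative_primitive assms)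
  from DERIV_isconst_all[OF this, of t 0] show ?thesis
    using primitive_0[OF assms(1)] assms(3) by simp
qed

lemma primitive_diff:
  assumes "continuous_on UNIV f" "continuous_on UNIV g"
  shows "primitive (\<lambda>s. f s - g s) t = primitive f t - primitive g t"
  by (rule primitive_unique)
     (auto intro!: continuous_intros derivative_eq_intros has_derivative_primitive assms
       simp: primitive_0 assms)

lemma primitive_cmult:
  assumes "continuous_on UNIV f"
  shows "primitive (\<lambda>s. c * f s) t = c * primitive f t"
  by (rule primitive_unique)
     (auto intro!: continuous_intros derivative_eq_intros has_derivative_primitive assms
       simp: primitive_0 assms)

lemma primitive_bound:
  assumes "continuous_on UNIV f" "\<And>s. \<bar>f s\<bar> \<le> B"
  shows "\<bar>primitive f t\<bar> \<le> B * \<bar>t\<bar>"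
proof -
  have "norm (primitive f t - primitive f 0) \<le> B * norm (t - 0)"
    by (rule field_differentiable_bound[of UNIV])
       (use assms has_derivative_primitive[OF assms(1)] in auto)
  thus ?thesis using primitive_0[OF assms(1)] by simp
qed

lemma primitive_odd:
  assumes "continuous_on UNIV f" "\<And>s. f (-s) = f s"
  shows "primitive f (-t) = - primitive f t"
proof -
  have "((\<lambda>x. - primitive f (-x)) has_real_derivative f x) (at x)" for x
    using has_derivative_primitive[OF assms(1), of "-x"] assms(2)[of x]
    by (auto simp: DERIV_mirror intro!: derivative_eq_intros)
  from primitive_unique[OF assms(1) this, of t] show ?thesis
    using primitive_0[OF assms(1)] by simp
qed

lemma primitive_even:
  assumes "continuous_on UNIV f" "\<And>s. f (-s) = - f s"
  shows "primitive f (-t) = primitive f t"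
proof -
  have "((\<lambda>x. primitive f (-x)) has_real_derivative f x) (at x)" for x
    using has_derivative_primitive[OF assms(1), of "-x"] assms(2)[of x]
    by (auto simp: DERIV_mirror intro!: derivative_eq_intros)
  from primitive_unique[OF assms(1) this, of t] show ?thesis
    using primitive_0[OF assms(1)] by simp
qed

text \<open>The function F(t + 2 pi) - F(t) has zero derivative, and its constant value is read off
  at t = -pi. Comparing -pi with pi suits the parity arguments that follow.\<close>

lemma primitive_periodic:
  assumes "continuous_on UNIV f" "\<And>s. f (s + 2*pi) = f s" "primitive f (-pi) = primitive f pi"
  shows "primitive f (t + 2*pi) = primitive f t"
proof -
  have "((\<lambda>x. primitive f (x + 2*pi) - primitive f x) has_real_derivative 0) (at x)" for x
    using has_derivative_primitive[OF assms(1), of "x + 2*pi"] has_derivative_primitive[OF assms(1), of x]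
      assms(2)[of x]
    by (auto intro!: derivative_eq_intros DERIV_chain2[where f = "primitive f"])
  hence "\<forall>x. DERIV (\<lambda>x. primitive f (x + 2*pi) - primitive f x) x :> 0" by blast
  from DERIV_isconst_all[OF this, of t "-pi"] show ?thesis using assms(3) by simp
qed

lemma bounded_periodic:
  fixes f :: "real \<Rightarrow> real"
  assumes per: "\<And>t. f (t + 2*pi) = f t" and b: "\<And>t. \<bar>t\<bar> \<le> pi \<Longrightarrow> \<bar>f t\<bar> \<le> B"
  shows "\<bar>f t\<bar> \<le> B"
proof -
  have nat: "f (t + 2 * pi * real k) = f t" for t k
  proof (induction k)
    case (Suc k)
    have "f (t + 2 * pi * real (Suc k)) = f ((t + 2 * pi * real k) + 2 * pi)"
      by (simp add: algebra_simps)
    thus ?case using per Suc by simp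
  qed simp
  have int: "f (t + 2 * pi * of_int k) = f t" for t k
  proof (cases "k \<ge> 0")
    case True thus ?thesis using nat[of t "nat k"] by simp
  next
    case False
    thus ?thesis using nat[of "t + 2 * pi * of_int k" "nat (-k)"] by simp
  qed
  \<comment> \<open>The integer for which t - 2 pi k lies in [-pi, pi).\<close>
  define k where "k = \<lfloor>(t + pi) / (2*pi)\<rfloor>"
  have "of_int k \<le> (t + pi) / (2*pi)" "(t + pi) / (2*pi) < of_int k + 1"
    unfolding k_def by linarith+
  hence "2*pi * of_int k \<le> t + pi" "t + pi < 2*pi * (of_int k + 1)"
    by (simp_all add: field_simps)
  hence "\<bar>t + 2*pi* of_int (-k)\<bar> \<le> pi" by (simp add: algebra_simps abs_le_iff)
  from b[OF this] show ?thesis using int[of t "-k"] by simp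
qed

section \<open>A solution operator for the resonant oscillator on even periodic sources\<close>

definition cos_coeff :: "(real \<Rightarrow> real) \<Rightarrow> real" where
  "cos_coeff q = 2 / pi * primitive (\<lambda>s. q s * cos s) pi"

text \<open>For an even periodic source the half-period integral in \<open>cos_coeff\<close> already
  gives the full Fourier coefficient of cos. Removing that multiple of cos leaves a source with a
  periodic response.\<close>

definition deflate :: "(real \<Rightarrow> real) \<Rightarrow> real \<Rightarrow> real" where
  "deflate q s = q s - cos_coeff q * cos s"

text \<open>Variation of constants for x'' + x = \<open>deflate q\<close> with zero position and
  velocity at time 0. This normalisation, instead of orthogonality of the solution to cos, keeps the
  formula explicit.\<close>

definition osc :: "(real \<Rightarrow> real) \<Rightarrow> real \<Rightarrow> real" where
  "osc q t = sin t * primitive (\<lambda>s. deflate q s * cos s) t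
           - cos t * primitive (\<lambda>s. deflate q s * sin s) t"

definition osc' :: "(real \<Rightarrow> real) \<Rightarrow> real \<Rightarrow> real" where
  "osc' q t = cos t * primitive (\<lambda>s. deflate q s * cos s) t
            + sin t * primitive (\<lambda>s. deflate q s * sin s) t"

lemma continuous_on_deflate [continuous_intros]:
  "continuous_on UNIV q \<Longrightarrow> continuous_on UNIV (deflate q)"
  unfolding deflate_def by (intro continuous_intros)

lemma continuous_deflate_cos: "continuous_on UNIV q \<Longrightarrow> continuous_on UNIV (\<lambda>s. deflate q s * cos s)"
  and continuous_deflate_sin: "continuous_on UNIV q \<Longrightarrow> continuous_on UNIV (\<lambda>s. deflate q s * sin s)"
  by (intro continuous_intros; assumption)+

lemma has_derivative_osc:
  assumes "continuous_on UNIV q"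
  shows "(osc q has_real_derivative osc' q t) (at t)"
  unfolding osc_def osc'_def
  by (rule derivative_eq_intros has_derivative_primitive continuous_deflate_cos
        continuous_deflate_sin assms refl)+ (simp add: algebra_simps)

lemma has_derivative_osc':
  assumes "continuous_on UNIV q"
  shows "(osc' q has_real_derivative deflate q t - osc q t) (at t)"
proof -
  have "deflate q t * (cos t)\<^sup>2 + deflate q t * (sin t)\<^sup>2 = deflate q t"
    by (metis distrib_left mult.right_neutral sin_cos_squared_add2)
  thus ?thesis
  unfolding osc_def osc'_def
  by - ((rule derivative_eq_intros has_derivative_primitive continuous_deflate_cos
        continuous_deflate_sin assms refl)+, simp add: algebra_simps power2_eq_square)
qed

lemma cos_coeff_diff:
  assumes "continuous_on UNIV f" "continuous_on UNIV g"
  shows "cos_coeff (\<lambda>s. f s - g s) = cos_coeff f - cos_coeff g"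
proof -
  have "primitive (\<lambda>s. (f s - g s) * cos s) pi
      = primitive (\<lambda>s. f s * cos s) pi - primitive (\<lambda>s. g s * cos s) pi"
    unfolding left_diff_distrib
    by (rule primitive_diff) (intro continuous_intros assms)+
  thus ?thesis unfolding cos_coeff_def by (simp only: right_diff_distrib)
qed

lemma mult_abs_le_bound:
  fixes a b :: real assumes "\<bar>a\<bar> \<le> B" "\<bar>b\<bar> \<le> 1" shows "\<bar>a * b\<bar> \<le> B"
  using mult_mono[OF assms] assms by (simp add: abs_mult)

lemma cos_coeff_bound:
  assumes "continuous_on UNIV q" "\<And>s. \<bar>q s\<bar> \<le> B"
  shows "\<bar>cos_coeff q\<bar> \<le> 2 * B"
proof -
  have "\<bar>primitive (\<lambda>s. q s * cos s) pi\<bar> \<le> B * \<bar>pi\<bar>"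
    by (rule primitive_bound) (auto intro!: continuous_intros assms mult_abs_le_bound)
  thus ?thesis unfolding cos_coeff_def by (simp add: abs_mult field_simps)
qed

lemma primitive_affine_cos:
  "primitive (\<lambda>s. (d + c * cos s) * cos s) t = d * sin t + c * (t / 2 + sin t * cos t / 2)"
proof (rule primitive_unique)
  fix t :: real
  have "((\<lambda>t. d * sin t + c * (t / 2 + sin t * cos t / 2)) has_real_derivative
      d * cos t + c * (1 / 2 + (cos t * cos t - sin t * sin t) / 2)) (at t)"
    by (auto intro!: derivative_eq_intros)
  moreover have "1 / 2 + (cos t * cos t - sin t * sin t) / 2 = cos t * cos t"
    using sin_squared_eq[of t] by (simp add: power2_eq_square diff_divide_distrib)
  ultimately show "((\<lambda>t. d * sin t + c * (t / 2 + sin t * cos t / 2)) has_real_derivative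
      (d + c * cos t) * cos t) (at t)"
    by (simp add: algebra_simps)
qed (auto intro!: continuous_intros)

lemma cos_coeff_cos: "cos_coeff (\<lambda>s. d + c * cos s) = c"
  unfolding cos_coeff_def primitive_affine_cos by simp

lemma deflate_bound:
  assumes "continuous_on UNIV q" "\<And>s. \<bar>q s\<bar> \<le> B"
  shows "\<bar>deflate q s\<bar> \<le> 3 * B"
  using mult_abs_le_bound[OF cos_coeff_bound[OF assms] abs_cos_le_one[of s]] assms(2)[of s]
  unfolding deflate_def by linarith

lemma deflate_diff:
  assumes "continuous_on UNIV f" "continuous_on UNIV g"
  shows "deflate (\<lambda>s. f s - g s) t = deflate f t - deflate g t"
  unfolding deflate_def cos_coeff_diff[OF assms] by (simp add: algebra_simps)

lemma osc_diff:
  assumes "continuous_on UNIV f" "continuous_on UNIV g"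
  shows "osc (\<lambda>s. f s - g s) t = osc f t - osc g t"
    and "osc' (\<lambda>s. f s - g s) t = osc' f t - osc' g t"
proof -
  have "primitive (\<lambda>s. deflate (\<lambda>s. f s - g s) s * cos s) t
      = primitive (\<lambda>s. deflate f s * cos s) t - primitive (\<lambda>s. deflate g s * cos s) t"
    unfolding deflate_diff[OF assms] left_diff_distrib
    by (rule primitive_diff) (intro continuous_intros assms)+
  moreover have "primitive (\<lambda>s. deflate (\<lambda>s. f s - g s) s * sin s) t
      = primitive (\<lambda>s. deflate f s * sin s) t - primitive (\<lambda>s. deflate g s * sin s) t"
    unfolding deflate_diff[OF assms] left_diff_distrib
    by (rule primitive_diff) (intro continuous_intros assms)+
  ultimately show "osc (\<lambda>s. f s - g s) t = osc f t - osc g t"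
    "osc' (\<lambda>s. f s - g s) t = osc' f t - osc' g t"
    unfolding osc_def osc'_def by (simp_all only: right_diff_distrib)
qed

context
  fixes q :: "real \<Rightarrow> real"
  assumes q_cont: "continuous_on UNIV q" and q_even: "\<And>s. q (-s) = q s"
    and q_per: "\<And>s. q (s + 2*pi) = q s"
begin

lemma deflate_even: "deflate q (-s) = deflate q s"
  and deflate_per: "deflate q (s + 2*pi) = deflate q s"
  by (simp_all add: deflate_def q_even q_per)

text \<open>The factor \<open>2 / pi\<close> in \<open>cos_coeff\<close> is the reciprocal of the
  integral of cos^2 over [0, pi], which makes the deflated source orthogonal to cos.\<close>

lemma primitive_deflate_cos_pi: "primitive (\<lambda>s. deflate q s * cos s) pi = 0"
proof -
  have "primitive (\<lambda>s. deflate q s * cos s) pi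
      = primitive (\<lambda>s. q s * cos s) pi - cos_coeff q * primitive (\<lambda>s. cos s * cos s) pi"
    unfolding deflate_def left_diff_distrib
    by (subst primitive_diff)
       (auto intro!: continuous_intros q_cont primitive_cmult simp: mult.assoc)
  moreover have "primitive (\<lambda>s. cos s * cos s) pi = pi / 2" using primitive_affine_cos[of 0 1 pi] by simp
  ultimately show ?thesis unfolding cos_coeff_def by simp
qed

lemma osc_even: "osc q (-t) = osc q t" and osc'_odd: "osc' q (-t) = - osc' q t"
  unfolding osc_def osc'_def
  using primitive_odd[OF continuous_deflate_cos[OF q_cont], of t]
    primitive_even[OF continuous_deflate_sin[OF q_cont], of t]
  by (simp_all add: deflate_even)

text \<open>Both primitives must agree at -pi and pi. For the integrand with cos the primitive is
  odd and the deflation makes it vanish at pi. For the integrand with sin, evenness of q makes the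
  integrand odd and its primitive even.\<close>

lemma osc_periodic: "osc q (t + 2*pi) = osc q t" and osc'_periodic: "osc' q (t + 2*pi) = osc' q t"
proof -
  have "primitive (\<lambda>s. deflate q s * cos s) (t + 2*pi) = primitive (\<lambda>s. deflate q s * cos s) t"
    using primitive_odd[OF continuous_deflate_cos[OF q_cont], of pi] primitive_deflate_cos_pi
    by (intro primitive_periodic) (auto intro!: continuous_deflate_cos q_cont simp: deflate_even deflate_per)
  moreover have "primitive (\<lambda>s. deflate q s * sin s) (t + 2*pi) = primitive (\<lambda>s. deflate q s * sin s) t"
    using primitive_even[OF continuous_deflate_sin[OF q_cont], of pi]
    by (intro primitive_periodic) (auto intro!: continuous_deflate_sin q_cont simp: deflate_even deflate_per)
  ultimately show "osc q (t + 2*pi) = osc q t" "osc' q (t + 2*pi) = osc' q t"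
    unfolding osc_def osc'_def by (simp_all)
qed

lemma osc_bound:
  assumes "\<And>s. \<bar>q s\<bar> \<le> B"
  shows "\<bar>osc q t\<bar> \<le> 20 * B" and "\<bar>osc' q t\<bar> \<le> 20 * B"
proof -
  have B: "B \<ge> 0" using assms[of 0] by linarith
  \<comment> \<open>The deflated source is at most B + 2B, so on [-pi, pi] each primitive is at most
    3B pi \<le> 10B; two such terms give the factor 20.\<close>
  have "B * 3 * pi \<le> B * 3 * (10/3)"
    using B pi_less_4 pi_approx by (intro mult_left_mono) auto
  hence pi: "3 * B * \<bar>t\<bar> \<le> 10 * B" if "\<bar>t\<bar> \<le> pi" for t
    using mult_left_mono[OF that, of "3*B"] B by simp
  have 1: "\<bar>primitive (\<lambda>s. deflate q s * cos s) t\<bar> \<le> 10 * B" if "\<bar>t\<bar> \<le> pi" for t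
    by (rule order_trans[OF primitive_bound[where B = "3*B"]])
       (auto intro!: continuous_deflate_cos q_cont mult_abs_le_bound deflate_bound assms pi that)
  have 2: "\<bar>primitive (\<lambda>s. deflate q s * sin s) t\<bar> \<le> 10 * B" if "\<bar>t\<bar> \<le> pi" for t
    by (rule order_trans[OF primitive_bound[where B = "3*B"]])
       (auto intro!: continuous_deflate_sin q_cont mult_abs_le_bound deflate_bound assms pi that)
  have "\<bar>osc q t\<bar> \<le> 20 * B" "\<bar>osc' q t\<bar> \<le> 20 * B" if "\<bar>t\<bar> \<le> pi" for t
    using mult_abs_le_bound[OF 1[OF that] abs_sin_le_one[of t]] mult_abs_le_bound[OF 2[OF that] abs_cos_le_one[of t]]
      mult_abs_le_bound[OF 2[OF that] abs_sin_le_one[of t]] mult_abs_le_bound[OF 1[OF that] abs_cos_le_one[of t]]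
    unfolding osc_def osc'_def by (simp_all add: mult.commute)
  thus "\<bar>osc q t\<bar> \<le> 20 * B" "\<bar>osc' q t\<bar> \<le> 20 * B"
    using bounded_periodic[of "osc q"] bounded_periodic[of "osc' q"] osc_periodic osc'_periodic by blast+
qed

end


section \<open>Contraction for the source and the intermediate value argument in the
  parameter\<close>

context
  fixes Q :: "real \<Rightarrow> real \<Rightarrow> real \<Rightarrow> real \<Rightarrow> real" and a b m K :: real
  assumes ab: "a \<le> b" and m: "m > 0" and K: "K \<ge> 0"
    and Q_even: "\<And>r t x y. r \<in> {a..b} \<Longrightarrow> Q r (-t) x (-y) = Q r t x y"
    and Q_per: "\<And>r t x y. r \<in> {a..b} \<Longrightarrow> Q r (t + 2*pi) x y = Q r t x y"
    and Q_lip: "\<And>r r' t t' x x' y y'. r \<in> {a..b} \<Longrightarrow> r' \<in> {a..b} \<Longrightarrow> \<bar>x\<bar> \<le> 40*m \<Longrightarrow> \<bar>x'\<bar> \<le> 40*m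
       \<Longrightarrow> \<bar>y\<bar> \<le> 40*m \<Longrightarrow> \<bar>y'\<bar> \<le> 40*m
       \<Longrightarrow> \<bar>Q r t x y - Q r' t' x' y'\<bar> \<le> K * (\<bar>r - r'\<bar> + \<bar>t - t'\<bar>) + (\<bar>x - x'\<bar> + \<bar>y - y'\<bar>) / 80"
    and Q_small: "\<And>r t. r \<in> {a..b} \<Longrightarrow> \<bar>Q r t 0 0\<bar> \<le> m"
begin

text \<open>The radius 2m makes \<open>osc q\<close> and \<open>osc' q\<close> at most 20 * 2m =
  40m, the range on which Q is controlled. The conditions are pointwise and closed, so the set is
  complete in the sup metric.\<close>

definition source_set :: "(real \<Rightarrow>\<^sub>C real) set" where
  "source_set = {q :: real \<Rightarrow>\<^sub>C real. \<forall>t. q (-t) = q t \<and> q (t + 2*pi) = q t \<and> \<bar>q t\<bar> \<le> 2*m}"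

definition osc_map :: "real \<Rightarrow> (real \<Rightarrow> real) \<Rightarrow> real \<Rightarrow> real" where
  "osc_map r q t = Q r t (osc q t) (osc' q t)"

lemma source_set_osc:
  assumes "q \<in> source_set"
  shows "osc q (-t) = osc q t" "osc' q (-t) = - osc' q t" "osc q (t + 2*pi) = osc q t"
    "osc' q (t + 2*pi) = osc' q t" "\<bar>osc q t\<bar> \<le> 40*m" "\<bar>osc' q t\<bar> \<le> 40*m" "\<bar>cos_coeff q\<bar> \<le> 4*m"
  using assms osc_even[of q t] osc'_odd[of q t] osc_periodic[of q t] osc'_periodic[of q t]
    osc_bound[of q "2*m" t] cos_coeff_bound[of q "2*m"]
  by (auto simp: source_set_def)

lemma source_set_osc_diff:
  assumes "p \<in> source_set" "q \<in> source_set"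
  shows "\<bar>osc p t - osc q t\<bar> \<le> 20 * dist p q" "\<bar>osc' p t - osc' q t\<bar> \<le> 20 * dist p q"
proof -
  have *: "\<bar>p s - q s\<bar> \<le> dist p q" for s using dist_bounded[of p s q] by (simp add: dist_real_def)
  have "continuous_on UNIV (\<lambda>s. p s - q s)" by (intro continuous_intros) auto
  from osc_bound[OF this, of "dist p q" t] assms *
  show "\<bar>osc p t - osc q t\<bar> \<le> 20 * dist p q" "\<bar>osc' p t - osc' q t\<bar> \<le> 20 * dist p q"
    by (simp_all add: source_set_def osc_diff)
qed

lemma closed_source_set: "closed source_set"
proof -
  have c: "continuous_on UNIV (\<lambda>q::real \<Rightarrow>\<^sub>C real. q t)" for t
    unfolding continuous_on_iff
    by (metis dist_bounded dist_commute order_le_less_trans)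
  show ?thesis unfolding source_set_def
    by (intro closed_Collect_all closed_Collect_conj closed_Collect_eq closed_Collect_le
        continuous_intros c)
qed

text \<open>The factor 1/80 in the Lipschitz hypothesis on Q is tuned to the bound 20 for both
  components of the solution operator: (20 + 20)/80 = 1/2.\<close>

lemma osc_map_lip:
  assumes "r \<in> {a..b}" "r' \<in> {a..b}" "p \<in> source_set" "q \<in> source_set"
  shows "\<bar>osc_map r p t - osc_map r' q t\<bar> \<le> K * \<bar>r - r'\<bar> + dist p q / 2"
proof -
  have "\<bar>osc_map r p t - osc_map r' q t\<bar> \<le> K * (\<bar>r - r'\<bar> + \<bar>t - t\<bar>)
       + (\<bar>osc p t - osc q t\<bar> + \<bar>osc' p t - osc' q t\<bar>) / 80"
    unfolding osc_map_def by (rule Q_lip) (use assms source_set_osc in auto)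
  hence "\<bar>osc_map r p t - osc_map r' q t\<bar> \<le> K * \<bar>r - r'\<bar>
       + (\<bar>osc p t - osc q t\<bar> + \<bar>osc' p t - osc' q t\<bar>) / 80" by simp
  also have "(\<bar>osc p t - osc q t\<bar> + \<bar>osc' p t - osc' q t\<bar>) / 80 \<le> dist p q / 2"
    using source_set_osc_diff[OF assms(3,4), of t] by simp
  finally show ?thesis by simp
qed

lemma osc_map_bcontfun:
  assumes "r \<in> {a..b}" "q \<in> source_set"
  shows "osc_map r q \<in> bcontfun" "Bcontfun (osc_map r q) \<in> source_set"
    "Bcontfun (osc_map r q) t = osc_map r q t"
proof -
  have qc: "continuous_on UNIV (apply_bcontfun q)" by auto
  have co: "isCont (osc q) t" "isCont (osc' q) t" for t
    using has_derivative_osc[OF qc] has_derivative_osc'[OF qc] by (blast intro: DERIV_isCont)+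
  have "continuous_on UNIV (osc_map r q)"
  proof (rule continuous_at_imp_continuous_on, rule ballI)
    fix t
    have "((\<lambda>s. K * \<bar>s - t\<bar> + (\<bar>osc q s - osc q t\<bar> + \<bar>osc' q s - osc' q t\<bar>) / 80)
      \<longlongrightarrow> K * \<bar>t - t\<bar> + (\<bar>osc q t - osc q t\<bar> + \<bar>osc' q t - osc' q t\<bar>) / 80) (at t)"
      using co[unfolded isCont_def] by (intro tendsto_intros) auto
    hence lim: "((\<lambda>s. K * \<bar>s - t\<bar> + (\<bar>osc q s - osc q t\<bar> + \<bar>osc' q s - osc' q t\<bar>) / 80) \<longlongrightarrow> 0) (at t)"
      by simp
    have "norm (osc_map r q s - osc_map r q t)
         \<le> K * \<bar>s - t\<bar> + (\<bar>osc q s - osc q t\<bar> + \<bar>osc' q s - osc' q t\<bar>) / 80" for s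
      using Q_lip[OF assms(1,1), of "osc q s" "osc q t" "osc' q s" "osc' q t" s t] source_set_osc[OF assms(2)]
      by (simp add: osc_map_def)
    hence "((\<lambda>s. osc_map r q s - osc_map r q t) \<longlongrightarrow> 0) (at t)"
      by (intro Lim_null_comparison[OF _ lim] always_eventually allI)
    thus "isCont (osc_map r q) t" unfolding isCont_def using LIM_zero_cancel by blast
  qed
  moreover have bound: "\<bar>osc_map r q t\<bar> \<le> 2 * m" for t
  proof -
    have "\<bar>osc_map r q t - Q r t 0 0\<bar> \<le> K * (\<bar>r - r\<bar> + \<bar>t - t\<bar>) + (\<bar>osc q t - 0\<bar> + \<bar>osc' q t - 0\<bar>) / 80"
      unfolding osc_map_def by (rule Q_lip) (use assms source_set_osc m in auto)
    hence "\<bar>osc_map r q t - Q r t 0 0\<bar> \<le> (\<bar>osc q t\<bar> + \<bar>osc' q t\<bar>) / 80" by simp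
    \<comment> \<open>(40m + 40m)/80 = m; added to the bound m for Q at zero this returns the radius
      2m.\<close>
    also have "\<dots> \<le> m" using source_set_osc(5,6)[OF assms(2), of t] by simp
    finally show ?thesis using Q_small[OF assms(1), of t] by linarith
  qed
  ultimately show *: "osc_map r q \<in> bcontfun" by (intro bcontfun_normI[of _ "2*m"]) auto
  thus **: "Bcontfun (osc_map r q) t = osc_map r q t" for t by (simp add: Bcontfun_inverse)
  show "Bcontfun (osc_map r q) \<in> source_set"
    using bound source_set_osc[OF assms(2)] Q_even[OF assms(1)] Q_per[OF assms(1)]
    by (simp add: source_set_def **) (simp add: osc_map_def)
qed

lemma osc_map_fixpoint:
  assumes "r \<in> {a..b}"
  shows "\<exists>q\<in>source_set. \<forall>t. q t = osc_map r q t"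
proof -
  have "\<exists>!q\<in>source_set. Bcontfun (osc_map r q) = q"
  proof (rule Banach_fix[of source_set "1/2"])
    show "complete source_set" using closed_source_set by (simp add: complete_eq_closed)
    have "const_bcontfun 0 \<in> source_set" using m by (auto simp: source_set_def const_bcontfun.rep_eq)
    thus "source_set \<noteq> {}" by blast
    show "(\<lambda>q :: real \<Rightarrow>\<^sub>C real. Bcontfun (osc_map r q)) ` source_set \<subseteq> source_set"
      using osc_map_bcontfun[OF assms] by blast
    fix p q assume pq: "p \<in> source_set" "q \<in> source_set"
    show "dist (Bcontfun (osc_map r p)) (Bcontfun (osc_map r q)) \<le> 1/2 * dist p q"
      using osc_map_lip[OF assms assms pq] osc_map_bcontfun(3)[OF assms pq(1)] osc_map_bcontfun(3)[OF assms pq(2)]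
      by (intro dist_bound) (simp add: dist_real_def)
  qed auto
  thus ?thesis using osc_map_bcontfun(3)[OF assms] by metis
qed

text \<open>For every parameter the contraction principle solves the equation up to a multiple of
  \<open>cos\<close>; the sign hypotheses at the endpoints make that multiple vanish for some parameter.\<close>

theorem periodic_solution:
  assumes left: "\<And>t x y. \<bar>x\<bar> \<le> 40*m \<Longrightarrow> \<bar>y\<bar> \<le> 40*m \<Longrightarrow> \<bar>Q a t x y - (da + ca * cos t)\<bar> \<le> ea"
    and right: "\<And>t x y. \<bar>x\<bar> \<le> 40*m \<Longrightarrow> \<bar>y\<bar> \<le> 40*m \<Longrightarrow> \<bar>Q b t x y - (db + cb * cos t)\<bar> \<le> eb"
    and signs: "ca \<le> - 2 * ea" "cb \<ge> 2 * eb"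
  shows "\<exists>r\<in>{a..b}. \<exists>\<phi> \<phi>1 q. (\<forall>t. (\<phi> has_real_derivative \<phi>1 t) (at t) \<and>
     (\<phi>1 has_real_derivative q t - \<phi> t) (at t) \<and> q t = Q r t (\<phi> t) (\<phi>1 t) \<and>
     \<phi> (t + 2*pi) = \<phi> t \<and> \<bar>\<phi> t\<bar> \<le> 40*m \<and> \<bar>\<phi>1 t\<bar> \<le> 40*m \<and> \<bar>q t\<bar> \<le> 2*m)"
proof -
  have "\<forall>r\<in>{a..b}. \<exists>q. q \<in> source_set \<and> (\<forall>t. q t = osc_map r q t)"
    using osc_map_fixpoint by blast
  from bchoice[OF this] obtain qf where qf: "\<And>r. r \<in> {a..b} \<Longrightarrow> qf r \<in> source_set"
      "\<And>r t. r \<in> {a..b} \<Longrightarrow> qf r t = osc_map r (qf r) t"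
    by blast
  define l where "l r = cos_coeff (qf r)" for r
  \<comment> \<open>If Q stays within e of d + c cos t, the coefficient of the fixed source is
    within 2e of c: the constant d has no cos component, and the 2 is that of
    \<open>cos_coeff_bound\<close>.\<close>
  have near: "\<bar>l r - c\<bar> \<le> 2 * e"
    if "r \<in> {a..b}" and e: "\<And>t x y. \<bar>x\<bar> \<le> 40*m \<Longrightarrow> \<bar>y\<bar> \<le> 40*m \<Longrightarrow> \<bar>Q r t x y - (d + c * cos t)\<bar> \<le> e"
    for r c d e
  proof -
    have "\<bar>qf r t - (d + c * cos t)\<bar> \<le> e" for t
      using e[of "osc (qf r) t" "osc' (qf r) t" t] qf(2)[OF that(1), of t] source_set_osc[OF qf(1)[OF that(1)]]
      by (simp add: osc_map_def)
    hence "\<bar>cos_coeff (\<lambda>t. qf r t - (d + c * cos t))\<bar> \<le> 2 * e"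
      by (intro cos_coeff_bound continuous_intros) auto
    thus ?thesis unfolding l_def
      by (subst (asm) cos_coeff_diff) (auto intro!: continuous_intros simp: cos_coeff_cos)
  qed
  \<comment> \<open>The contraction constant 1/2 is the same for all parameters, so the last term
    can be absorbed on the left; the fixed source is Lipschitz in r.\<close>
  have "dist (qf r) (qf r') \<le> K * \<bar>r - r'\<bar> + dist (qf r) (qf r') / 2"
    if "r \<in> {a..b}" "r' \<in> {a..b}" for r r'
    using osc_map_lip[OF that qf(1)[OF that(1)] qf(1)[OF that(2)]] qf(2)[OF that(1)] qf(2)[OF that(2)]
    by (intro dist_bound) (simp add: dist_real_def)
  hence qd: "dist (qf r) (qf r') \<le> 2 * K * \<bar>r - r'\<bar>" if "r \<in> {a..b}" "r' \<in> {a..b}" for r r'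
    using that by fastforce
  have "\<bar>l r - l r'\<bar> \<le> 4 * K * \<bar>r - r'\<bar>" if "r \<in> {a..b}" "r' \<in> {a..b}" for r r'
  proof -
    have "\<bar>cos_coeff (\<lambda>t. qf r t - qf r' t)\<bar> \<le> 2 * (2 * K * \<bar>r - r'\<bar>)"
      using order_trans[OF dist_bounded qd[OF that]]
      by (intro cos_coeff_bound continuous_intros) (auto simp: dist_real_def)
    thus ?thesis unfolding l_def by (subst (asm) cos_coeff_diff) auto
  qed
  hence "lipschitz_on (4 * K) {a..b} l"
    using K by (intro lipschitz_onI) (auto simp: dist_real_def)
  hence "continuous_on {a..b} l" by (rule lipschitz_on_continuous_on)
  moreover have "l a \<le> 0" "0 \<le> l b"
    using near[OF _ left] near[OF _ right] ab signs by force+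
  ultimately obtain r where r: "r \<in> {a..b}" "l r = 0"
    using IVT'[of l a 0 b] ab by auto
  define q where "q = qf r"
  have qs: "q \<in> source_set" and q: "\<And>t. q t = osc_map r q t" using qf[OF r(1)] by (auto simp: q_def)
  \<comment> \<open>At a parameter with vanishing coefficient the deflation removes nothing, so
    \<open>osc q\<close> solves the full equation.\<close>
  have "deflate q t = q t" for t using r(2) by (simp add: deflate_def l_def q_def)
  moreover have "continuous_on UNIV (apply_bcontfun q)" by auto
  ultimately show ?thesis
    using has_derivative_osc[of q] has_derivative_osc'[of q] source_set_osc[OF qs] q qs
    by (intro bexI[OF _ r(1)] exI[of _ "osc q"] exI[of _ "osc' q"] exI[of _ "apply_bcontfun q"])
       (auto simp: osc_map_def source_set_def)
qed

end

section \<open>Asymptotics of the radial profile\<close>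

lemma powr_neg_half_le:
  fixes s u p :: real
  assumes "s > 0" "s / 2 \<le> u" "p \<ge> 0"
  shows "u powr (-p) \<le> 2 powr p * s powr (-p)"
proof -
  have "u powr (-p) \<le> (s/2) powr (-p)" using assms by (intro powr_mono2') auto
  also have "\<dots> = 2 powr p * s powr (-p)"
    using assms by (simp add: powr_divide powr_minus field_simps)
  finally show ?thesis .
qed

lemma powr_neg_diff_le:
  fixes s u v p :: real
  assumes "s \<ge> 2" "p > 0" "\<bar>u - s\<bar> \<le> 1" "\<bar>v - s\<bar> \<le> 1"
  shows "\<bar>u powr (-p) - v powr (-p)\<bar> \<le> p * 2 powr (p+1) * s powr (-p-1) * \<bar>u - v\<bar>"
proof -
  have "norm (u powr (-p) - v powr (-p)) \<le> p * 2 powr (p+1) * s powr (-p-1) * norm (u - v)"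
  proof (rule field_differentiable_bound[where f' = "\<lambda>z. - p * z powr (-p-1)" and S = "{s-1..s+1}"])
    fix z assume z: "z \<in> {s-1..s+1}"
    show "((\<lambda>x. x powr (-p)) has_real_derivative - p * z powr (-p-1)) (at z within {s-1..s+1})"
      using z assms by (intro has_real_derivative_powr has_field_derivative_at_within) auto
    have "z powr (-p-1) \<le> 2 powr (p+1) * s powr (-p-1)"
      using z assms powr_neg_half_le[of s z "p+1"] by simp
    from mult_left_mono[OF this, of p]
    show "norm (- p * z powr (-p-1)) \<le> p * 2 powr (p+1) * s powr (-p-1)"
      using assms by (simp add: abs_mult mult_ac)
  qed (use assms in auto)
  thus ?thesis by simp
qed

text \<open>Mean value bound for z^(-p) + p s^(-p-1) z, whose derivative vanishes at z = s; that
  derivative is in turn estimated by \<open>powr_neg_diff_le\<close> with p + 1 in place of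
  p.\<close>

lemma powr_neg_expand_le:
  fixes s x p :: real
  assumes "s \<ge> 2" "p > 0" "\<bar>x\<bar> \<le> 1"
  shows "\<bar>(s + x) powr (-p) - s powr (-p) + p * x * s powr (-p-1)\<bar>
           \<le> p * ((p+1) * 2 powr (p+2)) * s powr (-p-2)"
proof -
  let ?g = "\<lambda>z. z powr (-p) + p * s powr (-p-1) * z"
  let ?B = "p * ((p+1) * 2 powr (p+2)) * s powr (-p-2)"
  have "norm (?g (s + x) - ?g s) \<le> ?B * norm (s + x - s)"
  proof (rule field_differentiable_bound[where f' = "\<lambda>z. - p * z powr (-p-1) + p * s powr (-p-1)"
        and S = "{s-1..s+1}"])
    fix z assume z: "z \<in> {s-1..s+1}"
    have "((\<lambda>x. x powr (-p)) has_real_derivative - p * z powr (-p-1)) (at z within {s-1..s+1})"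
      using z assms by (intro has_real_derivative_powr has_field_derivative_at_within) auto
    from DERIV_add[OF this DERIV_cmult_Id[of "p * s powr (-p-1)"]]
    show "(?g has_real_derivative - p * z powr (-p-1) + p * s powr (-p-1)) (at z within {s-1..s+1})" .
    have "\<bar>z powr (-p-1) - s powr (-p-1)\<bar> \<le> (p+1) * 2 powr (p+2) * s powr (-p-2) * \<bar>z - s\<bar>"
    proof -
      have "-(p+1) = -p-1" "-(p+1)-1 = -p-2" "p+1+1 = p+2" by simp_all
      with powr_neg_diff_le[of s "p+1" z s] z assms show ?thesis by (simp only:) (simp add: abs_le_iff)
    qed
    also have "\<dots> \<le> (p+1) * 2 powr (p+2) * s powr (-p-2) * 1"
      using z assms by (intro mult_left_mono) auto
    finally have *: "p * \<bar>z powr (-p-1) - s powr (-p-1)\<bar> \<le> p * ((p+1) * 2 powr (p+2) * s powr (-p-2))"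
      using assms by (intro mult_left_mono) auto
    have "norm (- p * z powr (-p-1) + p * s powr (-p-1)) = p * \<bar>z powr (-p-1) - s powr (-p-1)\<bar>"
      using assms abs_mult[of p "s powr (-p-1) - z powr (-p-1)"] by (simp add: algebra_simps abs_minus_commute)
    thus "norm (- p * z powr (-p-1) + p * s powr (-p-1)) \<le> ?B"
      using * by (simp add: mult.assoc)
  qed (use assms in auto)
  also have "\<dots> \<le> ?B * 1" using assms by (intro mult_left_mono) auto
  finally show ?thesis by (simp add: algebra_simps)
qed

lemma smallo_powr_quotient:
  fixes f :: "real \<Rightarrow> real"
  assumes "f \<in> o(\<lambda>s. s powr a)" shows "(\<lambda>s. f s / s powr b) \<in> o(\<lambda>s. s powr (a - b))"
proof -
  have "(\<lambda>s. f s / s powr b) \<in> o(\<lambda>s. s powr a / s powr b)"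
    by (rule landau_o.small.divide_right[OF _ assms])
       (auto intro!: eventually_mono[OF eventually_gt_at_top[of 0]])
  thus ?thesis by (simp add: powr_diff)
qed

text \<open>The regimes of \<beta> are brought to one form with error o(s^(-\<gamma>-1)), the order
  of the solvability condition. An uncertainty o(s^(\<beta>-1)) in \<open>ht\<close> becomes such an
  error after division by s^(\<gamma>+\<beta>); for \<beta> > 1 a bounded \<open>ht\<close> is
  itself o(s^(\<beta>-1)).\<close>

lemma profile_expansion:
  fixes h ht :: "real \<Rightarrow> real"
  assumes A_pos: "A > 0" and beta: "\<beta> \<ge> 0"
    and h_expansion: "\<exists>s0. \<forall>s\<ge>s0. h s = 1 + A / s powr \<gamma> + ht s / s powr (\<gamma> + \<beta>)"
    and beta_gt1: "\<beta> > 1 \<Longrightarrow> bounded (ht ` {0<..})"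
    and beta_01: "0 < \<beta> \<Longrightarrow> \<beta> \<le> 1 \<Longrightarrow>
                   (\<exists>B. (\<lambda>s. ht s - B) \<in> o[at_top](\<lambda>s. s powr (\<beta> - 1)))"
    and beta_0: "\<beta> = 0 \<Longrightarrow> (\<exists>B. B > - A \<and> (\<lambda>s. ht s - B) \<in> o[at_top](\<lambda>s. 1 / s))"
  obtains A' B \<beta>' f where "A' > 0" "\<beta>' > 0" "f \<in> o(\<lambda>s. s powr (-\<gamma>-1))"
    "\<forall>\<^sub>F s in at_top. h s = 1 + A' * s powr (-\<gamma>) + B * s powr (-(\<gamma>+\<beta>')) + f s"
proof -
  obtain s0 where s0: "\<And>s. s \<ge> s0 \<Longrightarrow> h s = 1 + A / s powr \<gamma> + ht s / s powr (\<gamma> + \<beta>)"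
    using h_expansion by blast
  have ev: "\<forall>\<^sub>F s in at_top. h s = 1 + A * s powr (-\<gamma>) + ht s / s powr (\<gamma> + \<beta>)"
    by (rule eventually_mono[OF eventually_ge_at_top[of s0]]) (use s0 in \<open>simp add: powr_minus field_simps\<close>)
  have \<beta>_eq: "\<beta> - 1 - (\<gamma> + \<beta>) = -\<gamma> - 1" and \<gamma>_eq: "-1 - \<gamma> = -\<gamma> - 1" by simp_all
  consider "\<beta> > 1" | "0 < \<beta>" "\<beta> \<le> 1" | "\<beta> = 0" using beta by linarith
  thus thesis
  proof cases
    case 1
    obtain M where M: "\<And>s. s > 0 \<Longrightarrow> \<bar>ht s\<bar> \<le> M" using beta_gt1[OF 1] by (auto simp: bounded_iff)
    have "ht \<in> O(\<lambda>_. 1)"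
      by (rule bigoI[of _ M]) (use M in \<open>auto intro!: eventually_mono[OF eventually_gt_at_top[of 0]]\<close>)
    also have "((\<lambda>s::real. s powr (1 - \<beta>)) \<longlongrightarrow> 0) at_top"
      using 1 by (intro tendsto_neg_powr filterlim_ident) auto
    hence "(\<lambda>_::real. 1 :: real) \<in> o(\<lambda>s. s powr (\<beta> - 1))"
      by (intro smalloI_tendsto eventually_mono[OF eventually_gt_at_top[of 0]])
         (auto simp: powr_diff)
    finally have "(\<lambda>s. ht s / s powr (\<gamma> + \<beta>)) \<in> o(\<lambda>s. s powr (-\<gamma> - 1))"
      using smallo_powr_quotient[of _ "\<beta> - 1" "\<gamma> + \<beta>"] \<beta>_eq by (simp only:)
    \<comment> \<open>There is no second power in this case: its coefficient is 0, and the exponent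
      shift 1 is a placeholder.\<close>
    thus thesis using ev A_pos by (intro that[of A 1 "\<lambda>s. ht s / s powr (\<gamma> + \<beta>)" 0]) auto
  next
    case 2
    obtain B where "(\<lambda>s. ht s - B) \<in> o[at_top](\<lambda>s. s powr (\<beta> - 1))" using beta_01[OF 2] by blast
    hence "(\<lambda>s. (ht s - B) / s powr (\<gamma> + \<beta>)) \<in> o(\<lambda>s. s powr (-\<gamma> - 1))"
      using smallo_powr_quotient[of _ "\<beta> - 1" "\<gamma> + \<beta>"] \<beta>_eq by (simp only:)
    moreover have "\<forall>\<^sub>F s in at_top. h s = 1 + A * s powr (-\<gamma>) + B * s powr (-(\<gamma>+\<beta>)) + (ht s - B) / s powr (\<gamma> + \<beta>)"
      using ev by eventually_elim (simp only: powr_minus divide_inverse, simp add: algebra_simps)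
    ultimately show thesis using A_pos 2
      by (intro that[of A \<beta> "\<lambda>s. (ht s - B) / s powr (\<gamma> + \<beta>)" B]) auto
  next
    case 3
    obtain B where B: "B > - A" "(\<lambda>s. ht s - B) \<in> o[at_top](\<lambda>s. 1 / s)" using beta_0[OF 3] by blast
    have "(\<lambda>s. ht s - B) \<in> o[at_top](\<lambda>s. s powr (-1))"
      by (rule landau_o.small.cong[THEN equalityD1, THEN subsetD, OF _ B(2)])
         (auto intro!: eventually_mono[OF eventually_gt_at_top[of 0]] simp: powr_minus divide_inverse)
    hence "(\<lambda>s. (ht s - B) / s powr \<gamma>) \<in> o(\<lambda>s. s powr (-\<gamma> - 1))"
      using smallo_powr_quotient[of _ "-1" "\<gamma>"] \<gamma>_eq by (simp only:)
    moreover have "\<forall>\<^sub>F s in at_top. h s = 1 + (A + B) * s powr (-\<gamma>) + 0 * s powr (-(\<gamma>+1)) + (ht s - B) / s powr \<gamma>"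
      using ev by eventually_elim (simp add: 3 powr_minus diff_divide_distrib divide_inverse algebra_simps)
    ultimately show thesis using B
      by (intro that[of "A + B" 1 "\<lambda>s. (ht s - B) / s powr \<gamma>" 0]) auto
  qed
qed

lemma powr_eventually_small:
  fixes K e p :: real
  assumes "e > 0" "p < q"
  shows "\<forall>\<^sub>F s in at_top. K * s powr p \<le> e * s powr q"
proof -
  have "((\<lambda>s::real. K * s powr (p - q)) \<longlongrightarrow> K * 0) at_top"
    by (intro tendsto_intros tendsto_neg_powr filterlim_ident) (use assms in auto)
  hence "\<forall>\<^sub>F s in at_top. K * s powr (p - q) < e" using assms by (intro order_tendstoD) auto
  thus ?thesis using eventually_gt_at_top[of 0]
  proof eventually_elim
    case (elim s)
    have "K * s powr p = (K * s powr (p - q)) * s powr q" using elim by (simp flip: powr_add)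
    also have "\<dots> \<le> e * s powr q" using elim by (intro mult_right_mono) auto
    finally show ?case .
  qed
qed

text \<open>Over a bounded distance only the leading power moves at order s^(-\<gamma>-1). The power
  with B moves by O(s^(-\<gamma>-\<beta>-1)), and the remainder f is estimated by its size at the
  two points, not by its slope.\<close>

lemma profile_difference:
  fixes h f :: "real \<Rightarrow> real"
  assumes "\<gamma> > 1" "A > 0" "\<beta> > 0" "f \<in> o(\<lambda>s. s powr (-\<gamma>-1))" "e > 0"
    and h: "\<forall>\<^sub>F s in at_top. h s = 1 + A * s powr (-\<gamma>) + B * s powr (-(\<gamma>+\<beta>)) + f s"
  shows "\<forall>\<^sub>F s in at_top. \<forall>x. \<bar>x\<bar> \<le> 1 \<longrightarrow>
     \<bar>h (s + x) - h s + \<gamma> * A * x * s powr (-\<gamma>-1)\<bar> \<le> e * s powr (-\<gamma>-1)"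
proof -
  \<comment> \<open>The error e is shared by four terms: the Taylor remainder, the power with B, and
    f at two points. The power of 2 pays for evaluating f at points as small as s/2.\<close>
  define e1 where "e1 = e / (4 * 2 powr (\<gamma> + 1))"
  have "e1 > 0" using assms by (simp add: e1_def)
  define K1 where "K1 = A * (\<gamma> * ((\<gamma>+1) * 2 powr (\<gamma>+2)))"
  define K2 where "K2 = \<bar>B\<bar> * ((\<gamma>+\<beta>) * 2 powr (\<gamma>+\<beta>+1))"
  have "\<forall>\<^sub>F s in at_top. \<bar>f s\<bar> \<le> e1 * \<bar>s powr (-\<gamma>-1)\<bar>"
    using landau_o.smallD[OF assms(4) \<open>e1 > 0\<close>] by simp
  with h have "\<forall>\<^sub>F s in at_top. h s = 1 + A * s powr (-\<gamma>) + B * s powr (-(\<gamma>+\<beta>)) + f s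
     \<and> \<bar>f s\<bar> \<le> e1 * \<bar>s powr (-\<gamma>-1)\<bar>" by (rule eventually_conj)
  then obtain s1 where s1: "\<And>s. s \<ge> s1 \<Longrightarrow> h s = 1 + A * s powr (-\<gamma>) + B * s powr (-(\<gamma>+\<beta>)) + f s"
     "\<And>s. s \<ge> s1 \<Longrightarrow> \<bar>f s\<bar> \<le> e1 * s powr (-\<gamma>-1)" by (auto simp: eventually_at_top_linorder)
  have "\<forall>\<^sub>F s in at_top. K1 * s powr (-\<gamma>-2) \<le> e/4 * s powr (-\<gamma>-1)"
    "\<forall>\<^sub>F s in at_top. K2 * s powr (-(\<gamma>+\<beta>)-1) \<le> e/4 * s powr (-\<gamma>-1)"
    by (rule powr_eventually_small; use assms in simp)+
  thus ?thesis using eventually_ge_at_top[of 2] eventually_ge_at_top[of "s1 + 1"]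
  proof eventually_elim
    case (elim s)
    show ?case
    proof (intro allI impI)
      fix x :: real assume x: "\<bar>x\<bar> \<le> 1"
      have f: "\<bar>f (s + y)\<bar> \<le> e/4 * s powr (-\<gamma>-1)" if "\<bar>y\<bar> \<le> 1" for y
      proof -
        have "\<bar>f (s + y)\<bar> \<le> e1 * (s + y) powr (-\<gamma>-1)" using elim that by (intro s1) auto
        also have "(s + y) powr (-\<gamma>-1) \<le> 2 powr (\<gamma>+1) * s powr (-\<gamma>-1)"
          using elim that assms powr_neg_half_le[of s "s + y" "\<gamma>+1"] by simp
        hence "e1 * (s + y) powr (-\<gamma>-1) \<le> e1 * (2 powr (\<gamma>+1) * s powr (-\<gamma>-1))"
          using \<open>e1 > 0\<close> by (intro mult_left_mono) auto
        also have "\<dots> = e/4 * s powr (-\<gamma>-1)" by (simp add: e1_def)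
        finally show ?thesis .
      qed
      let ?D1 = "(s + x) powr (-\<gamma>) - s powr (-\<gamma>) + \<gamma> * x * s powr (-\<gamma>-1)"
      let ?D2 = "(s + x) powr (-(\<gamma>+\<beta>)) - s powr (-(\<gamma>+\<beta>))"
      have "\<bar>A * ?D1\<bar> \<le> A * (\<gamma> * ((\<gamma>+1) * 2 powr (\<gamma>+2)) * s powr (-\<gamma>-2))"
        unfolding abs_mult using elim x assms by (intro mult_mono powr_neg_expand_le) auto
      hence D1: "\<bar>A * ?D1\<bar> \<le> e/4 * s powr (-\<gamma>-1)" using elim(1) by (simp add: K1_def mult_ac)
      have "\<bar>?D2\<bar> \<le> (\<gamma>+\<beta>) * 2 powr (\<gamma>+\<beta>+1) * s powr (-(\<gamma>+\<beta>)-1) * \<bar>s + x - s\<bar>"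
        using elim x assms by (intro powr_neg_diff_le) auto
      also have "\<dots> \<le> (\<gamma>+\<beta>) * 2 powr (\<gamma>+\<beta>+1) * s powr (-(\<gamma>+\<beta>)-1) * 1"
        using x assms by (intro mult_left_mono) auto
      finally have "\<bar>B * ?D2\<bar> \<le> \<bar>B\<bar> * ((\<gamma>+\<beta>) * 2 powr (\<gamma>+\<beta>+1) * s powr (-(\<gamma>+\<beta>)-1))"
        unfolding abs_mult by (intro mult_left_mono) auto
      hence D2: "\<bar>B * ?D2\<bar> \<le> e/4 * s powr (-\<gamma>-1)" using elim(2) by (simp add: K2_def mult_ac)
      have "h (s + x) - h s + \<gamma> * A * x * s powr (-\<gamma>-1) = A * ?D1 + B * ?D2 + f (s + x) - f s"
        using elim x by (subst (1 2) s1(1)) (auto simp: algebra_simps)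
      thus "\<bar>h (s + x) - h s + \<gamma> * A * x * s powr (-\<gamma>-1)\<bar> \<le> e * s powr (-\<gamma>-1)"
        using D1 D2 f[OF x] f[of 0] by simp
    qed
  qed
qed

lemma profile_bound:
  fixes h f :: "real \<Rightarrow> real"
  assumes "\<gamma> > 1" "A > 0" "\<beta> > 0" "f \<in> o(\<lambda>s. s powr (-\<gamma>-1))"
    and h: "\<forall>\<^sub>F s in at_top. h s = 1 + A * s powr (-\<gamma>) + B * s powr (-(\<gamma>+\<beta>)) + f s"
  shows "\<forall>\<^sub>F s in at_top. \<bar>h s - 1\<bar> \<le> (A + \<bar>B\<bar> + 1) * s powr (-\<gamma>)"
proof -
  have "\<forall>\<^sub>F s in at_top. \<bar>f s\<bar> \<le> 1 * \<bar>s powr (-\<gamma>-1)\<bar>"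
    using landau_o.smallD[OF assms(4) zero_less_one] by simp
  with h eventually_ge_at_top[of 1] show ?thesis
  proof eventually_elim
    case (elim s)
    have 1: "s powr (-\<gamma>-1) \<le> s powr (-\<gamma>)" "s powr (-(\<gamma>+\<beta>)) \<le> s powr (-\<gamma>)"
      using elim assms by (auto intro!: powr_mono)
    hence "\<bar>B * s powr (-(\<gamma>+\<beta>))\<bar> \<le> \<bar>B\<bar> * s powr (-\<gamma>)" by (auto simp: abs_mult intro: mult_left_mono)
    moreover have "\<bar>A * s powr (-\<gamma>)\<bar> = A * s powr (-\<gamma>)" using assms by simp
    ultimately show ?case using elim 1 by (simp add: algebra_simps)
  qed
qed

text \<open>On the positive real axis h coincides with H, so its derivatives are those of H in the
  direction 1. The restriction to s > 0 reflects that H determines h only for nonnegative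
  arguments.\<close>

lemma radial_profile_C2:
  assumes "C2_plane H" "\<forall>p. H p = h (cmod p)"
  obtains h1 h2 :: "real \<Rightarrow> real" where
    "\<And>s. s > 0 \<Longrightarrow> (h has_real_derivative h1 s) (at s)"
    "\<And>s. s > 0 \<Longrightarrow> (h1 has_real_derivative h2 s) (at s)"
    "\<And>s. s > 0 \<Longrightarrow> deriv (deriv h) s = h2 s"
proof -
  obtain DH :: "complex \<Rightarrow> complex \<Rightarrow>\<^sub>L real" and D2H :: "complex \<Rightarrow> complex \<Rightarrow>\<^sub>L (complex \<Rightarrow>\<^sub>L real)"
    where DH: "\<And>p. (H has_derivative blinfun_apply (DH p)) (at p)"
      and D2H: "\<And>p. (DH has_derivative blinfun_apply (D2H p)) (at p)"
    using assms(1) unfolding C2_plane_def by blast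
  define h1 where "h1 s = DH (complex_of_real s) 1" for s
  define h2 where "h2 s = D2H (complex_of_real s) 1 1" for s
  have r: "(complex_of_real has_derivative complex_of_real) (at s)" for s
    by (rule bounded_linear_imp_has_derivative) (rule bounded_linear_of_real)
  have sc: "complex_of_real x = x *\<^sub>R 1" for x by (simp add: scaleR_conv_of_real)
  have 1: "(h has_real_derivative h1 s) (at s)" if "s > 0" for s
  proof -
    have "((\<lambda>s. H (complex_of_real s)) has_derivative (\<lambda>x. DH (complex_of_real s) (complex_of_real x))) (at s)"
      by (rule has_derivative_compose[OF r DH])
    moreover have "(\<lambda>x. DH (complex_of_real s) (complex_of_real x)) = (*) (h1 s)"
      by (rule ext) (simp add: h1_def sc[of _] blinfun.scaleR_right del: scaleR_conv_of_real of_real_def)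
    ultimately have "((\<lambda>s. H (complex_of_real s)) has_real_derivative h1 s) (at s)"
      by (simp add: has_field_derivative_def)
    moreover have "\<forall>\<^sub>F x in nhds s. H (complex_of_real x) = h x"
      by (rule eventually_mono[OF eventually_nhds_in_open[of "{0<..}"]]) (use that assms(2) in auto)
    ultimately show ?thesis by (rule iffD1[OF DERIV_cong_ev[OF refl _ refl], rotated])
  qed
  have 2: "(h1 has_real_derivative h2 s) (at s)" for s
  proof -
    have "((\<lambda>s. DH (complex_of_real s)) has_derivative (\<lambda>x. D2H (complex_of_real s) (complex_of_real x))) (at s)"
      by (rule has_derivative_compose[OF r D2H])
    hence "((\<lambda>s. DH (complex_of_real s) 1) has_derivative (\<lambda>x. D2H (complex_of_real s) (complex_of_real x) 1)) (at s)"
      by (rule bounded_linear.has_derivative[OF blinfun.bounded_linear_left])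
    moreover have "(\<lambda>x. D2H (complex_of_real s) (complex_of_real x) 1) = (*) (h2 s)"
      by (rule ext) (simp add: h2_def sc[of _] blinfun.scaleR_right blinfun.scaleR_left del: scaleR_conv_of_real of_real_def)
    ultimately show ?thesis unfolding h1_def by (simp add: has_field_derivative_def)
  qed
  have "deriv (deriv h) s = h2 s" if "s > 0" for s
  proof -
    have "\<forall>\<^sub>F x in nhds s. deriv h x = h1 x"
      by (rule eventually_mono[OF eventually_nhds_in_open[of "{0<..}"]])
         (use that in \<open>auto intro: DERIV_imp_deriv 1\<close>)
    hence "deriv (deriv h) s = deriv h1 s" by (rule deriv_cong_ev) simp
    thus ?thesis using 2 by (simp add: DERIV_imp_deriv)
  qed
  with 1 2 show thesis by (intro that) auto
qed

text \<open>The Lipschitz bound on h is an interpolation: the increment of h over [s, s + 1] is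
  O(s^(-\<gamma>-1)), hence h' has this size at some point of the interval, and the bound on h''
  carries the estimate back to s.\<close>

lemma profile_asymptotics:
  fixes A \<gamma> \<beta> C :: real
    and H :: "complex \<Rightarrow> real" and h ht :: "real \<Rightarrow> real"
  assumes H_C2: "C2_plane H"
    and H_radial: "\<forall>p. H p = h (cmod p)"
    and A_pos: "A > 0" and gamma: "\<gamma> > 1" and beta: "\<beta> \<ge> 0"
    and h_expansion: "\<exists>s0. \<forall>s\<ge>s0. h s = 1 + A / s powr \<gamma> + ht s / s powr (\<gamma> + \<beta>)"
    and beta_gt1: "\<beta> > 1 \<Longrightarrow> bounded (ht ` {0<..})"
    and beta_01: "0 < \<beta> \<Longrightarrow> \<beta> \<le> 1 \<Longrightarrow>
                   (\<exists>B. (\<lambda>s. ht s - B) \<in> o[at_top](\<lambda>s. s powr (\<beta> - 1)))"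
    and beta_0: "\<beta> = 0 \<Longrightarrow> (\<exists>B. B > - A \<and> (\<lambda>s. ht s - B) \<in> o[at_top](\<lambda>s. 1 / s))"
    and C_pos: "C > 0"
    and h2_bound: "\<exists>s0. \<forall>s\<ge>s0. \<bar>deriv (deriv h) s\<bar> \<le> C * s powr (- (\<gamma> + 1 + min 1 \<beta>))"
  obtains A' C1 s1 where "A' > 0" "C1 > 0" "s1 \<ge> 1"
    "\<And>s. s \<ge> s1 \<Longrightarrow> \<bar>h s - 1\<bar> \<le> C1 * s powr (-\<gamma>)"
    "\<And>s s'. s \<ge> s1 \<Longrightarrow> s' \<ge> s \<Longrightarrow> \<bar>h s - h s'\<bar> \<le> C1 * s powr (-\<gamma>-1) * \<bar>s - s'\<bar>"
    "\<And>e. e > 0 \<Longrightarrow> \<forall>\<^sub>F s in at_top. \<forall>x. \<bar>x\<bar> \<le> 1 \<longrightarrow>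
       \<bar>h (s + x) - h s + \<gamma> * A' * x * s powr (-\<gamma>-1)\<bar> \<le> e * s powr (-\<gamma>-1)"
proof -
  obtain A' B \<beta>' f where A': "A' > 0" "\<beta>' > 0" "f \<in> o(\<lambda>s. s powr (-\<gamma>-1))"
    and exp: "\<forall>\<^sub>F s in at_top. h s = 1 + A' * s powr (-\<gamma>) + B * s powr (-(\<gamma>+\<beta>')) + f s"
    by (rule profile_expansion[OF A_pos beta h_expansion beta_gt1 beta_01 beta_0])
  note diff = profile_difference[OF gamma A' _ exp]
  obtain h1 h2 where h1: "\<And>s. s > 0 \<Longrightarrow> (h has_real_derivative h1 s) (at s)"
    and h2: "\<And>s. s > 0 \<Longrightarrow> (h1 has_real_derivative h2 s) (at s)"
    and h2': "\<And>s. s > 0 \<Longrightarrow> deriv (deriv h) s = h2 s"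
    using radial_profile_C2[OF H_C2 H_radial] by metis
  obtain s0 where s0: "\<And>s. s \<ge> s0 \<Longrightarrow> \<bar>deriv (deriv h) s\<bar> \<le> C * s powr (- (\<gamma> + 1 + min 1 \<beta>))"
    using h2_bound by blast
  have "\<forall>\<^sub>F s in at_top. \<bar>h s - 1\<bar> \<le> (A' + \<bar>B\<bar> + 1) * s powr (-\<gamma>) \<and>
     (\<forall>x. \<bar>x\<bar> \<le> 1 \<longrightarrow> \<bar>h (s + x) - h s + \<gamma> * A' * x * s powr (-\<gamma>-1)\<bar> \<le> 1 * s powr (-\<gamma>-1))"
    by (intro eventually_conj diff profile_bound[OF gamma A' exp]) simp
  then obtain s2 where s2: "\<And>s. s \<ge> s2 \<Longrightarrow> \<bar>h s - 1\<bar> \<le> (A' + \<bar>B\<bar> + 1) * s powr (-\<gamma>)"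
     "\<And>s. s \<ge> s2 \<Longrightarrow> \<bar>h (s + 1) - h s + \<gamma> * A' * s powr (-\<gamma>-1)\<bar> \<le> s powr (-\<gamma>-1)"
    unfolding eventually_at_top_linorder by (metis abs_one mult_1 mult.right_neutral order_refl)
  define s1 where "s1 = Max {1, s0, s2}"
  have s1: "s1 \<ge> 1" "s1 \<ge> s0" "s1 \<ge> s2" by (auto simp: s1_def)
  \<comment> \<open>The increment of h over a unit step contributes \<gamma> A' + 1, from the
    expansion with e = 1; the drift of h' over that step contributes C.\<close>
  define C2 where "C2 = \<gamma> * A' + 1 + C"
  have h2b: "\<bar>h2 z\<bar> \<le> C * s powr (-\<gamma>-1)" if "s \<ge> s1" "z \<ge> s" for s z
  proof -
    have "\<bar>h2 z\<bar> \<le> C * z powr (- (\<gamma> + 1 + min 1 \<beta>))"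
      using s0[of z] h2'[of z] that s1 by simp
    also have "z powr (- (\<gamma> + 1 + min 1 \<beta>)) \<le> z powr (-\<gamma>-1)"
      using that s1 beta by (intro powr_mono) auto
    also have "z powr (-\<gamma>-1) \<le> s powr (-\<gamma>-1)" using that s1 gamma by (intro powr_mono2') auto
    finally show ?thesis using C_pos by (simp add: mult_left_mono)
  qed
  have h1b: "\<bar>h1 s\<bar> \<le> C2 * s powr (-\<gamma>-1)" if s: "s \<ge> s1" for s
  proof -
    obtain z where z: "s < z" "z < s + 1" "h (s + 1) - h s = (s + 1 - s) * h1 z"
      using MVT2[of s "s+1" h h1] h1 s s1 by auto
    obtain w where w: "s < w" "w < z" "h1 z - h1 s = (z - s) * h2 w"
      using MVT2[of s z h1 h2] h2 s s1 z by auto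
    have "\<bar>h1 z - h1 s\<bar> \<le> 1 * (C * s powr (-\<gamma>-1))"
      unfolding w(3) abs_mult using z w h2b[OF s, of w] by (intro mult_mono) auto
    moreover have "\<bar>h1 z\<bar> \<le> \<gamma> * A' * s powr (-\<gamma>-1) + s powr (-\<gamma>-1)"
    proof -
      have "\<gamma> * A' * s powr (-\<gamma>-1) \<ge> 0" using gamma A' by simp
      thus ?thesis using s2(2)[of s] s s1 z(3) by simp
    qed
    ultimately show ?thesis unfolding C2_def by (simp add: algebra_simps)
  qed
  have lip: "\<bar>h s - h s'\<bar> \<le> C2 * s powr (-\<gamma>-1) * \<bar>s - s'\<bar>" if s: "s \<ge> s1" "s' \<ge> s" for s s'
  proof (cases "s = s'")
    case False
    then obtain z where z: "s < z" "z < s'" "h s' - h s = (s' - s) * h1 z"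
      using MVT2[of s s' h h1] h1 s s1 by auto
    have "\<bar>h1 z\<bar> \<le> C2 * z powr (-\<gamma>-1)" using h1b[of z] z s by simp
    also have "z powr (-\<gamma>-1) \<le> s powr (-\<gamma>-1)" using z s s1 gamma by (intro powr_mono2') auto
    hence "C2 * z powr (-\<gamma>-1) \<le> C2 * s powr (-\<gamma>-1)"
      using gamma A' C_pos by (intro mult_left_mono) (auto simp: C2_def)
    finally have "\<bar>s' - s\<bar> * \<bar>h1 z\<bar> \<le> \<bar>s' - s\<bar> * (C2 * s powr (-\<gamma>-1))" by (intro mult_left_mono) auto
    thus ?thesis using z(3) by (simp add: abs_mult[symmetric] abs_minus_commute mult_ac)
  qed simp
  define C1 where "C1 = max C2 (A' + \<bar>B\<bar> + 1)"
  have "C1 \<ge> C2" "C1 \<ge> A' + \<bar>B\<bar> + 1" "C1 > 0" using A' by (auto simp: C1_def)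
  show thesis
  proof (rule that[of A' C1 s1])
    fix s assume s: "s \<ge> s1"
    have "(A' + \<bar>B\<bar> + 1) * s powr (-\<gamma>) \<le> C1 * s powr (-\<gamma>)"
      using \<open>C1 \<ge> A' + \<bar>B\<bar> + 1\<close> by (intro mult_right_mono) auto
    thus "\<bar>h s - 1\<bar> \<le> C1 * s powr (-\<gamma>)" using s2(1)[of s] s s1 by linarith
    fix s' assume s': "s' \<ge> s"
    have "C2 * s powr (-\<gamma>-1) * \<bar>s - s'\<bar> \<le> C1 * s powr (-\<gamma>-1) * \<bar>s - s'\<bar>"
      using \<open>C1 \<ge> C2\<close> by (intro mult_right_mono) auto
    thus "\<bar>h s - h s'\<bar> \<le> C1 * s powr (-\<gamma>-1) * \<bar>s - s'\<bar>" using lip[OF s s'] by linarith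
  qed (use A' s1 \<open>C1 > 0\<close> diff in auto)
qed

section \<open>Curvature of normal graphs\<close>

text \<open>Multiplication by T is a rotation composed with scaling by the modulus of T.\<close>

lemma inner_mult_right_complex: "(x * T) \<bullet> (y * T) = (x \<bullet> y) * (cmod T)\<^sup>2" for x y T :: complex
  unfolding inner_complex_def cmod_power2 by (simp add: algebra_simps power2_eq_square)

lemma vector_derivative_eqI:
  assumes "\<And>t. (f has_vector_derivative f' t) (at t)"
  shows "(\<lambda>t. vector_derivative f (at t)) = f'"
  using assms by (intro ext vector_derivative_at)

context
  fixes V T :: "real \<Rightarrow> complex" and a b a' b' p :: "real \<Rightarrow> real"
  assumes V: "\<And>t. (V has_vector_derivative Complex (a t) (b t) * T t) (at t)"
    and T: "\<And>t. (T has_vector_derivative \<i> * of_real (p t) * T t) (at t)"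
    and T_unit: "\<And>t. cmod (T t) = 1"
    and a: "\<And>t. (a has_real_derivative a' t) (at t)"
    and b: "\<And>t. (b has_real_derivative b' t) (at t)"
begin

lemma moving_frame_second_derivative:
  "((\<lambda>t. Complex (a t) (b t) * T t) has_vector_derivative
     (Complex (a' t) (b' t) + \<i> * of_real (p t) * Complex (a t) (b t)) * T t) (at t)"
proof -
  have "((\<lambda>t. of_real (a t) + \<i> * of_real (b t)) has_vector_derivative of_real (a' t) + \<i> * of_real (b' t)) (at t)"
    using a[of t] b[of t]
    by (intro has_vector_derivative_add has_vector_derivative_mult_right has_vector_derivative_of_real)
       (simp_all add: has_real_derivative_iff_has_vector_derivative)
  hence "((\<lambda>t. Complex (a t) (b t)) has_vector_derivative Complex (a' t) (b' t)) (at t)"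
    by (simp add: Complex_eq)
  from has_vector_derivative_mult[OF this T[of t]] show ?thesis by (simp add: algebra_simps)
qed

text \<open>Both derivatives of V carry the factor T of modulus 1, which leaves inner products
  unchanged; only the coefficients a, b and the angular velocity p remain.\<close>

lemma curvature_moving_frame:
  "curvature V t = (a t * b' t - b t * a' t + p t * (a t * a t + b t * b t)) / sqrt (a t * a t + b t * b t) ^ 3"
proof -
  have n: "cmod (Complex (a t) (b t) * T t) = sqrt (a t * a t + b t * b t)"
    unfolding norm_mult T_unit by (simp add: complex_norm power2_eq_square)
  have "(\<i> * Complex (a t) (b t)) \<bullet> (Complex (a' t) (b' t) + \<i> * of_real (p t) * Complex (a t) (b t))
      = a t * b' t - b t * a' t + p t * (a t * a t + b t * b t)"
    by (simp add: inner_complex_def algebra_simps)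
  thus ?thesis
    unfolding curvature_def vector_derivative_eqI[OF V] vector_derivative_at[OF V]
      vector_derivative_at[OF moving_frame_second_derivative] n mult.assoc[symmetric] inner_mult_right_complex
    using T_unit by simp
qed

lemma regular_moving_frame:
  assumes "\<And>t. a t > 0" "continuous_on UNIV a'" "continuous_on UNIV b'" "continuous_on UNIV p"
  shows "regular_C2_curve V"
  unfolding regular_C2_curve_def
proof (intro exI[of _ "\<lambda>t. Complex (a t) (b t) * T t"] conjI allI V)
  have c: "continuous_on UNIV a" "continuous_on UNIV b" "continuous_on UNIV T"
    by (intro continuous_at_imp_continuous_on ballI DERIV_isCont[OF a] DERIV_isCont[OF b]
        has_vector_derivative_continuous[OF T])+
  show "(\<lambda>t. Complex (a t) (b t) * T t) C1_differentiable_on UNIV"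
    unfolding C1_differentiable_on_def
    using moving_frame_second_derivative
    by (intro exI[of _ "\<lambda>t. (Complex (a' t) (b' t) + \<i> * of_real (p t) * Complex (a t) (b t)) * T t"] conjI ballI)
       (auto simp: Complex_eq intro!: continuous_intros assms c)
  fix t show "Complex (a t) (b t) * T t \<noteq> 0"
  proof -
    have "T t \<noteq> 0" using T_unit[of t] by auto
    thus ?thesis using assms(1)[of t] by (simp add: complex_eq_iff[of "Complex (a t) (b t)"])
  qed
qed

end

text \<open>Differentiating a quotient by the speed V produces V^3. Clearing it leaves the identity
  without fractions that is verified for the unit tangent.\<close>

lemma divide_cube_eqI:
  fixes A K V X Y :: "'a::field"
  assumes "A * V\<^sup>2 + K * Y = X * Y * V\<^sup>2" "V \<noteq> 0"
  shows "inverse V * A + K / V ^ 3 * Y = X * (inverse V * Y)"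
proof -
  have "inverse V * A + K / V ^ 3 * Y = (A * V\<^sup>2 + K * Y) / V ^ 3"
    using assms(2) by (simp add: field_simps power2_eq_square power3_eq_cube)
  also have "\<dots> = X * (inverse V * Y)"
    unfolding assms(1) using assms(2) by (simp add: field_simps power2_eq_square power3_eq_cube)
  finally show ?thesis .
qed

section \<open>The rotating frame and the seven variables along the curve\<close>

definition shift_cis :: "real \<Rightarrow> real \<Rightarrow> complex" where "shift_cis d t = of_real d + cis t"

text \<open>Distance of U + \<phi> N from the origin once the rotation by cis (t/n) is removed. The
  minus sign arises because the normal is \<i> times a tangent that itself contains the factor
  \<i>.\<close>

definition dist_at :: "real \<Rightarrow> real \<Rightarrow> real \<Rightarrow> real \<Rightarrow> real" where
  "dist_at d R t x = cmod (of_real R + cis t - of_real x * sgn (shift_cis d t))"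

definition state :: "(real \<Rightarrow> real) \<Rightarrow> nat \<Rightarrow> real \<Rightarrow> real \<Rightarrow> real \<Rightarrow> real \<Rightarrow> vars" where
  "state h n R t x y = (R / n * cos t, R / n, R / n * sin t, 1 / n, x, y, h (dist_at (R / n) R t x) - 1)"

lemma state_vars [simp]:
  "var_g (state h n R t x y) = R / n * cos t" "var_d (state h n R t x y) = R / n"
  "var_k (state h n R t x y) = R / n * sin t" "omega (state h n R t x y) = 1 - 1 / n"
  "var_x (state h n R t x y) = x" "var_y (state h n R t x y) = y"
  "var_e (state h n R t x y) = h (dist_at (R / n) R t x) - 1"
  by (simp_all add: state_def var_g_def var_d_def var_k_def omega_def var_x_def var_y_def var_e_def)

lemma cmod_shift_cis: "(cmod (shift_cis d t))\<^sup>2 = 1 + 2 * (d * cos t) + d * d"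
proof -
  have "(cos t)\<^sup>2 + (sin t)\<^sup>2 = 1" by simp
  hence "(d + cos t)\<^sup>2 + (sin t)\<^sup>2 = 1 + 2 * (d * cos t) + d * d"
    by (simp add: power2_eq_square algebra_simps)
  thus ?thesis by (simp add: shift_cis_def cmod_power2)
qed

lemma speed2_state: "speed2 (state h n R t x y) = (cmod (shift_cis (R/n) t))\<^sup>2"
  unfolding cmod_shift_cis by (simp add: speed2_def)

lemma speed_state: "speed (state h n R t x y) = cmod (shift_cis (R/n) t)"
  unfolding speed_def speed2_state by simp

text \<open>For z = \<open>shift_cis d t\<close> the product cnj z * cis t equals 1 + d cis t. This
  expresses cis t through z, the direction of the tangent in the rotating frame.\<close>

lemma shift_cis_identity:
  "of_real ((cmod (shift_cis d t))\<^sup>2) * cis t = shift_cis d t * (1 + of_real (d * cos t) + \<i> * of_real (d * sin t))"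
proof -
  have "of_real ((cmod (shift_cis d t))\<^sup>2) * cis t = shift_cis d t * (cnj (shift_cis d t) * cis t)"
    by (simp add: complex_norm_square mult.assoc del: of_real_power)
  also have "cnj (shift_cis d t) * cis t = of_real d * cis t + cnj (cis t) * cis t"
    by (simp add: shift_cis_def algebra_simps)
  also have "cnj (cis t) * cis t = 1" by (simp add: cis_cnj cis_mult)
  also have "of_real d * cis t + 1 = 1 + of_real (d * cos t) + \<i> * of_real (d * sin t)"
    by (simp add: complex_eq_iff)
  finally show ?thesis .
qed

section \<open>Curvature of the graph over the unperturbed curve\<close>

context
  fixes n :: nat and R :: real and h :: "real \<Rightarrow> real" and \<phi> \<phi>1 q :: "real \<Rightarrow> real" and w :: "real \<Rightarrow> vars" and om d :: real
  assumes n: "n \<ge> 2"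
    and \<phi>: "\<And>t. (\<phi> has_real_derivative \<phi>1 t) (at t)"
    and \<phi>1: "\<And>t. (\<phi>1 has_real_derivative q t - \<phi> t) (at t)"
    and q_cont: "continuous_on UNIV q"
  defines "w \<equiv> \<lambda>t. state h n R t (\<phi> t) (\<phi>1 t)" and "om \<equiv> 1 - 1 / real n" and "d \<equiv> R / real n"
  assumes q: "\<And>t. q t = resid (w t) + var_e (w t) + 2 * var_g (w t)"
    and pos: "\<And>t. speed2 (w t) > 0" "\<And>t. tang (w t) > 0"
begin

lemma om_pos: "om > 0" using n by (simp add: om_def)

lemma accel_eq: "accel (w t) = om * om * (q t - \<phi> t)"
  using om_pos unfolding q resid_def linpart_def by (simp add: w_def om_def[symmetric])

definition tangent :: "real \<Rightarrow> complex" where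
  "tangent t = \<i> * cis (t / n) * sgn (shift_cis d (om * t))"

lemma shift_cis_nz: "shift_cis d t \<noteq> 0"
  using pos(1)[of t] by (auto simp: w_def speed2_state d_def)

lemma cis_split: "cis t = cis (t / n) * cis (om * t)"
  by (simp add: cis_mult om_def algebra_simps)

lemma cis_scaled_derivative: "((\<lambda>t. cis (c * t)) has_vector_derivative \<i> * of_real c * cis (c * t)) (at t)"
proof -
  have "((\<lambda>z. exp (\<i> * of_real c * z)) has_field_derivative \<i> * of_real c * exp (\<i> * of_real c * of_real t)) (at (of_real t))"
    by (auto intro!: derivative_eq_intros)
  from has_vector_derivative_real_field[OF this] show ?thesis
    by (simp add: cis_conv_exp mult.assoc)
qed

lemma U_derivative:
  "(U_curve n R has_vector_derivative of_real (speed (w (om * t))) * tangent t) (at t)"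
proof -
  have "((\<lambda>t. of_real R * cis (1 / n * t) + cis (1 * t)) has_vector_derivative
     of_real R * (\<i> * of_real (1 / n) * cis (1 / n * t)) + \<i> * of_real 1 * cis (1 * t)) (at t)"
    by (intro has_vector_derivative_add has_vector_derivative_mult_right cis_scaled_derivative)
  moreover have "of_real R * (\<i> * of_real (1 / n) * cis (1 / n * t)) + \<i> * of_real 1 * cis (1 * t)
      = \<i> * cis (t / n) * shift_cis d (om * t)"
    using cis_split[of t] by (simp add: shift_cis_def d_def algebra_simps)
  moreover have "\<dots> = of_real (speed (w (om * t))) * tangent t"
    using shift_cis_nz[of "om * t"]
    by (simp add: tangent_def sgn_eq w_def speed_state d_def)
  ultimately show ?thesis by (simp add: U_curve_def[abs_def])
qed

lemma norm_tangent: "cmod (tangent t) = 1"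
  using shift_cis_nz by (simp add: tangent_def norm_mult norm_sgn)

lemma speed_pos: "speed (w t) > 0"
  using pos(1) by (simp add: speed_def)

lemma N_normal_eq: "N_normal n R t = \<i> * tangent t"
  unfolding N_normal_def vector_derivative_at[OF U_derivative] norm_mult norm_tangent
  using speed_pos[of "om * t"] by simp

lemma chain_om:
  assumes "(f has_real_derivative f') (at (om * t))"
  shows "((\<lambda>t. f (om * t)) has_real_derivative om * f') (at t)"
  using DERIV_chain2[where g = "\<lambda>t. om * t", OF assms DERIV_cmult_Id] by (simp add: mult.commute)

lemma speed2_derivative:
  "((\<lambda>t. speed2 (w (om * t))) has_real_derivative - (2 * om * var_k (w (om * t)))) (at t)"
proof -
  have "((\<lambda>t. 1 + 2 * (d * cos t) + d * d) has_real_derivative - (2 * (d * sin t))) (at t)" for t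
    by (auto intro!: derivative_eq_intros)
  from chain_om[OF this[of "om * t"]] show ?thesis
    by (simp add: speed2_def w_def d_def mult_ac)
qed

lemma speed_derivative: "((\<lambda>t. speed (w (om * t))) has_real_derivative dspeed (w (om * t))) (at t)"
  unfolding speed_def
  by (rule DERIV_cong[OF DERIV_chain2[OF DERIV_real_sqrt[OF pos(1)] speed2_derivative]])
     (simp add: dspeed_def speed_def, simp add: w_def om_def field_simps)

lemma turn_derivative: "((\<lambda>t. turn (w (om * t))) has_real_derivative dturn (w (om * t))) (at t)"
proof -
  have nz: "speed2 (w t) \<noteq> 0" for t using pos(1)[of t] by simp
  have "((\<lambda>t. d * cos t + d * d) has_real_derivative - (d * sin t)) (at t)" for t
    by (auto intro!: derivative_eq_intros)
  from chain_om[OF this[of "om * t"]]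
  have "((\<lambda>t. d * cos (om * t) + d * d) has_real_derivative om * - (d * sin (om * t))) (at t)" .
  from DERIV_diff[OF DERIV_const[of 1] DERIV_cmult[OF DERIV_divide[OF this speed2_derivative nz], of om]]
  have *: "((\<lambda>t. turn (w (om * t))) has_real_derivative 0 - om * ((om * - (d * sin (om * t)) * speed2 (w (om * t)) -
      (d * cos (om * t) + d * d) * - (2 * om * var_k (w (om * t)))) / (speed2 (w (om * t)) * speed2 (w (om * t))))) (at t)"
    by (simp add: turn_def w_def om_def[symmetric] d_def)
  \<comment> \<open>The factor 1 - d^2 of \<open>dturn\<close> is speed2 - 2(g + d^2).\<close>
  have "om * - (d * sin (om * t)) * speed2 (w (om * t)) - (d * cos (om * t) + d * d) * - (2 * om * var_k (w (om * t)))
     = - (om * (1 - d * d) * (d * sin (om * t)))"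
    by (simp add: speed2_def w_def d_def[symmetric] algebra_simps)
  thus ?thesis unfolding dturn_def using *
    by (simp add: w_def om_def[symmetric] d_def[symmetric] mult_ac)
qed

text \<open>The derivative of 1/v contributes a real multiple of the tangent. It cancels against the
  term \<i> k of \<open>shift_cis_identity\<close>; what is left is an imaginary multiple of the
  tangent, with coefficient \<open>turn\<close>.\<close>

lemma tangent_derivative:
  "(tangent has_vector_derivative \<i> * of_real (turn (w (om * t))) * tangent t) (at t)"
proof -
  define v e E z k g where "v = (\<lambda>t. speed (w (om * t)))" and "e = cis (t / n)" and "E = cis (om * t)"
    and "z = shift_cis d (om * t)" and "k = d * sin (om * t)" and "g = d * cos (om * t)"
  have v: "v t > 0" for t using speed_pos by (simp add: v_def)
  have tan: "tangent = (\<lambda>t. of_real (inverse (v t)) * (\<i> * cis (1 / n * t) * (of_real d + cis (om * t))))"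
  proof (rule ext)
    fix t
    have "v t = cmod (of_real d + cis (om * t))" by (simp add: v_def w_def speed_state d_def shift_cis_def)
    thus "tangent t = of_real (inverse (v t)) * (\<i> * cis (1 / n * t) * (of_real d + cis (om * t)))"
      by (simp add: tangent_def sgn_eq shift_cis_def divide_inverse mult_ac)
  qed
  have "((\<lambda>t. inverse (v t)) has_real_derivative - (inverse (v t) * dspeed (w (om * t)) * inverse (v t))) (at t)"
    unfolding v_def by (rule DERIV_inverse'[OF speed_derivative]) (use speed_pos[of "om * t"] in simp)
  moreover have "- (inverse (v t) * dspeed (w (om * t)) * inverse (v t)) = om * k / (v t ^ 3)"
    by (simp add: dspeed_def v_def k_def w_def om_def[symmetric] d_def[symmetric] field_simps power3_eq_cube)
  ultimately have dv: "((\<lambda>t. complex_of_real (inverse (v t))) has_vector_derivative of_real (om * k / v t ^ 3)) (at t)"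
    by (intro has_vector_derivative_of_real) (simp add: has_real_derivative_iff_has_vector_derivative)
  have dz: "((\<lambda>t. \<i> * cis (1 / n * t) * (of_real d + cis (om * t))) has_vector_derivative
      (\<i> * cis (1 / n * t)) * (0 + \<i> * of_real om * cis (om * t))
      + \<i> * (\<i> * of_real (1 / n) * cis (1 / n * t)) * (of_real d + cis (om * t))) (at t)"
    by (intro has_vector_derivative_mult has_vector_derivative_add has_vector_derivative_mult_right
        cis_scaled_derivative has_vector_derivative_const)
  have "(tangent has_vector_derivative of_real (inverse (v t)) * ((\<i> * e) * (\<i> * of_real om * E) + \<i> * (\<i> * of_real (1 / n) * e) * z)
     + of_real (om * k / v t ^ 3) * (\<i> * e * z)) (at t)"
    using has_vector_derivative_mult[OF dv dz] unfolding tan by (simp add: e_def E_def z_def shift_cis_def)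
  moreover have "of_real (inverse (v t)) * ((\<i> * e) * (\<i> * of_real om * E) + \<i> * (\<i> * of_real (1 / n) * e) * z)
     + of_real (om * k / v t ^ 3) * (\<i> * e * z) = \<i> * of_real (turn (w (om * t))) * tangent t"
  proof -
    have id: "of_real ((v t)\<^sup>2) * E = z * (1 + of_real g + \<i> * of_real k)"
      using shift_cis_identity[of d "om * t"]
      by (simp add: v_def w_def speed_state d_def[symmetric] E_def z_def g_def k_def)
    have v2: "(v t)\<^sup>2 = 1 + 2 * g + d * d"
      by (simp add: v_def w_def speed_state d_def[symmetric] cmod_shift_cis g_def)
    have tv: "turn (w (om * t)) * (v t)\<^sup>2 = (v t)\<^sup>2 - om * (g + d * d)"
      using v[of t] pos(1)[of "om * t"]
      by (simp add: turn_def speed2_state w_def om_def[symmetric] d_def[symmetric] v_def speed_state g_def field_simps)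
    have "1 / n = 1 - om" by (simp add: om_def)
    have tan_t: "tangent t = of_real (inverse (v t)) * (\<i> * e * z)"
      using tan by (simp add: e_def z_def shift_cis_def)
    define P where "P = turn (w (om * t))"
    define vt where "vt = v t"
    have vt: "vt > 0" using v by (simp add: vt_def)
    have P: "of_real P * (of_real vt)\<^sup>2 = (of_real vt)\<^sup>2 - complex_of_real om * (of_real g + of_real d * of_real d)"
      using arg_cong[OF tv, of complex_of_real] by (simp add: P_def vt_def)
    have V: "(complex_of_real vt)\<^sup>2 = 1 + 2 * of_real g + of_real d * of_real d"
      using arg_cong[OF v2, of complex_of_real] by (simp add: vt_def)
    have I: "(complex_of_real vt)\<^sup>2 * E = z * (1 + of_real g + \<i> * of_real k)"
      using id by (simp add: vt_def)
    have "(of_real vt)\<^sup>2 * (\<i> * of_real om * E + \<i> * (1 - of_real om) * z) + of_real om * of_real k * z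
       = \<i> * (of_real P * (of_real vt)\<^sup>2) * z"
    proof -
      have "(of_real vt)\<^sup>2 * (\<i> * of_real om * E + \<i> * (1 - of_real om) * z) + of_real om * of_real k * z
         = \<i> * of_real om * ((of_real vt)\<^sup>2 * E) + (of_real vt)\<^sup>2 * \<i> * (1 - of_real om) * z + of_real om * of_real k * z"
        by (simp add: algebra_simps)
      also have "\<dots> = \<i> * ((of_real vt)\<^sup>2 + of_real om * (1 + of_real g - (of_real vt)\<^sup>2)) * z"
        unfolding I by (simp add: algebra_simps)
      also have "\<dots> = \<i> * (of_real P * (of_real vt)\<^sup>2) * z"
        unfolding P by (simp add: V algebra_simps)
      finally show ?thesis .
    qed
    from arg_cong[OF this, of "\<lambda>X. \<i> * e * X"]
    have "((\<i> * e) * (\<i> * of_real om * E) + \<i> * (\<i> * (1 - of_real om) * e) * z) * (of_real vt)\<^sup>2 + of_real om * of_real k * (\<i> * e * z)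
       = \<i> * of_real P * (\<i> * e * z) * (of_real vt)\<^sup>2"
      by (simp add: algebra_simps)
    hence "of_real (inverse vt) * ((\<i> * e) * (\<i> * of_real om * E) + \<i> * (\<i> * (1 - of_real om) * e) * z)
     + of_real om * of_real k / of_real vt ^ 3 * (\<i> * e * z) = \<i> * of_real P * (of_real (inverse vt) * (\<i> * e * z))"
      unfolding of_real_inverse using vt by (intro divide_cube_eqI) auto
    thus ?thesis using \<open>1 / n = 1 - om\<close> unfolding tan_t P_def[symmetric] vt_def[symmetric] by simp
  qed
  ultimately show ?thesis by simp
qed

definition graph_curve :: "real \<Rightarrow> complex" where
  "graph_curve t = U_curve n R t + of_real (\<phi> (om * t)) * N_normal n R t"

lemma norm_graph_curve: "cmod (graph_curve t) = dist_at d R (om * t) (\<phi> (om * t))"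
proof -
  have "graph_curve t = cis (t / n) * (of_real R + cis (om * t) - of_real (\<phi> (om * t)) * sgn (shift_cis d (om * t)))"
    unfolding graph_curve_def N_normal_eq tangent_def U_curve_def
    by (subst cis_split[of t]) (simp add: algebra_simps)
  thus ?thesis by (simp add: norm_mult dist_at_def)
qed

lemma graph_curve_derivative:
  "(graph_curve has_vector_derivative Complex (tang (w (om * t))) (norml (w (om * t))) * tangent t) (at t)"
proof -
  have "((\<lambda>t. \<phi> (om * t)) has_real_derivative om * \<phi>1 (om * t)) (at t)" by (rule chain_om[OF \<phi>])
  hence d\<phi>: "((\<lambda>t. complex_of_real (\<phi> (om * t))) has_vector_derivative of_real (om * \<phi>1 (om * t))) (at t)"
    by (intro has_vector_derivative_of_real) (simp add: has_real_derivative_iff_has_vector_derivative)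
  from has_vector_derivative_add[OF U_derivative has_vector_derivative_mult[OF this
      has_vector_derivative_mult_right[OF tangent_derivative, of \<i>]]]
  show ?thesis unfolding graph_curve_def[abs_def] N_normal_eq
    by (simp add: Complex_eq tang_def norml_def w_def om_def[symmetric] algebra_simps)
qed

lemma tang_derivative:
  "((\<lambda>t. tang (w (om * t))) has_real_derivative
     dspeed (w (om * t)) - dturn (w (om * t)) * \<phi> (om * t) - turn (w (om * t)) * norml (w (om * t))) (at t)"
  using DERIV_diff[OF speed_derivative DERIV_mult[OF turn_derivative chain_om[OF \<phi>]], of t]
  unfolding tang_def norml_def
  by (simp add: w_def om_def[symmetric] algebra_simps)

text \<open>Here the differential equation for \<phi> enters: by \<open>accel_eq\<close> it
  identifies the derivative of the normal component with \<open>accel\<close>.\<close>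

lemma norml_derivative:
  "((\<lambda>t. norml (w (om * t))) has_real_derivative accel (w (om * t))) (at t)"
  using DERIV_cmult[OF chain_om[OF \<phi>1], of om t]
  unfolding norml_def accel_eq by (simp add: w_def om_def[symmetric] mult_ac)

text \<open>Since \<open>accel\<close> solves the curvature formula for the normal acceleration,
  inserting it back returns the prescribed value \<open>1 + var_e\<close>, which is h at the
  distance of the curve from the origin.\<close>

lemma graph_curve_curvature: "curvature graph_curve t = h (cmod (graph_curve t))"
proof -
  define W where "W = w (om * t)"
  have v2: "vel2 W > 0"
    using pos(2)[of "om * t"] unfolding vel2_def W_def by (intro add_pos_nonneg) auto
  have x: "var_x W = \<phi> (om * t)" by (simp add: W_def w_def)
  have "accel W * tang W = vel2 W * (sqrt (vel2 W) * (1 + var_e W) - turn W)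
        + norml W * (dspeed W - dturn W * var_x W) - turn W * norml W * norml W"
    using pos(2)[of "om * t"] by (simp add: accel_def W_def)
  hence num: "tang W * accel W - norml W * (dspeed W - dturn W * \<phi> (om * t) - turn W * norml W) + turn W * vel2 W
      = (vel2 W * sqrt (vel2 W)) * (1 + var_e W)"
    unfolding x by (simp add: algebra_simps)
  have "sqrt (vel2 W) ^ 3 = vel2 W * sqrt (vel2 W)" using v2 by (simp add: power3_eq_cube)
  hence "curvature graph_curve t = 1 + var_e W"
    unfolding curvature_moving_frame[OF graph_curve_derivative tangent_derivative norm_tangent
      tang_derivative norml_derivative] W_def[symmetric] vel2_def[symmetric] num
    using v2 by simp
  thus ?thesis by (simp add: W_def w_def norm_graph_curve d_def)
qed

lemma graph_curve_regular: "regular_C2_curve graph_curve"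
proof (rule regular_moving_frame[OF graph_curve_derivative tangent_derivative norm_tangent
      tang_derivative norml_derivative])
  have c: "continuous_on UNIV (\<lambda>t. speed2 (w (om * t)))" "continuous_on UNIV (\<lambda>t. speed (w (om * t)))"
    "continuous_on UNIV (\<lambda>t. turn (w (om * t)))" "continuous_on UNIV (\<lambda>t. \<phi> (om * t))"
    "continuous_on UNIV (\<lambda>t. norml (w (om * t)))"
    by (intro continuous_at_imp_continuous_on ballI DERIV_isCont[OF speed2_derivative]
        DERIV_isCont[OF speed_derivative] DERIV_isCont[OF turn_derivative] DERIV_isCont[OF chain_om[OF \<phi>]]
        DERIV_isCont[OF norml_derivative])+
  have nz: "speed2 (w t) \<noteq> 0" "speed (w t) \<noteq> 0" for t using pos(1)[of t] speed_pos[of t] by simp_all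
  have k: "continuous_on UNIV (\<lambda>t. var_k (w (om * t)))" "continuous_on UNIV (\<lambda>t. omega (w (om * t)))"
     "continuous_on UNIV (\<lambda>t. var_d (w (om * t)))"
    by (simp_all add: w_def, intro continuous_intros) (use n in auto)
  show "continuous_on UNIV (\<lambda>t. turn (w (om * t)))" by (fact c)
  have q': "continuous_on UNIV (\<lambda>t. q (om * t))"
    by (rule continuous_on_compose2[OF q_cont]) (auto intro!: continuous_intros)
  show "continuous_on UNIV (\<lambda>t. accel (w (om * t)))"
    unfolding accel_eq by (intro continuous_intros q' c)
  show "continuous_on UNIV (\<lambda>t. dspeed (w (om * t)) - dturn (w (om * t)) * \<phi> (om * t) - turn (w (om * t)) * norml (w (om * t)))"
    unfolding dspeed_def dturn_def by (intro continuous_intros c k; simp add: nz)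
qed (use pos in auto)

end

section \<open>Estimates and conclusion\<close>

lemma cmod_cis_diff_le: "cmod (cis s - cis t) \<le> \<bar>s - t\<bar>"
proof -
  have "cis s - cis t = cis t * (cis (s - t) - 1)" by (simp add: cis_mult algebra_simps)
  hence "cmod (cis s - cis t) = cmod (cis (s - t) - 1)" by (simp add: norm_mult)
  also have "\<dots> = 2 * \<bar>sin ((s - t) / 2)\<bar>" using dist_exp_i_1[of "s - t"] by (simp add: cis_conv_exp)
  also have "\<dots> \<le> 2 * \<bar>(s - t) / 2\<bar>" using abs_sin_x_le_abs_x[of "(s - t) / 2"] by simp
  finally show ?thesis by simp
qed

lemma
  fixes s t :: real
  shows abs_cos_diff_le: "\<bar>cos s - cos t\<bar> \<le> \<bar>s - t\<bar>"
    and abs_sin_diff_le: "\<bar>sin s - sin t\<bar> \<le> \<bar>s - t\<bar>"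
  using abs_Re_le_cmod[of "cis s - cis t"] abs_Im_le_cmod[of "cis s - cis t"] cmod_cis_diff_le[of s t]
  by auto

text \<open>sgn z - sgn w is ((z - w) + (norm w - norm z) sgn w) / norm z, and both summands of the
  numerator are at most norm (z - w). Only norm z is divided by.\<close>

lemma norm_sgn_diff_le:
  fixes z w :: "'a::real_normed_vector"
  assumes "c > 0" "norm z \<ge> c" shows "norm (sgn z - sgn w) \<le> 2 / c * norm (z - w)"
proof -
  have z: "norm z > 0" using assms by linarith
  have "sgn z - sgn w = (1 / norm z) *\<^sub>R ((z - w) + (norm w - norm z) *\<^sub>R sgn w)"
  proof -
    have "norm w *\<^sub>R sgn w = w" by (cases "w = 0") (simp_all add: sgn_div_norm)
    thus ?thesis using z by (simp add: sgn_div_norm[of z] algebra_simps inverse_eq_divide)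
  qed
  hence "norm (sgn z - sgn w) = norm ((z - w) + (norm w - norm z) *\<^sub>R sgn w) / norm z"
    using z by simp
  also have "\<dots> \<le> (norm (z - w) + \<bar>norm w - norm z\<bar> * 1) / norm z"
    using z by (intro divide_right_mono order_trans[OF norm_triangle_ineq] add_left_mono)
      (auto simp: norm_sgn)
  also have "\<dots> \<le> (2 * norm (z - w)) / norm z"
    using z norm_triangle_ineq3[of w z] by (intro divide_right_mono) (auto simp: norm_minus_commute)
  also have "\<dots> \<le> 2 * norm (z - w) / c" using assms by (intro divide_left_mono mult_pos_pos z) auto
  finally show ?thesis by simp
qed

text \<open>For d \<le> 1/2 the modulus of \<open>shift_cis d t\<close> is at least 1/2, so its
  direction varies with constant 4; t counts once more through cis t, whence 5.\<close>

lemma dist_at_diff_le: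
  assumes d: "0 \<le> d" "d \<le> 1/2" and x': "\<bar>x'\<bar> \<le> 1"
  shows "\<bar>dist_at d R t x - dist_at d' R' t' x'\<bar> \<le> \<bar>R - R'\<bar> + 5 * \<bar>t - t'\<bar> + \<bar>x - x'\<bar> + 4 * \<bar>d - d'\<bar>"
proof -
  let ?s = "sgn (shift_cis d t)" and ?s' = "sgn (shift_cis d' t')"
  have "cmod (cis t) - cmod (complex_of_real d) \<le> cmod (cis t + of_real d)" by (rule norm_diff_ineq)
  hence "1/2 \<le> cmod (shift_cis d t)" using d by (simp add: shift_cis_def add.commute)
  from norm_sgn_diff_le[OF _ this, of "shift_cis d' t'"]
  have "cmod (?s - ?s') \<le> 4 * cmod (shift_cis d t - shift_cis d' t')" by simp
  also have "shift_cis d t - shift_cis d' t' = of_real (d - d') + (cis t - cis t')"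
    by (simp add: shift_cis_def)
  also have "cmod \<dots> \<le> \<bar>d - d'\<bar> + \<bar>t - t'\<bar>"
    using cmod_cis_diff_le[of t t'] by (intro order_trans[OF norm_triangle_ineq] add_mono) (auto simp del: of_real_diff)
  finally have s: "cmod (?s - ?s') \<le> 4 * (\<bar>d - d'\<bar> + \<bar>t - t'\<bar>)" by simp
  have "\<bar>dist_at d R t x - dist_at d' R' t' x'\<bar>
     \<le> cmod ((of_real R + cis t - of_real x * ?s) - (of_real R' + cis t' - of_real x' * ?s'))"
    unfolding dist_at_def by (rule norm_triangle_ineq3)
  also have "(of_real R + cis t - of_real x * ?s) - (of_real R' + cis t' - of_real x' * ?s')
     = (of_real (R - R') + (cis t - cis t')) - (of_real (x - x') * ?s + of_real x' * (?s - ?s'))"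
    by (simp add: algebra_simps)
  also have "cmod \<dots> \<le> (cmod (of_real (R - R')) + cmod (cis t - cis t'))
     + (cmod (of_real (x - x') * ?s) + cmod (of_real x' * (?s - ?s')))"
    by (intro order_trans[OF norm_triangle_ineq4] add_mono norm_triangle_ineq)
  also have "cmod (of_real (x - x') * ?s) \<le> \<bar>x - x'\<bar> * 1"
    unfolding norm_mult by (intro mult_mono) (auto simp: norm_sgn simp del: of_real_diff)
  also have "cmod (of_real x' * (?s - ?s')) \<le> 1 * (4 * (\<bar>d - d'\<bar> + \<bar>t - t'\<bar>))"
    unfolding norm_mult by (intro mult_mono s) (use x' in auto)
  also have "cmod (cis t - cis t') \<le> \<bar>t - t'\<bar>" by (rule cmod_cis_diff_le)
  finally show ?thesis by (simp del: of_real_diff)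
qed

lemma dist_at_ge:
  assumes "\<bar>x\<bar> \<le> 1" shows "dist_at d R t x \<ge> R - 2"
proof -
  have "cmod (of_real x * sgn (shift_cis d t)) \<le> 1 * 1"
    unfolding norm_mult by (intro mult_mono) (use assms in \<open>auto simp: norm_sgn\<close>)
  hence "cmod (of_real x * sgn (shift_cis d t) - cis t) \<le> 2"
    by (intro order_trans[OF norm_triangle_ineq4]) simp
  moreover have "cmod (of_real R) - cmod (of_real x * sgn (shift_cis d t) - cis t) \<le> dist_at d R t x"
    using norm_triangle_ineq2[of "of_real R" "of_real x * sgn (shift_cis d t) - cis t"]
    by (simp add: dist_at_def algebra_simps)
  ultimately show ?thesis by simp
qed

text \<open>The modulus of R + cis t exceeds R + cos t by at most 1/R, because sin^2 t \<le> 1 \<le>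
  2(R + cos t)/R. The displacement along the normal adds at most the absolute value of x.\<close>

lemma dist_at_near:
  assumes "R \<ge> 2" shows "\<bar>dist_at d R t x - (R + cos t)\<bar> \<le> \<bar>x\<bar> + 1 / R"
proof -
  let ?p = "complex_of_real R + cis t"
  have c: "cos t \<ge> -1" by simp
  have pos: "R + cos t \<ge> R / 2" using assms c by linarith
  have "\<bar>cmod (?p - of_real x * sgn (shift_cis d t)) - cmod ?p\<bar> \<le> cmod (of_real x * sgn (shift_cis d t))"
    using norm_triangle_ineq3[of "?p - of_real x * sgn (shift_cis d t)" ?p] by simp
  also have "\<dots> \<le> \<bar>x\<bar> * 1" unfolding norm_mult by (intro mult_mono) (auto simp: norm_sgn)
  finally have 1: "\<bar>dist_at d R t x - cmod ?p\<bar> \<le> \<bar>x\<bar>" by (simp add: dist_at_def)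
  have sq: "(cmod ?p)\<^sup>2 = (R + cos t)\<^sup>2 + (sin t)\<^sup>2" by (simp add: cmod_power2)
  have "R + cos t \<le> cmod ?p" using complex_Re_le_cmod[of ?p] by simp
  moreover have "cmod ?p \<le> R + cos t + 1 / R"
  proof (rule power2_le_imp_le)
    have "(sin t)\<^sup>2 \<le> 1" by (simp add: abs_square_le_1)
    also have "1 = 2 * (R / 2) * (1 / R)" using assms by simp
    also have "\<dots> \<le> 2 * (R + cos t) * (1 / R)" using pos assms by (intro mult_right_mono) auto
    also have "\<dots> \<le> 2 * (R + cos t) * (1 / R) + (1/R)\<^sup>2" by simp
    finally have "(sin t)\<^sup>2 \<le> 2 * (R + cos t) * (1 / R) + (1/R)\<^sup>2" .
    thus "(cmod ?p)\<^sup>2 \<le> (R + cos t + 1 / R)\<^sup>2"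
      unfolding sq power2_sum[of "R + cos t" "1/R"] by simp
    have "0 \<le> R + cos t" "0 \<le> 1 / R" using pos assms by simp_all
    thus "0 \<le> R + cos t + 1 / R" by linarith
  qed
  ultimately show ?thesis using 1 by linarith
qed

lemma norm_vars_le: "norm ((a, b, c, d, e, f, g) :: vars) \<le> \<bar>a\<bar> + \<bar>b\<bar> + \<bar>c\<bar> + \<bar>d\<bar> + \<bar>e\<bar> + \<bar>f\<bar> + \<bar>g\<bar>"
proof -
  have "norm ((a, b, c, d, e, f, g) :: vars) \<le> \<bar>a\<bar> + (\<bar>b\<bar> + (\<bar>c\<bar> + (\<bar>d\<bar> + (\<bar>e\<bar> + (\<bar>f\<bar> + \<bar>g\<bar>)))))"
    by (intro order_trans[OF norm_Pair_le] add_mono; simp)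
  thus ?thesis by (simp add: add.assoc)
qed

text \<open>Up to distance 1 the Lipschitz bound controls the Hoelder quotient, beyond it the sup
  bound does. The seminorm is thus at most 2M, and three sup norms bring the total to 5M.\<close>

lemma C2alpha_estimate:
  fixes \<alpha> T M :: real
  assumes alpha: "0 < \<alpha>" "\<alpha> < 1" and T: "T > 0"
    and per: "\<And>t. \<phi> (t + T) = \<phi> t"
    and \<phi>: "\<And>t. (\<phi> has_real_derivative \<phi>1 t) (at t)"
    and \<phi>1: "\<And>t. (\<phi>1 has_real_derivative \<phi>2 t) (at t)"
    and bounds: "\<And>t. \<bar>\<phi> t\<bar> \<le> M" "\<And>t. \<bar>\<phi>1 t\<bar> \<le> M" "\<And>t. \<bar>\<phi>2 t\<bar> \<le> M"
    and lip: "\<And>s t. \<bar>\<phi>2 s - \<phi>2 t\<bar> \<le> M * \<bar>s - t\<bar>"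
  shows "C2alpha_periodic \<alpha> T \<phi> \<and> C2alpha_norm \<alpha> T \<phi> \<le> 5 * M"
proof -
  have M: "M \<ge> 0" using bounds(1)[of 0] by linarith
  have hoelder: "\<bar>\<phi>2 s - \<phi>2 t\<bar> \<le> 2 * M * \<bar>s - t\<bar> powr \<alpha>" for s t
  proof (cases "\<bar>s - t\<bar> \<le> 1")
    case True
    have "\<bar>s - t\<bar> \<le> \<bar>s - t\<bar> powr \<alpha>"
      using True alpha powr_mono'[of \<alpha> 1 "\<bar>s - t\<bar>"] by simp
    hence "M * \<bar>s - t\<bar> \<le> M * \<bar>s - t\<bar> powr \<alpha>" using M by (intro mult_left_mono)
    moreover have "0 \<le> M * \<bar>s - t\<bar> powr \<alpha>" using M by simp
    ultimately show ?thesis using lip[of s t] by linarith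
  next
    case False
    hence "1 \<le> \<bar>s - t\<bar> powr \<alpha>" using alpha by (intro ge_one_powr_ge_zero) auto
    hence "2 * M * 1 \<le> 2 * M * \<bar>s - t\<bar> powr \<alpha>" using M by (intro mult_left_mono) auto
    thus ?thesis using bounds(3)[of s] bounds(3)[of t] by linarith
  qed
  have "C2alpha_periodic \<alpha> T \<phi>"
    unfolding C2alpha_periodic_def using per \<phi> \<phi>1 hoelder by blast
  moreover have d: "deriv \<phi> = \<phi>1" "deriv \<phi>1 = \<phi>2" using \<phi> \<phi>1 by (auto intro!: ext DERIV_imp_deriv)
  have "(0, T) \<in> {(s, t). s \<in> {0..T} \<and> t \<in> {0..T} \<and> s \<noteq> t}" using T by simp
  hence ne: "{0..T} \<noteq> {}" "{(s, t). s \<in> {0..T} \<and> t \<in> {0..T} \<and> s \<noteq> t} \<noteq> {}"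
    using T by (simp, blast)
  have "(SUP t\<in>{0..T}. \<bar>\<phi> t\<bar>) \<le> M" "(SUP t\<in>{0..T}. \<bar>\<phi>1 t\<bar>) \<le> M" "(SUP t\<in>{0..T}. \<bar>\<phi>2 t\<bar>) \<le> M"
    by (intro cSUP_least bounds ne)+
  moreover have "(SUP st\<in>{(s, t). s \<in> {0..T} \<and> t \<in> {0..T} \<and> s \<noteq> t}.
          \<bar>\<phi>2 (fst st) - \<phi>2 (snd st)\<bar> / \<bar>fst st - snd st\<bar> powr \<alpha>) \<le> 2 * M"
    using hoelder by (intro cSUP_least ne) (auto simp: divide_le_eq)
  ultimately show ?thesis
    unfolding C2alpha_norm_def d by linarith
qed

section \<open>The forcing term and its symmetries\<close>

definition forcing :: "(real \<Rightarrow> real) \<Rightarrow> nat \<Rightarrow> real \<Rightarrow> real \<Rightarrow> real \<Rightarrow> real \<Rightarrow> real" where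
  "forcing h n R t x y = resid (state h n R t x y) + var_e (state h n R t x y) + 2 * var_g (state h n R t x y)"

lemma shift_cis_uminus: "shift_cis d (-t) = cnj (shift_cis d t)"
  by (simp add: shift_cis_def complex_eq_iff)

lemma dist_at_uminus: "dist_at d R (-t) x = dist_at d R t x"
proof -
  have "of_real R + cis (-t) - of_real x * sgn (shift_cis d (-t)) = cnj (of_real R + cis t - of_real x * sgn (shift_cis d t))"
    by (simp add: shift_cis_uminus sgn_eq cis_cnj[symmetric])
  thus ?thesis unfolding dist_at_def by (metis complex_mod_cnj)
qed

lemma dist_at_periodic: "dist_at d R (t + 2*pi) x = dist_at d R t x"
  by (simp add: dist_at_def shift_cis_def cis.ctr)

text \<open>Reflection of \<tau> flips sin \<tau> and \<phi>', hence \<open>dspeed\<close>,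
  \<open>dturn\<close> and \<open>norml\<close>. In \<open>accel\<close> these occur only in
  products of two, which are unchanged.\<close>

lemma forcing_even: "forcing h n R (-t) x (-y) = forcing h n R t x y"
proof -
  define v w where "v = state h n R (-t) x (-y)" and "w = state h n R t x y"
  have 1: "var_g v = var_g w" "var_d v = var_d w" "var_k v = - var_k w" "omega v = omega w"
    "var_x v = var_x w" "var_y v = - var_y w" "var_e v = var_e w"
    by (simp_all add: v_def w_def dist_at_uminus)
  have 2: "speed2 v = speed2 w" by (simp add: speed2_def 1)
  have 3: "speed v = speed w" "turn v = turn w" "dturn v = - dturn w" "norml v = - norml w"
    by (simp_all add: speed_def turn_def dturn_def norml_def 1 2)
  have 4: "dspeed v = - dspeed w" "tang v = tang w" by (simp_all add: dspeed_def tang_def 1 3)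
  have 5: "vel2 v = vel2 w" by (simp add: vel2_def 3 4)
  have "norml v * (dspeed v - dturn v * var_x v) = norml w * (dspeed w - dturn w * var_x w)"
    by (simp add: 1 3 4 algebra_simps)
  hence "accel v = accel w" unfolding accel_def by (simp add: 1 3 4 5)
  thus ?thesis unfolding forcing_def v_def[symmetric] w_def[symmetric] by (simp add: resid_def linpart_def 1)
qed

lemma forcing_periodic: "forcing h n R (t + 2*pi) x y = forcing h n R t x y"
  by (simp add: forcing_def state_def dist_at_periodic)

lemma abs_add3_le:
  fixes x y z :: real
  assumes "\<bar>x\<bar> \<le> a" "\<bar>y\<bar> \<le> b" "\<bar>z\<bar> \<le> c"
  shows "\<bar>x + y + 2 * z\<bar> \<le> a + b + 2 * c"
  using assms by linarith

lemma abs_product_diff_le: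
  fixes d d' c c' :: real
  assumes "\<bar>c\<bar> \<le> 1" "\<bar>d'\<bar> \<le> B" "\<bar>c - c'\<bar> \<le> e"
  shows "\<bar>d * c - d' * c'\<bar> \<le> \<bar>d - d'\<bar> + B * e"
proof -
  have "d * c - d' * c' = (d - d') * c + d' * (c - c')" by (simp add: algebra_simps)
  hence "\<bar>d * c - d' * c'\<bar> \<le> \<bar>(d - d') * c\<bar> + \<bar>d' * (c - c')\<bar>" by simp
  moreover have "\<bar>(d - d') * c\<bar> \<le> \<bar>d - d'\<bar>" by (rule mult_abs_le_bound) (use assms in auto)
  moreover have "\<bar>d' * (c - c')\<bar> \<le> B * e"
    unfolding abs_mult using assms by (intro mult_mono) auto
  ultimately show ?thesis by linarith
qed

section \<open>Existence for a single n under quantitative smallness\<close>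

context
  fixes n :: nat and h :: "real \<Rightarrow> real" and a b D l \<eta> m K r :: real
  assumes n: "n \<ge> 2" and a: "a \<ge> 4" and ab: "a \<le> b" and D: "b / n \<le> D" "D \<le> 1/4"
    and l: "0 \<le> l" "l \<le> 1/320" and \<eta>: "\<eta> \<ge> 0"
    and h_lip: "\<And>s s'. s \<ge> a - 2 \<Longrightarrow> s' \<ge> a - 2 \<Longrightarrow> \<bar>h s - h s'\<bar> \<le> l * \<bar>s - s'\<bar>"
    and h_bd: "\<And>s. s \<ge> a - 2 \<Longrightarrow> \<bar>h s - 1\<bar> \<le> \<eta>"
    and K: "K > 0" and r: "r > 0"
    and resid: "\<And>v w. norm v \<le> r \<Longrightarrow> norm w \<le> r \<Longrightarrow> \<bar>resid v - resid w\<bar> \<le> K * (norm v + norm w) * norm (v - w)"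
    and pos: "\<And>w. norm w \<le> r \<Longrightarrow> speed2 w > 0 \<and> tang w > 0 \<and> omega w > 0"
    and m: "m = 2 * \<eta> + 4 * D" "40 * m \<le> 1"
    and rho: "4 * D + \<eta> + 80 * m \<le> r" "K * (4 * D + \<eta> + 80 * m) \<le> 1/640"
begin

lemma D_pos: "D > 0"
proof -
  have "0 < b / n" using a ab n by simp
  thus ?thesis using D(1) by linarith
qed

lemma radius_facts:
  assumes "R \<in> {a..b}"
  shows "R \<ge> 4" "0 \<le> R / n" "R / n \<le> D" "R / n \<le> 1/2"
proof -
  show "R \<ge> 4" using assms a by simp
  thus "0 \<le> R / n" using n by simp
  have "R / n \<le> b / n" using assms by (intro divide_right_mono) auto
  thus "R / n \<le> D" using D(1) by linarith
  thus "R / n \<le> 1/2" using D(2) by linarith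
qed

lemma m_pos: "m > 0" using m D_pos \<eta> by linarith

lemma inverse_n_le: "1 / n \<le> D"
proof -
  have "1 / n \<le> b / n" using a ab by (intro divide_right_mono) auto
  thus ?thesis using D(1) by linarith
qed

lemma h_dist_bound:
  assumes "R \<in> {a..b}" "\<bar>x\<bar> \<le> 1" shows "\<bar>h (dist_at (R / n) R t x) - 1\<bar> \<le> \<eta>"
  using dist_at_ge[OF assms(2), of R "R/n" t] assms(1) by (intro h_bd) auto

text \<open>Each of the first four variables is at most D and the last is at most \<eta>. D bounds
  1/n as well as R/n because b \<ge> 1.\<close>

lemma norm_state:
  assumes R: "R \<in> {a..b}" and x: "\<bar>x\<bar> \<le> 1"
  shows "norm (state h n R t x y) \<le> 4 * D + \<eta> + \<bar>x\<bar> + \<bar>y\<bar>"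
proof -
  note f = radius_facts[OF R]
  have "\<bar>R / n\<bar> \<le> D" using f by linarith
  hence "\<bar>R / n * cos t\<bar> \<le> D" "\<bar>R / n * sin t\<bar> \<le> D"
    by (rule mult_abs_le_bound, simp)+
  moreover have "\<bar>R / n\<bar> \<le> D" "\<bar>1 / real n\<bar> \<le> D" using f inverse_n_le by auto
  ultimately show ?thesis
    using norm_vars_le[of "R / n * cos t" "R / n" "R / n * sin t" "1 / n" x y "h (dist_at (R / n) R t x) - 1"]
      h_dist_bound[OF R x, of t]
    unfolding state_def by linarith
qed

text \<open>The remainder and h each contribute about 1/320 to the dependence on \<phi> and \<phi>',
  well within 1/80. The coefficient of the time difference is kept in the small form 4D + 10l
  because it reappears in the norm of \<phi>''; that of the difference of radii only has to be
  finite.\<close>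

lemma forcing_diff:
  assumes R: "R \<in> {a..b}" "R' \<in> {a..b}" and x: "\<bar>x\<bar> \<le> 40 * m" "\<bar>x'\<bar> \<le> 40 * m"
    and y: "\<bar>y\<bar> \<le> 40 * m" "\<bar>y'\<bar> \<le> 40 * m"
  shows "\<bar>forcing h n R t x y - forcing h n R' t' x' y'\<bar>
    \<le> 10 * \<bar>R - R'\<bar> + (4 * D + 10 * l) * \<bar>t - t'\<bar> + (\<bar>x - x'\<bar> + \<bar>y - y'\<bar>) / 80"
proof -
  define w w' where "w = state h n R t x y" and "w' = state h n R' t' x' y'"
  define dR where "dR = \<bar>R - R'\<bar>"
  define dt where "dt = \<bar>t - t'\<bar>"
  define dx where "dx = \<bar>x - x'\<bar>"
  define dy where "dy = \<bar>y - y'\<bar>"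
  note f = radius_facts[OF R(1)] and f' = radius_facts[OF R(2)]
  have nn: "0 \<le> dR" "0 \<le> dt" "0 \<le> dx" "0 \<le> dy" by (auto simp: dR_def dt_def dx_def dy_def)
  have x1: "\<bar>x\<bar> \<le> 1" "\<bar>x'\<bar> \<le> 1" using x m by auto
  have "\<bar>R / n - R' / n\<bar> = dR / n" by (simp add: dR_def diff_divide_distrib[symmetric])
  also have "\<dots> \<le> dR / 2" using n nn by (intro divide_left_mono) auto
  finally have dd: "\<bar>R / n - R' / n\<bar> \<le> dR / 2" .
  have g: "\<bar>R / n * cos t - R' / n * cos t'\<bar> \<le> dR / 2 + D * dt"
    using abs_product_diff_le[of "cos t" "R' / n" D "cos t'" dt "R / n"] f' abs_cos_diff_le[of t t'] dd
    by (simp add: dt_def)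
  have k: "\<bar>R / n * sin t - R' / n * sin t'\<bar> \<le> dR / 2 + D * dt"
    using abs_product_diff_le[of "sin t" "R' / n" D "sin t'" dt "R / n"] f' abs_sin_diff_le[of t t'] dd
    by (simp add: dt_def)
  define E where "E = dR + 5 * dt + dx + 4 * (dR / 2)"
  have E: "\<bar>dist_at (R / n) R t x - dist_at (R' / n) R' t' x'\<bar> \<le> E"
    using dist_at_diff_le[OF f(2,4) x1(2), of R t x "R' / n" R' t'] dd
    unfolding E_def dR_def dt_def dx_def by linarith
  have "\<bar>h (dist_at (R / n) R t x) - h (dist_at (R' / n) R' t' x')\<bar>
     \<le> l * \<bar>dist_at (R / n) R t x - dist_at (R' / n) R' t' x'\<bar>"
    using dist_at_ge[OF x1(1), of R "R/n" t] dist_at_ge[OF x1(2), of R' "R'/n" t'] R by (intro h_lip) auto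
  also have "\<dots> \<le> l * E" using E l by (intro mult_left_mono) auto
  finally have e: "\<bar>h (dist_at (R / n) R t x) - h (dist_at (R' / n) R' t' x')\<bar> \<le> l * E" .
  have lE: "l * E \<le> 1/320 * (3 * dR) + 5 * l * dt + dx / 320"
  proof -
    have "l * (3 * dR) \<le> 1/320 * (3 * dR)" "l * dx \<le> 1/320 * dx"
      using nn l by (intro mult_right_mono; simp)+
    thus ?thesis by (simp add: E_def algebra_simps)
  qed
  have "norm (w - w') \<le> \<bar>R / n * cos t - R' / n * cos t'\<bar> + \<bar>R / n - R' / n\<bar>
     + \<bar>R / n * sin t - R' / n * sin t'\<bar> + \<bar>1 / real n - 1 / n\<bar> + \<bar>x - x'\<bar> + \<bar>y - y'\<bar>
     + \<bar>(h (dist_at (R / n) R t x) - 1) - (h (dist_at (R' / n) R' t' x') - 1)\<bar>"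
    unfolding w_def w'_def state_def diff_Pair by (rule norm_vars_le)
  also have "\<dots> \<le> (dR / 2 + D * dt) + dR / 2 + (dR / 2 + D * dt) + 0 + dx + dy + l * E"
    using g k dd e by (simp add: dx_def dy_def)
  finally have dw: "norm (w - w') \<le> 3 / 2 * dR + 2 * (D * dt) + dx + dy + l * E" by simp
  define B where "B = 3 / 2 * dR + 2 * (D * dt) + dx + dy + l * E"
  have nw: "norm w \<le> 4 * D + \<eta> + 80 * m" "norm w' \<le> 4 * D + \<eta> + 80 * m"
    using norm_state[OF R(1) x1(1), of t y] norm_state[OF R(2) x1(2), of t' y'] x y
    unfolding w_def w'_def by linarith+
  have "\<bar>resid w - resid w'\<bar> \<le> K * (norm w + norm w') * norm (w - w')"
    by (rule resid) (use nw rho in linarith)+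
  also have "\<dots> \<le> (1 / 320) * B"
  proof (rule mult_mono)
    \<comment> \<open>Each of the two states uses 1/640, which gives 1/320.\<close>
    have "K * (norm w + norm w') \<le> K * (2 * (4 * D + \<eta> + 80 * m))"
      using nw K by (intro mult_left_mono) auto
    also have "\<dots> = 2 * (K * (4 * D + \<eta> + 80 * m))" by simp
    also have "\<dots> \<le> 1 / 320" using rho(2) by linarith
    finally show "K * (norm w + norm w') \<le> 1 / 320" .
  qed (use dw B_def in auto)
  finally have res: "\<bar>resid w - resid w'\<bar> \<le> B / 320" by simp
  have "forcing h n R t x y - forcing h n R' t' x' y' = (resid w - resid w')
     + (h (dist_at (R / n) R t x) - h (dist_at (R' / n) R' t' x')) + 2 * (R / n * cos t - R' / n * cos t')"
    by (simp add: forcing_def w_def w'_def)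
  hence "\<bar>forcing h n R t x y - forcing h n R' t' x' y'\<bar> \<le> B / 320 + l * E + 2 * (dR / 2 + D * dt)"
    by (simp only: abs_add3_le[OF res e g])
  also have "\<dots> \<le> 10 * dR + (4 * D + 10 * l) * dt + (dx + dy) / 80"
  proof -
    have "0 \<le> D * dt" "0 \<le> l * dt" using D_pos l nn by simp_all
    moreover have "(4 * D + 10 * l) * dt = 4 * (D * dt) + 10 * (l * dt)" by (simp add: algebra_simps)
    ultimately show ?thesis using lE nn unfolding B_def by (simp add: field_simps)
  qed
  finally show ?thesis by (simp add: dR_def dt_def dx_def dy_def)
qed

lemma resid_0: "norm w \<le> r \<Longrightarrow> \<bar>resid w\<bar> \<le> K * norm w * norm w"
  using resid[of w 0] r by simp

text \<open>The leading part is at most \<eta> + 2D; m is twice that, which leaves room for the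
  remainder.\<close>

lemma forcing_small:
  assumes R: "R \<in> {a..b}" shows "\<bar>forcing h n R t 0 0\<bar> \<le> m"
proof -
  let ?w = "state h n R t 0 0"
  note f = radius_facts[OF R]
  have nw: "norm ?w \<le> 4 * D + \<eta>" using norm_state[OF R, of 0 t 0] by simp
  have mp: "m > 0" by (rule m_pos)
  have "\<bar>resid ?w\<bar> \<le> K * norm ?w * norm ?w" by (rule resid_0) (use nw rho mp in linarith)
  also have "\<dots> \<le> (1/640) * (4 * D + \<eta>)"
  proof (rule mult_mono)
    have "K * norm ?w \<le> K * (4 * D + \<eta> + 80 * m)" using nw mp K by (intro mult_left_mono) auto
    thus "K * norm ?w \<le> 1/640" using rho(2) by simp
  qed (use nw in auto)
  finally have "\<bar>resid ?w\<bar> \<le> (4 * D + \<eta>) / 640" by simp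
  moreover have "\<bar>var_e ?w\<bar> \<le> \<eta>" using h_dist_bound[OF R, of 0 t] by simp
  moreover have "\<bar>R / n\<bar> \<le> D" using f by linarith
  hence "\<bar>var_g ?w\<bar> \<le> D" unfolding state_vars by (rule mult_abs_le_bound) simp
  ultimately have "\<bar>resid ?w\<bar> + \<bar>var_e ?w\<bar> + 2 * \<bar>var_g ?w\<bar> \<le> m"
    unfolding m(1) using D_pos \<eta> by (simp add: field_simps del: state_vars)
  thus ?thesis unfolding forcing_def by linarith
qed

text \<open>The coefficient of cos combines \<open>2 * R / n\<close> from the curvature of U with
  the slope -P of h at R. The three errors are the quadratic remainder, the replacement of the
  distance by R + cos t, and the expansion of h.\<close>

lemma forcing_near:
  assumes R: "R \<in> {a..b}" and h: "\<And>x. \<bar>x\<bar> \<le> 1 \<Longrightarrow> \<bar>h (R + x) - h R + P * x\<bar> \<le> e"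
    and x: "\<bar>x\<bar> \<le> 40 * m" and y: "\<bar>y\<bar> \<le> 40 * m"
  shows "\<bar>forcing h n R t x y - ((h R - 1) + (2 * R / n - P) * cos t)\<bar>
     \<le> K * (4 * D + \<eta> + 80 * m)\<^sup>2 + l * (40 * m + 1 / a) + e"
proof -
  let ?w = "state h n R t x y" and ?s = "dist_at (R / n) R t x"
  note f = radius_facts[OF R]
  have x1: "\<bar>x\<bar> \<le> 1" using x m by auto
  have nw: "norm ?w \<le> 4 * D + \<eta> + 80 * m" using norm_state[OF R x1, of t y] x y by linarith
  have "\<bar>resid ?w\<bar> \<le> K * norm ?w * norm ?w" by (rule resid_0) (use nw rho in linarith)
  also have "\<dots> \<le> K * (4 * D + \<eta> + 80 * m)\<^sup>2"
    unfolding power2_eq_square mult.assoc using nw K by (intro mult_left_mono mult_mono) (auto intro: order_trans[OF norm_ge_zero])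
  finally have 1: "\<bar>resid ?w\<bar> \<le> K * (4 * D + \<eta> + 80 * m)\<^sup>2" .
  have "\<bar>h ?s - h (R + cos t)\<bar> \<le> l * \<bar>?s - (R + cos t)\<bar>"
    using dist_at_ge[OF x1, of R "R/n" t] R cos_ge_minus_one[of t] by (intro h_lip) (auto simp del: cos_ge_minus_one)
  also have "\<bar>?s - (R + cos t)\<bar> \<le> \<bar>x\<bar> + 1 / R" using f by (intro dist_at_near) auto
  also have "\<bar>x\<bar> + 1 / R \<le> 40 * m + 1 / a" using x R a by (intro add_mono divide_left_mono) auto
  finally have 2: "\<bar>h ?s - h (R + cos t)\<bar> \<le> l * (40 * m + 1 / a)" using l by (simp add: mult_left_mono)
  have 3: "\<bar>h (R + cos t) - h R + P * cos t\<bar> \<le> e" by (rule h) simp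
  have "forcing h n R t x y - ((h R - 1) + (2 * R / n - P) * cos t)
      = resid ?w + (h ?s - h (R + cos t)) + (h (R + cos t) - h R + P * cos t)"
    by (simp add: forcing_def algebra_simps)
  thus ?thesis using 1 2 3 by linarith
qed

theorem solve_fixed_n:
  assumes alpha: "0 < \<alpha>" "\<alpha> < 1"
    and left: "\<And>x. \<bar>x\<bar> \<le> 1 \<Longrightarrow> \<bar>h (a + x) - h a + Pa * x\<bar> \<le> ea"
    and right: "\<And>x. \<bar>x\<bar> \<le> 1 \<Longrightarrow> \<bar>h (b + x) - h b + Pb * x\<bar> \<le> eb"
    and signs: "2 * a / n - Pa \<le> - 2 * (K * (4 * D + \<eta> + 80 * m)\<^sup>2 + l * (40 * m + 1 / a) + ea)"
       "2 * b / n - Pb \<ge> 2 * (K * (4 * D + \<eta> + 80 * m)\<^sup>2 + l * (40 * m + 1 / a) + eb)"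
  shows "\<exists>R\<in>{a..b}. \<exists>\<phi>.
    C2alpha_periodic \<alpha> (2 * pi * real n / (real n - 1)) \<phi> \<and>
    C2alpha_norm \<alpha> (2 * pi * real n / (real n - 1)) \<phi> \<le> 5 * (42 * m + 4 * D + 10 * l) \<and>
    regular_C2_curve (\<lambda>t. U_curve n R t + of_real (\<phi> t) * N_normal n R t) \<and>
    (\<forall>t. curvature (\<lambda>t. U_curve n R t + of_real (\<phi> t) * N_normal n R t) t
        = h (cmod (U_curve n R t + of_real (\<phi> t) * N_normal n R t)))"
proof -
  have aR: "a \<in> {a..b}" "b \<in> {a..b}" using ab by auto
  have mp: "m > 0" by (rule m_pos)
  have Q_lip: "\<bar>forcing h n r t x y - forcing h n r' t' x' y'\<bar> \<le> 10 * (\<bar>r - r'\<bar> + \<bar>t - t'\<bar>) + (\<bar>x - x'\<bar> + \<bar>y - y'\<bar>) / 80"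
    if "r \<in> {a..b}" "r' \<in> {a..b}" "\<bar>x\<bar> \<le> 40*m" "\<bar>x'\<bar> \<le> 40*m" "\<bar>y\<bar> \<le> 40*m" "\<bar>y'\<bar> \<le> 40*m" for r r' t t' x x' y y'
  proof -
    have "(4 * D + 10 * l) * \<bar>t - t'\<bar> \<le> 10 * \<bar>t - t'\<bar>" using D l by (intro mult_right_mono) auto
    thus ?thesis using forcing_diff[OF that, of t t'] by (simp add: algebra_simps)
  qed
  have "\<exists>R\<in>{a..b}. \<exists>\<phi> \<phi>1 q. (\<forall>t. (\<phi> has_real_derivative \<phi>1 t) (at t) \<and>
     (\<phi>1 has_real_derivative q t - \<phi> t) (at t) \<and> q t = forcing h n R t (\<phi> t) (\<phi>1 t) \<and>
     \<phi> (t + 2*pi) = \<phi> t \<and> \<bar>\<phi> t\<bar> \<le> 40*m \<and> \<bar>\<phi>1 t\<bar> \<le> 40*m \<and> \<bar>q t\<bar> \<le> 2*m)"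
    by (rule periodic_solution[OF ab mp _ forcing_even forcing_periodic Q_lip forcing_small
      forcing_near[OF aR(1) left] forcing_near[OF aR(2) right] signs]) simp_all
  then
  obtain R \<phi> \<phi>1 q where R: "R \<in> {a..b}" and sol:
    "\<And>t. (\<phi> has_real_derivative \<phi>1 t) (at t)" "\<And>t. (\<phi>1 has_real_derivative q t - \<phi> t) (at t)"
    "\<And>t. q t = forcing h n R t (\<phi> t) (\<phi>1 t)" "\<And>t. \<phi> (t + 2*pi) = \<phi> t"
    "\<And>t. \<bar>\<phi> t\<bar> \<le> 40 * m" "\<And>t. \<bar>\<phi>1 t\<bar> \<le> 40 * m" "\<And>t. \<bar>q t\<bar> \<le> 2 * m"
    by blast
  define om where "om = 1 - 1 / real n"
  have om: "0 < om" "om \<le> 1" using n by (auto simp: om_def)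
  \<comment> \<open>\<phi>'' = q - \<phi> is at most 2m + 40m, and its Lipschitz constant is 4D +
    10l + 2m from q plus 40m from \<phi>. M covers all these bounds.\<close>
  define M where "M = 42 * m + 4 * D + 10 * l"
  have M: "42 * m \<le> M" using D_pos l by (simp add: M_def)
  have b2: "\<bar>q t - \<phi> t\<bar> \<le> 42 * m" for t using sol(5)[of t] sol(7)[of t] by linarith
  have mvt: "\<bar>f s - f t\<bar> \<le> B * \<bar>s - t\<bar>"
    if "\<And>t. (f has_real_derivative f' t) (at t)" "\<And>t. \<bar>f' t\<bar> \<le> B" for f f' :: "real \<Rightarrow> real" and B s t
    using field_differentiable_bound[of UNIV f f' B s t] that by simp
  \<comment> \<open>The equation makes q Lipschitz because \<phi> and \<phi>' are; their share (40 +
    42)/80 of m is rounded up to 2m.\<close>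
  have q_lip: "\<bar>q s - q t\<bar> \<le> (4 * D + 10 * l + 2 * m) * \<bar>s - t\<bar>" for s t
  proof -
    have "\<bar>q s - q t\<bar> \<le> 10 * \<bar>R - R\<bar> + (4 * D + 10 * l) * \<bar>s - t\<bar> + (\<bar>\<phi> s - \<phi> t\<bar> + \<bar>\<phi>1 s - \<phi>1 t\<bar>) / 80"
      unfolding sol(3) by (rule forcing_diff) (use R sol in auto)
    moreover have "\<bar>\<phi> s - \<phi> t\<bar> \<le> 40 * (m * \<bar>s - t\<bar>)" "\<bar>\<phi>1 s - \<phi>1 t\<bar> \<le> 42 * (m * \<bar>s - t\<bar>)"
      using mvt[OF sol(1) sol(6), of s t] mvt[OF sol(2) b2, of s t] by (simp_all add: mult.assoc)
    moreover have "0 \<le> m * \<bar>s - t\<bar>" using mp by simp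
    moreover have "y \<le> v + 2 * u" if "y \<le> 10 * \<bar>R - R\<bar> + v + (p1 + p2) / 80" "p1 \<le> 40 * u" "p2 \<le> 42 * u" "0 \<le> u"
      for y v p1 p2 u :: real using that by (simp add: add_divide_distrib)
    ultimately have "\<bar>q s - q t\<bar> \<le> (4 * D + 10 * l) * \<bar>s - t\<bar> + 2 * (m * \<bar>s - t\<bar>)" by blast
    thus ?thesis by (simp add: algebra_simps)
  qed
  have \<phi>2_lip: "\<bar>(q s - \<phi> s) - (q t - \<phi> t)\<bar> \<le> M * \<bar>s - t\<bar>" for s t
  proof -
    have "\<bar>(q s - \<phi> s) - (q t - \<phi> t)\<bar> \<le> \<bar>q s - q t\<bar> + \<bar>\<phi> s - \<phi> t\<bar>" by linarith
    also have "\<dots> \<le> (4 * D + 10 * l + 2 * m) * \<bar>s - t\<bar> + 40 * m * \<bar>s - t\<bar>"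
      by (intro add_mono q_lip mvt[OF sol(1) sol(6)])
    also have "\<dots> = M * \<bar>s - t\<bar>" by (simp add: M_def algebra_simps)
    finally show ?thesis .
  qed
  have "continuous_on UNIV q"
    by (rule lipschitz_on_continuous_on[OF lipschitz_onI[of UNIV q "4 * D + 10 * l + 2 * m"]])
       (use q_lip D_pos l mp in \<open>auto simp: dist_real_def\<close>)
  \<comment> \<open>Return to the time t. The period 2 pi becomes 2 pi n/(n-1), and since om \<le> 1
    no derivative grows.\<close>
  define \<psi> where "\<psi> t = \<phi> (om * t)" for t
  have st: "norm (state h n R t (\<phi> t) (\<phi>1 t)) \<le> r" for t
  proof -
    have "\<bar>\<phi> t\<bar> \<le> 1" using sol(5)[of t] m(2) by linarith
    from norm_state[OF R this, of t "\<phi>1 t"] show ?thesis using sol(5,6)[of t] rho(1) by linarith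
  qed
  have pos': "speed2 (state h n R t (\<phi> t) (\<phi>1 t)) > 0" "tang (state h n R t (\<phi> t) (\<phi>1 t)) > 0" for t
    using pos[OF st[of t]] by auto
  note curve = n sol(1,2) \<open>continuous_on UNIV q\<close> sol(3)[unfolded forcing_def] pos'
  have gc: "graph_curve n R \<phi> = (\<lambda>t. U_curve n R t + of_real (\<psi> t) * N_normal n R t)"
    by (rule ext) (simp add: graph_curve_def[OF curve] \<psi>_def om_def)
  have scale: "om * z \<le> z" if "z \<ge> 0" for z
    using om that by (simp add: mult_left_le_one_le)
  have abs_om: "\<bar>om * z\<bar> \<le> \<bar>z\<bar>" for z using om scale[of "\<bar>z\<bar>"] by (simp add: abs_mult)
  have c: "C2alpha_periodic \<alpha> (2 * pi * real n / (real n - 1)) \<psi> \<and>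
      C2alpha_norm \<alpha> (2 * pi * real n / (real n - 1)) \<psi> \<le> 5 * M"
  proof (rule C2alpha_estimate[OF alpha, of _ \<psi> "\<lambda>t. om * \<phi>1 (om * t)" "\<lambda>t. om * (om * (q (om * t) - \<phi> (om * t)))"])
    fix t :: real
    show "0 < 2 * pi * real n / (real n - 1)" using n by simp
    have "om * (2 * pi * real n / (real n - 1)) = 2 * pi" using n by (simp add: om_def field_simps)
    thus "\<psi> (t + 2 * pi * real n / (real n - 1)) = \<psi> t"
      using sol(4)[of "om * t"] by (simp add: \<psi>_def distrib_left)
    have ch: "((\<lambda>t. f (om * t)) has_real_derivative om * f') (at t)" if "(f has_real_derivative f') (at (om * t))" for f f'
      using DERIV_chain2[where g = "\<lambda>t. om * t", OF that DERIV_cmult_Id] by (simp add: mult.commute)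
    show "(\<psi> has_real_derivative om * \<phi>1 (om * t)) (at t)" unfolding \<psi>_def by (rule ch[OF sol(1)])
    show "((\<lambda>t. om * \<phi>1 (om * t)) has_real_derivative om * (om * (q (om * t) - \<phi> (om * t)))) (at t)"
      by (intro DERIV_cmult ch sol(2))
    show "\<bar>\<psi> t\<bar> \<le> M" using sol(5)[of "om * t"] M mp by (simp add: \<psi>_def)
    show "\<bar>om * \<phi>1 (om * t)\<bar> \<le> M" using abs_om[of "\<phi>1 (om * t)"] sol(6)[of "om * t"] M mp by linarith
    show "\<bar>om * (om * (q (om * t) - \<phi> (om * t)))\<bar> \<le> M"
      using abs_om[of "om * (q (om * t) - \<phi> (om * t))"] abs_om[of "q (om * t) - \<phi> (om * t)"] b2[of "om * t"] M by linarith
    fix s :: real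
    let ?d = "(q (om * s) - \<phi> (om * s)) - (q (om * t) - \<phi> (om * t))"
    have "om * (om * (q (om * s) - \<phi> (om * s))) - om * (om * (q (om * t) - \<phi> (om * t))) = om * (om * ?d)"
      by (simp add: algebra_simps)
    hence "\<bar>om * (om * (q (om * s) - \<phi> (om * s))) - om * (om * (q (om * t) - \<phi> (om * t)))\<bar> \<le> \<bar>?d\<bar>"
      using abs_om[of "om * ?d"] abs_om[of ?d] by linarith
    also have "\<dots> \<le> M * \<bar>om * s - om * t\<bar>" by (rule \<phi>2_lip)
    also have "\<bar>om * s - om * t\<bar> \<le> \<bar>s - t\<bar>" using abs_om[of "s - t"] by (simp add: right_diff_distrib)
    finally show "\<bar>om * (om * (q (om * s) - \<phi> (om * s))) - om * (om * (q (om * t) - \<phi> (om * t)))\<bar> \<le> M * \<bar>s - t\<bar>"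
      using M mp by (simp add: mult_left_mono)
  qed
  show ?thesis
    using R c graph_curve_regular[OF curve] graph_curve_curvature[OF curve] unfolding gc M_def
    by (intro bexI[OF _ R] exI[of _ \<psi>]) auto
qed

end

lemma eventually_powr_le:
  fixes K e p :: real
  assumes "e > 0" "p < 0" shows "\<forall>\<^sub>F s in at_top. K * s powr p \<le> e"
  using powr_eventually_small[OF assms, of K] eventually_gt_at_top[of 0]
  by eventually_elim simp

theorem theorem1p3p1:
  fixes \<alpha> A \<gamma> \<beta> C :: real
    and H :: "complex \<Rightarrow> real" and h ht :: "real \<Rightarrow> real"
  assumes alpha: "0 < \<alpha>" "\<alpha> < 1"
    and H_C2: "C2_plane H"
    and H_radial: "\<forall>p. H p = h (cmod p)"
    and A_pos: "A > 0" and gamma: "\<gamma> > 1" and beta: "\<beta> \<ge> 0"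
    and ht_C2: "C2_on ht {0<..}"
    and h_expansion: "\<exists>s0. \<forall>s\<ge>s0. h s = 1 + A / s powr \<gamma> + ht s / s powr (\<gamma> + \<beta>)"
    and beta_gt1: "\<beta> > 1 \<Longrightarrow> bounded (ht ` {0<..})"
    and beta_01: "0 < \<beta> \<Longrightarrow> \<beta> \<le> 1 \<Longrightarrow>
                   (\<exists>B. (\<lambda>s. ht s - B) \<in> o[at_top](\<lambda>s. s powr (\<beta> - 1)))"
    and beta_0: "\<beta> = 0 \<Longrightarrow> (\<exists>B. B > - A \<and> (\<lambda>s. ht s - B) \<in> o[at_top](\<lambda>s. 1 / s))"
    and C_pos: "C > 0"
    and h2_bound: "\<exists>s0. \<forall>s\<ge>s0. \<bar>deriv (deriv h) s\<bar> \<le> C * s powr (- (\<gamma> + 1 + min 1 \<beta>))"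
  shows "\<exists>(nbar::nat) Mbar (R::nat \<Rightarrow> real) (\<phi>::nat \<Rightarrow> real \<Rightarrow> real) r0 r1.
           nbar \<ge> 2 \<and> Mbar > 0 \<and> 0 < r0 \<and> r0 < r1 \<and>
           (\<forall>n\<ge>nbar.
              (\<exists>r. r0 < r \<and> r < r1 \<and> R n = (r * real n) powr (1 / (\<gamma> + 2))) \<and>
              C2alpha_periodic \<alpha> (2 * pi * real n / (real n - 1)) (\<phi> n) \<and>
              C2alpha_norm \<alpha> (2 * pi * real n / (real n - 1)) (\<phi> n)
                 \<le> Mbar * real n powr (- \<gamma> / (\<gamma> + 2)) \<and>
              regular_C2_curve (\<lambda>t. U_curve n (R n) t + of_real (\<phi> n t) * N_normal n (R n) t) \<and>
              (\<forall>t. curvature (\<lambda>t. U_curve n (R n) t + of_real (\<phi> n t) * N_normal n (R n) t) t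
                   = H (U_curve n (R n) t + of_real (\<phi> n t) * N_normal n (R n) t)))"
proof -
  obtain A' C1 s1 where A': "A' > 0" and C1: "C1 > 0" and s1: "s1 \<ge> 1"
    and h_bd: "\<And>s. s \<ge> s1 \<Longrightarrow> \<bar>h s - 1\<bar> \<le> C1 * s powr (-\<gamma>)"
    and h_lip: "\<And>s s'. s \<ge> s1 \<Longrightarrow> s' \<ge> s \<Longrightarrow> \<bar>h s - h s'\<bar> \<le> C1 * s powr (-\<gamma>-1) * \<bar>s - s'\<bar>"
    and h_diff: "\<And>e. e > 0 \<Longrightarrow> \<forall>\<^sub>F s in at_top. \<forall>x. \<bar>x\<bar> \<le> 1 \<longrightarrow>
       \<bar>h (s + x) - h s + \<gamma> * A' * x * s powr (-\<gamma>-1)\<bar> \<le> e * s powr (-\<gamma>-1)"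
    by (rule profile_asymptotics[OF H_C2 H_radial A_pos gamma beta h_expansion beta_gt1 beta_01 beta_0 C_pos h2_bound],
        assumption+, rule that, assumption+)
  obtain K r where K: "K > 0" and r: "r > 0"
    and resid: "\<And>v w. norm v \<le> r \<Longrightarrow> norm w \<le> r \<Longrightarrow> \<bar>resid v - resid w\<bar> \<le> K * (norm v + norm w) * norm (v - w)"
    and pos: "\<And>w. norm w \<le> r \<Longrightarrow> speed2 w > 0 \<and> tang w > 0 \<and> omega w > 0"
    by (rule resid_estimate, rule that, assumption+)
  define G where "G = \<gamma> * A'"
  have G: "G > 0" using gamma A' by (simp add: G_def)
  \<comment> \<open>At R = ca N and R = cb N, with N = n^(1/(\<gamma>+2)), the quotient
    R^(\<gamma>+2)/n equals G/4 and G. So 2R/n is one half, respectively twice, of G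
    R^(-\<gamma>-1), on either side of the zero.\<close>
  define ca where "ca = (G / 4) powr (1 / (\<gamma> + 2))"
  define cb where "cb = G powr (1 / (\<gamma> + 2))"
  have cpos: "ca > 0" "cb > 0" using G by (auto simp: ca_def cb_def)
  have cab: "ca \<le> cb" unfolding ca_def cb_def using G gamma by (intro powr_mono2) auto
  have cpow: "ca powr (\<gamma> + 2) = G / 4" "cb powr (\<gamma> + 2) = G"
    using G gamma by (simp_all add: ca_def cb_def powr_powr)
  \<comment> \<open>The powers of 2 here and in \<open>Ce\<close> come from admitting all radii s
    \<ge> a - 2 \<ge> a/2.\<close>
  define Cl where "Cl = C1 * (2 powr (\<gamma> + 1) * ca powr (-\<gamma>-1))"
  define Ce where "Ce = C1 * (2 powr \<gamma> * ca powr (-\<gamma>))"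
  have Cpos: "Cl > 0" "Ce > 0" using C1 cpos by (auto simp: Cl_def Ce_def)
  define Cm where "Cm = 2 * Ce + 4 * cb"
  define Cr where "Cr = 4 * cb + Ce + 80 * Cm"
  have Cpos': "Cm > 0" "Cr > 0" using Cpos cpos by (auto simp: Cm_def Cr_def)
  \<comment> \<open>In units of G R^(-\<gamma>-1) the margins are 1/2 at the left end and 1 at the
    right end. \<sigma> and \<open>e0\<close> take at most 1/16 each; doubled by the sign conditions
    they use 1/4.\<close>
  define \<sigma> where "\<sigma> = G / 16 * cb powr (-\<gamma>-1)"
  have \<sigma>: "\<sigma> > 0" using G cpos by (simp add: \<sigma>_def)
  define e0 where "e0 = G / 16"
  have e0: "e0 > 0" using G by (simp add: e0_def)
  have lim: "filterlim (\<lambda>N. c * N) at_top at_top" if "c > 0" for c :: real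
    using that by (intro filterlim_tendsto_pos_mult_at_top[OF tendsto_const _ filterlim_ident])
  \<comment> \<open>All smallness conditions in terms of N alone. The power 1 - \<gamma> is the
    ratio of the squared size N^(-2\<gamma>) of the state to the order N^(-\<gamma>-1) of the scalar
    equation.\<close>
  define PP where "PP N \<longleftrightarrow> N \<ge> 1 \<and> ca * N \<ge> s1 + 4 \<and> Cr * N powr (-\<gamma>) \<le> r \<and> K * Cr * N powr (-\<gamma>) \<le> 1/640 \<and>
      cb * N powr (-\<gamma>-1) \<le> 1/4 \<and> Cl * N powr (-\<gamma>-1) \<le> 1/320 \<and> 40 * Cm * N powr (-\<gamma>) \<le> 1 \<and>
      K * Cr\<^sup>2 * N powr (1-\<gamma>) \<le> \<sigma> / 3 \<and> Cl * 40 * Cm * N powr (-\<gamma>) \<le> \<sigma> / 3 \<and> Cl / ca * N powr (-1) \<le> \<sigma> / 3 \<and>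
      (\<forall>x. \<bar>x\<bar> \<le> 1 \<longrightarrow> \<bar>h (ca * N + x) - h (ca * N) + \<gamma> * A' * x * (ca * N) powr (-\<gamma>-1)\<bar> \<le> e0 * (ca * N) powr (-\<gamma>-1)) \<and>
      (\<forall>x. \<bar>x\<bar> \<le> 1 \<longrightarrow> \<bar>h (cb * N + x) - h (cb * N) + \<gamma> * A' * x * (cb * N) powr (-\<gamma>-1)\<bar> \<le> e0 * (cb * N) powr (-\<gamma>-1))" for N
  have "eventually PP at_top"
    unfolding PP_def
    by (intro eventually_conj eventually_ge_at_top eventually_powr_le
        eventually_compose_filterlim[OF h_diff[OF e0] lim[OF cpos(1)]]
        eventually_compose_filterlim[OF h_diff[OF e0] lim[OF cpos(2)]]
        eventually_compose_filterlim[OF eventually_ge_at_top lim[OF cpos(1)]])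
      (use gamma r \<sigma> in simp_all)
  moreover have "filterlim (\<lambda>n. real n powr (1 / (\<gamma> + 2))) at_top sequentially"
    using gamma by (intro filterlim_compose[OF real_powr_at_top filterlim_real_sequentially]) auto
  ultimately have "\<forall>\<^sub>F n in sequentially. PP (real n powr (1 / (\<gamma> + 2)))"
    by (rule eventually_compose_filterlim)
  then obtain n0 where n0: "\<And>n. n \<ge> n0 \<Longrightarrow> PP (real n powr (1 / (\<gamma> + 2)))"
    unfolding eventually_sequentially by blast
  define nbar where "nbar = max 2 n0"
  define Mbar where "Mbar = 5 * (42 * Cm + 4 * cb + 10 * Cl)"
  have Mbar: "Mbar > 0" using Cpos Cpos' cpos by (simp add: Mbar_def)
  \<comment> \<open>R^(\<gamma>+2)/n may attain G/4 or G, so the open interval is taken strictly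
    larger.\<close>
  define r0 r1 where "r0 = G / 8" and "r1 = 2 * G"
  define good where "good n R \<phi> \<longleftrightarrow> (\<exists>r. r0 < r \<and> r < r1 \<and> R = (r * real n) powr (1 / (\<gamma> + 2))) \<and>
      C2alpha_periodic \<alpha> (2 * pi * real n / (real n - 1)) \<phi> \<and>
      C2alpha_norm \<alpha> (2 * pi * real n / (real n - 1)) \<phi> \<le> Mbar * real n powr (- \<gamma> / (\<gamma> + 2)) \<and>
      regular_C2_curve (\<lambda>t. U_curve n R t + of_real (\<phi> t) * N_normal n R t) \<and>
      (\<forall>t. curvature (\<lambda>t. U_curve n R t + of_real (\<phi> t) * N_normal n R t) t
         = H (U_curve n R t + of_real (\<phi> t) * N_normal n R t))" for n R \<phi>
  have "\<exists>R \<phi>. good n R \<phi>" if "n \<ge> nbar" for n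
  proof -
    define N where "N = real n powr (1 / (\<gamma> + 2))"
    have n2: "n \<ge> 2" using that by (simp add: nbar_def)
    have "PP N" unfolding N_def by (rule n0) (use that in \<open>simp add: nbar_def\<close>)
    note PN = this[unfolded PP_def]
    have P: "N \<ge> 1" "ca * N \<ge> s1 + 4" "Cr * N powr (-\<gamma>) \<le> r" "K * Cr * N powr (-\<gamma>) \<le> 1/640"
      "cb * N powr (-\<gamma>-1) \<le> 1/4" "Cl * N powr (-\<gamma>-1) \<le> 1/320" "40 * Cm * N powr (-\<gamma>) \<le> 1"
      "K * Cr\<^sup>2 * N powr (1-\<gamma>) \<le> \<sigma> / 3" "Cl * 40 * Cm * N powr (-\<gamma>) \<le> \<sigma> / 3" "Cl / ca * N powr (-1) \<le> \<sigma> / 3"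
      using PN by - ((elim conjE, assumption)+)
    have Pa: "\<bar>h (ca * N + x) - h (ca * N) + \<gamma> * A' * x * (ca * N) powr (-\<gamma>-1)\<bar> \<le> e0 * (ca * N) powr (-\<gamma>-1)"
      and Pb: "\<bar>h (cb * N + x) - h (cb * N) + \<gamma> * A' * x * (cb * N) powr (-\<gamma>-1)\<bar> \<le> e0 * (cb * N) powr (-\<gamma>-1)"
      if "\<bar>x\<bar> \<le> 1" for x
      using PN that by - ((elim conjE, blast)+)
    define a b where "a = ca * N" and "b = cb * N"
    \<comment> \<open>u is the order of h - 1 and of \<phi>; v is that of R/n, of the Lipschitz
      constant of h and of the scalar equation.\<close>
    define u where "u = N powr (-\<gamma>)"
    define v where "v = N powr (-\<gamma>-1)"
    have N0: "N > 0" using P(1) by simp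
    have uv: "u > 0" "v > 0" "v \<le> u" using N0 P(1) by (auto simp: u_def v_def intro!: powr_mono)
    have nN: "real n = N powr (\<gamma> + 2)" using n2 gamma by (simp add: N_def powr_powr)
    have dv: "c * N / n = c * v" for c
    proof -
      have "N / N powr (\<gamma> + 2) = N powr (1 - (\<gamma> + 2))" using N0 by (subst powr_diff) simp
      also have "1 - (\<gamma> + 2) = -\<gamma>-1" by simp
      finally have "c * (N / n) = c * v" by (simp only: nN v_def)
      thus ?thesis by simp
    qed
    have hl: "\<bar>h s - h s'\<bar> \<le> Cl * v * \<bar>s - s'\<bar>" if "s \<ge> a - 2" "s' \<ge> a - 2" for s s'
    proof -
      have "\<bar>h s - h s'\<bar> \<le> Cl * v * \<bar>s - s'\<bar>" if "s \<ge> a - 2" "s' \<ge> s" for s s'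
      proof -
        have "s powr (-(\<gamma>+1)) \<le> 2 powr (\<gamma>+1) * a powr (-(\<gamma>+1))"
          using that P(2) s1 gamma by (intro powr_neg_half_le) (auto simp: a_def)
        also have "-(\<gamma>+1) = -\<gamma>-1" by simp
        also have "a powr (-\<gamma>-1) = ca powr (-\<gamma>-1) * v" using cpos N0 by (simp add: a_def v_def powr_mult)
        finally have "C1 * s powr (-\<gamma>-1) \<le> C1 * (2 powr (\<gamma>+1) * (ca powr (-\<gamma>-1) * v))"
          using C1 by (intro mult_left_mono) auto
        also have "\<dots> = Cl * v" by (simp add: Cl_def)
        finally have "C1 * s powr (-\<gamma>-1) * \<bar>s - s'\<bar> \<le> Cl * v * \<bar>s - s'\<bar>" by (intro mult_right_mono) auto
        thus ?thesis using h_lip[of s s'] that P(2) by (simp add: a_def)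
      qed
      from this[of s s'] this[of s' s] that show ?thesis by (cases "s \<le> s'") (auto simp: abs_minus_commute)
    qed
    have hb: "\<bar>h s - 1\<bar> \<le> Ce * u" if "s \<ge> a - 2" for s
    proof -
      have "s powr (-\<gamma>) \<le> 2 powr \<gamma> * a powr (-\<gamma>)"
        using that P(2) s1 gamma by (intro powr_neg_half_le) (auto simp: a_def)
      also have "a powr (-\<gamma>) = ca powr (-\<gamma>) * u" using cpos N0 by (simp add: a_def u_def powr_mult)
      finally have "C1 * s powr (-\<gamma>) \<le> C1 * (2 powr \<gamma> * (ca powr (-\<gamma>) * u))"
        using C1 by (intro mult_left_mono) auto
      also have "\<dots> = Ce * u" by (simp add: Ce_def)
      finally show ?thesis using h_bd[of s] that P(2) by (simp add: a_def)
    qed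
    have D: "b / n \<le> cb * v" "cb * v \<le> 1/4" using dv[of cb] P(5) by (auto simp: b_def v_def)
    define m where "m = 2 * (Ce * u) + 4 * (cb * v)"
    have cbuv: "cb * v \<le> cb * u" using uv cpos by simp
    have mu: "m \<le> Cm * u" unfolding m_def Cm_def using cbuv by (simp add: algebra_simps)
    have m40: "40 * m \<le> 1" using mu P(7) by (simp add: u_def)
    have rho: "4 * (cb * v) + Ce * u + 80 * m \<le> Cr * u"
      using mu cbuv by (simp add: Cr_def algebra_simps)
    have rho1: "4 * (cb * v) + Ce * u + 80 * m \<le> r" using rho P(3) by (simp add: u_def)
    have "K * (4 * (cb * v) + Ce * u + 80 * m) \<le> K * (Cr * u)" using rho K by (intro mult_left_mono) auto
    hence rho2: "K * (4 * (cb * v) + Ce * u + 80 * m) \<le> 1/640"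
      by (rule order_trans) (use P(4) in \<open>simp add: u_def mult.assoc\<close>)
    have m0: "m \<ge> 0" "0 \<le> 4 * (cb * v) + Ce * u + 80 * m" using uv cpos Cpos by (auto simp: m_def)
    have small: "K * (4 * (cb * v) + Ce * u + 80 * m)\<^sup>2 + Cl * v * (40 * m + 1 / a) \<le> \<sigma> * v"
    proof -
      have "(4 * (cb * v) + Ce * u + 80 * m)\<^sup>2 \<le> (Cr * u)\<^sup>2" using rho m0 by (intro power_mono) auto
      hence "K * (4 * (cb * v) + Ce * u + 80 * m)\<^sup>2 \<le> K * (Cr * u)\<^sup>2" using K by (intro mult_left_mono) auto
      also have "u * u = N powr (1-\<gamma>) * v" by (simp add: u_def v_def flip: powr_add)
      hence "K * (Cr * u)\<^sup>2 = (K * Cr\<^sup>2 * N powr (1-\<gamma>)) * v"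
        by (simp add: power2_eq_square mult_ac)
      also have "\<dots> \<le> \<sigma> / 3 * v" using P(8) uv by (intro mult_right_mono) auto
      finally have 1: "K * (4 * (cb * v) + Ce * u + 80 * m)\<^sup>2 \<le> \<sigma> / 3 * v" .
      have "Cl * v * (40 * m) \<le> Cl * v * (40 * (Cm * u))" using mu Cpos uv by (intro mult_left_mono) auto
      also have "\<dots> = (Cl * 40 * Cm * N powr (-\<gamma>)) * v" by (simp add: u_def)
      also have "\<dots> \<le> \<sigma> / 3 * v" using P(9) uv by (intro mult_right_mono) auto
      finally have 2: "Cl * v * (40 * m) \<le> \<sigma> / 3 * v" .
      have "Cl * v * (1 / a) = (Cl / ca * N powr (-1)) * v" using N0 by (simp add: a_def powr_minus field_simps)
      also have "\<dots> \<le> \<sigma> / 3 * v" using P(10) uv by (intro mult_right_mono) auto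
      finally have 3: "Cl * v * (1 / a) \<le> \<sigma> / 3 * v" .
      have "Cl * v * (40 * m + 1 / a) = Cl * v * (40 * m) + Cl * v * (1 / a)" by (rule distrib_left)
      thus ?thesis using 1 2 3 by linarith
    qed
    have pw: "(c * N) powr (-\<gamma>-1) = c powr (-\<gamma>-1) * v" if "c > 0" for c
      using that N0 by (simp add: v_def powr_mult)
    \<comment> \<open>This rewriting expresses 2R/n at the two endpoints in the same unit as the
      slope of h there.\<close>
    have cs: "c = c powr (\<gamma> + 2) * c powr (-\<gamma>-1)" if "c > 0" for c :: real
      using that by (simp flip: powr_add)
    define xa xb where "xa = ca powr (-\<gamma>-1)" and "xb = cb powr (-\<gamma>-1)"
    have x: "xa > 0" "xb > 0" using cpos by (auto simp: xa_def xb_def)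
    have xab: "xb \<le> xa" unfolding xa_def xb_def using cab cpos gamma by (intro powr_mono2') auto
    have ca_x: "ca = G / 4 * xa" and cb_x: "cb = G * xb"
      using cs[OF cpos(1)] cs[OF cpos(2)] unfolding cpow xa_def xb_def by auto
    have \<sigma>x: "\<sigma> = G / 16 * xb" by (simp add: \<sigma>_def xb_def)
    let ?S = "K * (4 * (cb * v) + Ce * u + 80 * m)\<^sup>2 + Cl * v * (40 * m + 1 / a)"
    have pa: "a powr (-\<gamma>-1) = xa * v" and pb: "b powr (-\<gamma>-1) = xb * v"
      unfolding a_def b_def xa_def xb_def by (intro pw cpos)+
    have Sv: "?S \<le> G * (xb * v) / 16" using small by (simp add: \<sigma>x)
    have G1: "G * (xb * v) \<le> G * (xa * v)" "0 < G * (xb * v)" using G uv xab x by simp_all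
    have sa: "2 * a / n - \<gamma> * A' * a powr (-\<gamma>-1) \<le> - 2 * (?S + e0 * a powr (-\<gamma>-1))"
    proof -
      have "2 * a / n = 2 * ca * v" using dv[of "2 * ca"] unfolding a_def by (simp only: mult.assoc)
      also have "\<dots> = G * (xa * v) / 2" by (subst ca_x) simp
      finally have "2 * a / n = G * (xa * v) / 2" .
      note e1 = this
      have e2: "\<gamma> * A' * a powr (-\<gamma>-1) = G * (xa * v)" "e0 * a powr (-\<gamma>-1) = G * (xa * v) / 16"
        unfolding pa by (simp_all add: G_def e0_def)
      have "X / 2 - X \<le> - 2 * (S + X / 16)" if "S \<le> Y / 16" "Y \<le> X" "0 < Y" for S X Y :: real
        using that by (simp add: algebra_simps)
      from this[OF Sv G1] show ?thesis unfolding e1 e2 .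
    qed
    have sb: "2 * b / n - \<gamma> * A' * b powr (-\<gamma>-1) \<ge> 2 * (?S + e0 * b powr (-\<gamma>-1))"
    proof -
      have "2 * b / n = 2 * cb * v" using dv[of "2 * cb"] unfolding b_def by (simp only: mult.assoc)
      also have "\<dots> = 2 * (G * (xb * v))" by (subst cb_x) simp
      finally have "2 * b / n = 2 * (G * (xb * v))" .
      note e1 = this
      have e2: "\<gamma> * A' * b powr (-\<gamma>-1) = G * (xb * v)" "e0 * b powr (-\<gamma>-1) = G * (xb * v) / 16"
        unfolding pb by (simp_all add: G_def e0_def)
      have "2 * (S + Y / 16) \<le> 2 * Y - Y" if "S \<le> Y / 16" "0 < Y" for S Y :: real
        using that by (simp add: algebra_simps)
      from this[OF Sv G1(2)] show ?thesis unfolding e1 e2 .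
    qed
    have ab: "4 \<le> a" "a \<le> b" using P(2) s1 cab N0 by (auto simp: a_def b_def)
    have l: "0 \<le> Cl * v" "Cl * v \<le> 1/320" using Cpos uv P(6) by (auto simp: v_def)
    have \<eta>: "0 \<le> Ce * u" using Cpos uv by simp
    have Pa': "\<bar>h (a + x) - h a + \<gamma> * A' * a powr (-\<gamma>-1) * x\<bar> \<le> e0 * a powr (-\<gamma>-1)" if "\<bar>x\<bar> \<le> 1" for x
      using Pa[OF that] by (simp add: a_def mult_ac)
    have Pb': "\<bar>h (b + x) - h b + \<gamma> * A' * b powr (-\<gamma>-1) * x\<bar> \<le> e0 * b powr (-\<gamma>-1)" if "\<bar>x\<bar> \<le> 1" for x
      using Pb[OF that] by (simp add: b_def mult_ac)
    obtain R \<phi> where R: "R \<in> {a..b}" and \<phi>: "C2alpha_periodic \<alpha> (2 * pi * real n / (real n - 1)) \<phi> \<and>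
       C2alpha_norm \<alpha> (2 * pi * real n / (real n - 1)) \<phi> \<le> 5 * (42 * m + 4 * (cb * v) + 10 * (Cl * v)) \<and>
       regular_C2_curve (\<lambda>t. U_curve n R t + of_real (\<phi> t) * N_normal n R t) \<and>
       (\<forall>t. curvature (\<lambda>t. U_curve n R t + of_real (\<phi> t) * N_normal n R t) t
        = h (cmod (U_curve n R t + of_real (\<phi> t) * N_normal n R t)))"
      by (rule bexE[OF solve_fixed_n[OF n2 ab D l \<eta> hl hb K r resid pos m_def m40 rho1 rho2 alpha Pa' Pb' sa sb]],
          assumption+, elim exE, rule that)
    have "Cl * v \<le> Cl * u" using uv Cpos by simp
    hence "5 * (42 * m + 4 * (cb * v) + 10 * (Cl * v)) \<le> 5 * (42 * (Cm * u) + 4 * (cb * u) + 10 * (Cl * u))"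
      using mu cbuv by simp
    also have "\<dots> = Mbar * u" by (simp add: Mbar_def algebra_simps)
    also have "u = real n powr (- \<gamma> / (\<gamma> + 2))" by (simp add: u_def N_def powr_powr)
    finally have norm: "C2alpha_norm \<alpha> (2 * pi * real n / (real n - 1)) \<phi> \<le> Mbar * real n powr (- \<gamma> / (\<gamma> + 2))"
      using \<phi> by simp
    \<comment> \<open>As N^(\<gamma>+2) = n, this is R^(\<gamma>+2)/n, the number r of the
      claim.\<close>
    define q where "q = (R / N) powr (\<gamma> + 2)"
    have RN: "ca \<le> R / N" "R / N \<le> cb" using R N0 by (auto simp: a_def b_def field_simps)
    have "ca powr (\<gamma> + 2) \<le> q" "q \<le> cb powr (\<gamma> + 2)"
      unfolding q_def using RN cpos gamma by (auto intro!: powr_mono2)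
    hence q: "r0 < q" "q < r1" using G unfolding cpow r0_def r1_def by simp_all
    have R0: "R > 0" using R ab by simp
    have "q * real n = R powr (\<gamma> + 2)" using R0 N0 by (simp add: q_def nN powr_divide)
    hence "R = (q * real n) powr (1 / (\<gamma> + 2))" using R0 gamma by (simp add: powr_powr)
    with q \<phi> norm show ?thesis
      unfolding good_def H_radial[rule_format] by (intro exI[of _ R] exI[of _ \<phi>] conjI exI[of _ q]) simp_all
  qed
  hence "\<forall>n. \<exists>R \<phi>. n \<ge> nbar \<longrightarrow> good n R \<phi>" by blast
  from choice[OF this] obtain R where "\<forall>n. \<exists>\<phi>. n \<ge> nbar \<longrightarrow> good n (R n) \<phi>" by blast
  from choice[OF this] obtain \<phi> where "\<forall>n\<ge>nbar. good n (R n) (\<phi> n)" by blast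
  moreover have "nbar \<ge> 2" "0 < r0" "r0 < r1" using G by (auto simp: nbar_def r0_def r1_def)
  ultimately show ?thesis using Mbar unfolding good_def
    by (intro exI[of _ nbar] exI[of _ Mbar] exI[of _ R] exI[of _ \<phi>] exI[of _ r0] exI[of _ r1] conjI) assumption+
qed

end
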